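(* Let $d\ge 1$ be an integer, let $N,\delta,r,\sigma>0$, and let $v:\mathbb{R}^d\to\mathbb{C}$ and $w:[-r,r]^d\to\mathbb{C}$ be such that $$\|v\|_{L^1(\mathbb{R}^d)}\le (2\pi)^d N,\qquad \operatorname{supp}(v)\subseteq\Big\{x\in\mathbb{R}^d:\sum_{j=1}^d|x_j|\le\sigma\Big\},\qquad \|w-\mathcal{F}v\|_{L^\infty([-r,r]^d)}\le\delta<N.$$ Assume also that $v\in H^m(\mathbb{R}^d)$ for some integer $m>0$ and that $|v|_{H^m(\mathbb{R}^d)}\le\gamma$ for some $\gamma>0$. Then, for any $\tau\in[0,1]$, $$\|v-\mathcal{F}^{-1}\mathcal{C}^*_{\tau,\delta}[w]\|_{L^2(\mathbb{R}^d)}\le \big(20\sqrt{r}\big)^d\,N\,\big(L_\tau(\delta)\big)^{d/2+1}\Big(\frac{\delta}{N}\Big)^{(1-\tau)^2}+\gamma\,\big(rL_\tau(\delta)\big)^{-m}.$$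
   Context: Fourier transform: $\mathcal{F}v(\xi)=\frac{1}{(2\pi)^d}\int_{\mathbb{R}^d}e^{i\xi x}v(x)\,dx$, and $\mathcal{F}^{-1}u(x)=\int_{\mathbb{R}^d}e^{-i\xi x}u(\xi)\,d\xi$, for $\xi,x\in\mathbb{R}^d$, where $\xi x$ is the scalar product. $\mathbb{N}=\{0,1,2,\dots\}$. $H^m(\mathbb{R}^d)$ is the standard $L^2$-based Sobolev space of order $m$, with the seminorm $|v|_{H^m(\mathbb{R}^d)}=\Big(\sum_{j=1}^d\big\|\frac{\partial^m v}{(\partial x_j)^m}\big\|_{L^2(\mathbb{R}^d)}^2\Big)^{1/2}$. $T_k$ ($k\in\mathbb{N}$) are the Chebyshev polynomials, $T_k(t)=\cos(k\arccos t)$ for $t\in[-1,1]$, extended as polynomials to all $t\in\mathbb{R}$. $\mathbf{1}[k>0]$ equals $1$ if $k>0$ and $0$ otherwise. For a function $w$ on $[-r,r]^d$ and $k_1,\dots,k_d\in\mathbb{N}$ put $$a_{k_1,\dots,k_d}[w]=\int_{-r}^r\cdots\int_{-r}^r w(\xi)\prod_{j=1}^d\left(\frac{2^{\mathbf{1}[k_j>0]}\,T_{k_j}(\xi_j/r)}{\pi(r^2-\xi_j^2)^{1/2}}\right)d\xi_1\cdots d\xi_d.$$ For $R\ge r$ and $n\in\mathbb{N}$, $\mathcal{C}_{R,n}[w]:\mathbb{R}^d\to\mathbb{C}$ is defined by: $\mathcal{C}_{R,n}[w](\xi)=w(\xi)$ for $\xi\in[-r,r]^d$; $$\mathcal{C}_{R,n}[w](\xi)=\sum_{\substack{k_1,\dots,k_d\in\mathbb{N}\\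 k_1+\cdots+k_d<n}}a_{k_1,\dots,k_d}[w]\prod_{j=1}^dT_{k_j}\Big(\frac{\xi_j}{r}\Big)\quad\text{for }\xi\in[-R,R]^d\setminus[-r,r]^d;$$ and $\mathcal{C}_{R,n}[w](\xi)=0$ for $\xi\in\mathbb{R}^d\setminus[-R,R]^d$. (For $n=0$, $\mathcal{C}_{R,n}[w]$ is $0$ everywhere outside $[-r,r]^d$.) For $\tau\in[0,1]$ and $0<\delta<N$ define $$L_\tau(\delta)=\max\left\{1,\ \frac14\left(\frac{(1-\tau)\ln\frac{N}{\delta}}{r\sigma}\right)^{\tau}\right\}\quad(\text{so }L_0(\delta)=1),\qquad R_\tau(\delta)=rL_\tau(\delta),$$ $$n_\tau(\delta)=\left\lceil\frac{(2-\tau)\ln\frac N\delta}{\ln3+\frac1\tau\ln(4L_\tau(\delta))}\right\rceil\ \text{if }\tau>0,\qquad n_0(\delta)=0,$$ and $\mathcal{C}^*_{\tau,\delta}=\mathcal{C}_{R_\tau(\delta),n_\tau(\delta)}$. *)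

theory Defs
  imports
    "HOL-Analysis.Analysis"
    "HOL-Computational_Algebra.Polynomial"
    "HOL-Probability.Essential_Supremum"
begin

section \<open>Fourier transform\<close>

definition fourier :: "(real^'d \<Rightarrow> complex) \<Rightarrow> real^'d \<Rightarrow> complex" where
  "fourier v \<xi> =
     (1 / (2 * complex_of_real pi) ^ CARD('d)) *
     (LINT x|lebesgue. exp (\<i> * complex_of_real (\<xi> \<bullet> x)) * v x)"

definition inv_fourier :: "(real^'d \<Rightarrow> complex) \<Rightarrow> real^'d \<Rightarrow> complex" where
  "inv_fourier u x = (LINT \<xi>|lebesgue. exp (- \<i> * complex_of_real (\<xi> \<bullet> x)) * u \<xi>)"


section \<open>Square-integrable functions and essential support\<close>

definition square_integrable :: "(real^'d \<Rightarrow> complex) \<Rightarrow> bool" where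
  "square_integrable f \<longleftrightarrow>
     f \<in> borel_measurable lebesgue \<and> integrable lebesgue (\<lambda>x. (norm (f x))\<^sup>2)"

text \<open>Only meaningful for square-integrable \<open>f\<close>: the integral of a non-integrable function is 0.\<close>

definition L2_norm :: "(real^'d \<Rightarrow> complex) \<Rightarrow> real" where
  "L2_norm f = sqrt (LINT x|lebesgue. (norm (f x))\<^sup>2)"

text \<open>
  The support of an almost-everywhere class: the complement of the largest open set on which
  the function vanishes almost everywhere.  It is contained in the closure of
  \<open>{x. f x \<noteq> 0}\<close>.
\<close>

definition ess_support :: "(real^'d \<Rightarrow> complex) \<Rightarrow> (real^'d) set" where
  "ess_support f = - \<Union>{U. open U \<and> (AE x in lebesgue. x \<in> U \<longrightarrow> f x = 0)}"


section \<open>Weak derivatives and Sobolev spaces\<close>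

text \<open>
  A differential monomial of order \<open>k\<close> is given by the list of the \<open>k\<close> coordinates in which
  one differentiates; since test functions are smooth, the order within the list is irrelevant,
  so these lists stand for the multi-indices.
\<close>

definition partial :: "'d \<Rightarrow> (real^'d \<Rightarrow> complex) \<Rightarrow> real^'d \<Rightarrow> complex" where
  "partial j f x = frechet_derivative f (at x) (axis j 1)"

definition partials :: "'d list \<Rightarrow> (real^'d \<Rightarrow> complex) \<Rightarrow> real^'d \<Rightarrow> complex" where
  "partials js f = foldr partial js f"

text \<open>
  Infinite differentiability: if all iterated partial derivatives are differentiable then they
  are all continuous.
\<close>

definition test_function :: "(real^'d \<Rightarrow> complex) \<Rightarrow> bool" where
  "test_function \<phi> \<longleftrightarrow>
     (\<forall>js x. partials js \<phi> differentiable (at x)) \<and> compact (closure {x. \<phi> x \<noteq> 0})"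

definition locally_integrable :: "(real^'d \<Rightarrow> complex) \<Rightarrow> bool" where
  "locally_integrable f \<longleftrightarrow> (\<forall>K. compact K \<longrightarrow> f absolutely_integrable_on K)"

definition has_weak_derivative ::
    "(real^'d \<Rightarrow> complex) \<Rightarrow> 'd list \<Rightarrow> (real^'d \<Rightarrow> complex) \<Rightarrow> bool" where
  "has_weak_derivative v js g \<longleftrightarrow>
     locally_integrable v \<and> locally_integrable g \<and>
     (\<forall>\<phi>. test_function \<phi> \<longrightarrow>
        (LINT x|lebesgue. v x * partials js \<phi> x) =
        (-1) ^ length js * (LINT x|lebesgue. g x * \<phi> x))"

definition in_Sobolev :: "nat \<Rightarrow> (real^'d \<Rightarrow> complex) \<Rightarrow> bool" where
  "in_Sobolev m v \<longleftrightarrow>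
     square_integrable v \<and>
     (\<forall>js. length js \<le> m \<longrightarrow> (\<exists>g. square_integrable g \<and> has_weak_derivative v js g))"

text \<open>Weak derivatives are unique up to null sets, so norms do not depend on the choice.\<close>

definition weak_derivative ::
    "'d list \<Rightarrow> (real^'d \<Rightarrow> complex) \<Rightarrow> real^'d \<Rightarrow> complex" where
  "weak_derivative js v = (SOME g. has_weak_derivative v js g)"

definition Sobolev_seminorm :: "nat \<Rightarrow> (real^'d \<Rightarrow> complex) \<Rightarrow> real" where
  "Sobolev_seminorm m v =
     sqrt (\<Sum>j\<in>(UNIV :: 'd set). (L2_norm (weak_derivative (replicate m j) v))\<^sup>2)"


section \<open>Chebyshev polynomials\<close>

definition chebyshev :: "nat \<Rightarrow> real poly" where
  "chebyshev k = (THE p. \<forall>t\<in>{-1..1}. poly p t = cos (real k * arccos t))"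

lemma chebyshev_exists:
  "\<exists>p :: real poly. \<forall>t\<in>{-1..1}. poly p t = cos (real k * arccos t)"
proof (induction k rule: less_induct)
  case (less k)
  consider "k = 0" | "k = 1" | j where "k = j + 2"
    by (metis One_nat_def add_2_eq_Suc' not0_implies_Suc)
  then show ?case
  proof cases
    case 1
    then show ?thesis by (intro exI[of _ 1]) auto
  next
    case 2
    then show ?thesis by (intro exI[of _ "[:0, 1:]"]) auto
  next
    case 3
    obtain p q :: "real poly"
      where p: "\<forall>t\<in>{-1..1}. poly p t = cos (real j * arccos t)"
        and q: "\<forall>t\<in>{-1..1}. poly q t = cos (real (j + 1) * arccos t)"
      using less.IH[of j] less.IH[of "j + 1"] 3 by auto
    have "poly ([:0, 2:] * q - p) t = cos (real k * arccos t)" if t: "t \<in> {-1..1}" for t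
    proof -
      define \<theta> where "\<theta> = arccos t"
      have c: "cos \<theta> = t" using t by (simp add: \<theta>_def)
      have "cos (real k * \<theta>) = 2 * (cos (real (j + 1) * \<theta>) * cos \<theta>) - cos (real j * \<theta>)"
        unfolding cos_times_cos using 3 by (simp add: algebra_simps)
      then show ?thesis using p q t c by (simp add: \<theta>_def mult.commute)
    qed
    then show ?thesis by blast
  qed
qed

lemma poly_chebyshev:
  assumes "t \<in> {-1..1}"
  shows "poly (chebyshev k) t = cos (real k * arccos t)"
proof -
  have "\<exists>!p :: real poly. \<forall>t\<in>{-1..1}. poly p t = cos (real k * arccos t)"
  proof (rule ex_ex1I[OF chebyshev_exists])
    fix p q :: "real poly"
    assume p: "\<forall>t\<in>{-1..1}. poly p t = cos (real k * arccos t)"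
      and q: "\<forall>t\<in>{-1..1}. poly q t = cos (real k * arccos t)"
    have "{-1..1} \<subseteq> {t. poly (p - q) t = 0}" using p q by auto
    moreover have "infinite {-1..1::real}" by (simp add: infinite_Icc)
    ultimately have "p - q = 0" using poly_roots_finite finite_subset by blast
    then show "p = q" by simp
  qed
  from theI'[OF this] show ?thesis using assms unfolding chebyshev_def by blast
qed


section \<open>Chebyshev extrapolation\<close>

definition cube :: "real \<Rightarrow> (real^'d) set" where
  "cube r = cbox (vec (- r)) (vec r)"

definition cheb_coeff :: "real \<Rightarrow> (real^'d \<Rightarrow> complex) \<Rightarrow> ('d \<Rightarrow> nat) \<Rightarrow> complex" where
  "cheb_coeff r w k =
     (LINT \<xi>:cube r|lebesgue. w \<xi> *
        complex_of_real (\<Prod>j\<in>UNIV.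
          (2 ^ (if k j > 0 then 1 else 0) * poly (chebyshev (k j)) (\<xi> $ j / r)) /
          (pi * sqrt (r\<^sup>2 - (\<xi> $ j)\<^sup>2))))"

definition cheb_extend ::
    "real \<Rightarrow> real \<Rightarrow> nat \<Rightarrow> (real^'d \<Rightarrow> complex) \<Rightarrow> real^'d \<Rightarrow> complex" where
  "cheb_extend r R n w \<xi> =
     (if \<xi> \<in> cube r then w \<xi>
      else if \<xi> \<in> cube R then
        (\<Sum>k | (\<Sum>j\<in>UNIV. k j) < n.
           cheb_coeff r w k * complex_of_real (\<Prod>j\<in>UNIV. poly (chebyshev (k j)) (\<xi> $ j / r)))
      else 0)"

definition L_tau :: "real \<Rightarrow> real \<Rightarrow> real \<Rightarrow> real \<Rightarrow> real \<Rightarrow> real" where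
  "L_tau N r \<sigma> \<tau> \<delta> = max 1 (1 / 4 * ((1 - \<tau>) * ln (N / \<delta>) / (r * \<sigma>)) powr \<tau>)"

lemma L_tau_0: "L_tau N r \<sigma> 0 \<delta> = 1"
  by (simp add: L_tau_def)

definition R_tau :: "real \<Rightarrow> real \<Rightarrow> real \<Rightarrow> real \<Rightarrow> real \<Rightarrow> real" where
  "R_tau N r \<sigma> \<tau> \<delta> = r * L_tau N r \<sigma> \<tau> \<delta>"

definition n_tau :: "real \<Rightarrow> real \<Rightarrow> real \<Rightarrow> real \<Rightarrow> real \<Rightarrow> nat" where
  "n_tau N r \<sigma> \<tau> \<delta> =
     (if \<tau> > 0
      then nat \<lceil>(2 - \<tau>) * ln (N / \<delta>) / (ln 3 + 1 / \<tau> * ln (4 * L_tau N r \<sigma> \<tau> \<delta>))\<rceil>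
      else 0)"

definition cheb_star ::
    "real \<Rightarrow> real \<Rightarrow> real \<Rightarrow> real \<Rightarrow> real \<Rightarrow> (real^'d \<Rightarrow> complex) \<Rightarrow> real^'d \<Rightarrow> complex" where
  "cheb_star N r \<sigma> \<tau> \<delta> = cheb_extend r (R_tau N r \<sigma> \<tau> \<delta>) (n_tau N r \<sigma> \<tau> \<delta>)"

end

theory Submission
  imports Defs "HOL-Probability.Characteristic_Functions"
begin

text \<open>
  Write \<open>F\<close> for \<open>fourier\<close>, \<open>u\<close> for the extrapolated data, \<open>L\<close> for \<open>L_tau N r \<sigma> \<tau> \<delta>\<close> and \<open>R = r * L\<close>.
  By Plancherel the \<open>L2\<close> error of \<open>v - inv_fourier u\<close> is \<open>(2 * pi) ^ (d/2)\<close> times that of \<open>F v - u\<close>,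
  and the latter splits over the cube \<open>[-R, R]^d\<close> and its complement.

  Off the cube \<open>u\<close> vanishes. There some coordinate has modulus above \<open>R\<close>, and the transform of the
  \<open>m\<close>-th weak derivative in direction \<open>j\<close> has modulus \<open>\<bar>\<xi> $ j\<bar> ^ m * norm (F v \<xi>)\<close>; Bessel's inequality
  for these derivatives yields the term \<open>\<gamma> / R ^ m\<close> (\<open>Sobolev_fourier_tail\<close>).

  On the cube \<open>u\<close> differs from \<open>F v\<close> by at most \<open>5 ^ d * N * (\<delta> / N) powr ((1 - \<tau>)\<^sup>2)\<close> almost everywhere,
  which integrates to the first term because \<open>5 * sqrt (4 * pi) \<le> 20\<close>. On \<open>[-r, r]^d\<close> this is the
  hypothesis on the data. On the remaining shell, which is empty unless \<open>L > 1\<close>, there are two errors.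
  Put \<open>L = (z + 1 / z) / 2\<close> with \<open>z \<ge> 1\<close>; then \<open>\<bar>T_k t\<bar> \<le> z ^ k\<close> for \<open>\<bar>t\<bar> \<le> L\<close>.

  The noise \<open>w - F v\<close> has Chebyshev coefficients of size \<open>\<delta>\<close>, up to a factor 2 for each nonzero index,
  so it is amplified to at most \<open>\<delta> * 3 ^ d * (2 * z) ^ (n - 1)\<close> (\<open>noise_bound\<close>). The truncation error of the
  expansion of \<open>F v\<close> is a superposition over \<open>x\<close> in the support of \<open>v\<close> of the errors for the plane waves
  \<open>cis (x \<bullet> \<xi>)\<close>. Monomials have nonnegative Chebyshev coefficients, so the expansion of \<open>exp (\<i> * s * t)\<close> is
  majorised at \<open>\<bar>t\<bar> \<le> L\<close> by that of \<open>exp (\<bar>s\<bar> * t)\<close> at \<open>t = L\<close>; inserting factors \<open>\<rho> ^ (k - n) \<ge> 1\<close> in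
  the discarded terms and absorbing them by enlarging the argument from \<open>L\<close> to at most \<open>\<rho> * L\<close> bounds the
  error by \<open>2 ^ d * exp (r * \<rho> * L * \<sigma>) / \<rho> ^ n\<close> (\<open>wave_truncation\<close>). For
  \<open>\<rho> = (4 * L) powr (1 / \<tau>) / L\<close> the prescribed \<open>L\<close> and \<open>n\<close> give both errors the same order
  (\<open>extrapolation_parameters\<close>).

  Only two consequences of Plancherel's theorem are used, and both come from one identity regularised
  by a Gaussian (\<open>FT_product_gaussian\<close>): Bessel's inequality, and Parseval's formula against continuous
  functions of compact support. A function whose pairings with all of these are bounded by
  \<open>C\<close> times their \<open>L2\<close> norms has \<open>L2\<close> norm at most \<open>C\<close> (\<open>L2_bound_by_duality\<close>). Weak derivatives are
  handled by testing with smooth cutoffs of plane waves, which turns the definition of a weak derivative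
  into an identity between Fourier transforms.
\<close>

section \<open>Gaussians and their Fourier transforms\<close>

lemma lborel_prod_Basis:
  fixes f :: "'a::euclidean_space \<Rightarrow> real \<Rightarrow> 'c::{real_normed_field,banach,second_countable_topology}"
  assumes "\<And>b. b \<in> Basis \<Longrightarrow> integrable lborel (f b)"
  shows "integrable lborel (\<lambda>x. \<Prod>b\<in>Basis. f b (x \<bullet> b))"
    and "(LINT x|lborel. (\<Prod>b\<in>Basis. f b (x \<bullet> b))) = (\<Prod>b\<in>Basis. LINT t|lborel. f b t)"
proof -
  interpret product_sigma_finite "\<lambda>_::'a. lborel :: real measure" ..
  have [measurable]: "f b \<in> borel_measurable borel" if "b \<in> Basis" for b
    using assms[OF that] by (simp add: borel_measurable_integrable flip: measurable_lborel2)
  have *: "(\<Prod>b\<in>Basis. f b ((\<Sum>c\<in>Basis. g c *\<^sub>R c) \<bullet> b)) = (\<Prod>b\<in>Basis. f b (g b))" for g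
    by (intro prod.cong refl) (simp add: inner_sum_left inner_Basis if_distrib cong: if_cong)
  have meas: "(\<lambda>x. \<Prod>b\<in>Basis. f b (x \<bullet> b)) \<in> borel_measurable (borel :: 'a measure)"
    by measurable
  have [measurable]: "(\<lambda>g. \<Sum>c\<in>Basis. g c *\<^sub>R c) \<in> measurable (\<Pi>\<^sub>M b\<in>Basis. lborel) (borel :: 'a measure)"
    by measurable
  show "integrable lborel (\<lambda>x. \<Prod>b\<in>Basis. f b (x \<bullet> b))"
    unfolding lborel_eq[where 'a='a]
    by (subst integrable_distr_eq) (use meas product_integrable_prod[of Basis f] assms in \<open>auto simp: *\<close>)
  show "(LINT x|lborel. (\<Prod>b\<in>Basis. f b (x \<bullet> b))) = (\<Prod>b\<in>Basis. LINT t|lborel. f b t)"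
    unfolding lborel_eq[where 'a='a]
    by (subst integral_distr) (use meas product_integral_prod[of Basis f] assms in \<open>auto simp: *\<close>)
qed

text \<open>
  The transform is taken with respect to the Borel measure \<open>lborel\<close>, for which Fubini's theorem on product
  measures is available; results for \<open>lebesgue\<close> follow by passing to a Borel representative.
\<close>
definition FT :: "('a::euclidean_space \<Rightarrow> complex) \<Rightarrow> 'a \<Rightarrow> complex" where
  "FT f \<xi> = (LINT x|lborel. cis (\<xi> \<bullet> x) * f x)"

lemma measurable_cis[measurable]: "cis \<in> borel_measurable borel"
  by (intro borel_measurable_continuous_onI continuous_intros)

lemma integrable_cis_mult:
  assumes "integrable lborel f"
  shows "integrable lborel (\<lambda>x::'a::euclidean_space. cis (\<xi> \<bullet> x) * f x)"
  by (rule Bochner_Integration.integrable_bound[OF assms])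
     (use borel_measurable_integrable[OF assms] in \<open>auto simp: norm_mult\<close>)

lemma FT_measurable[measurable]:
  assumes "f \<in> borel_measurable borel"
  shows "FT f \<in> borel_measurable (borel :: 'a::euclidean_space measure)"
proof -
  have [measurable]: "f \<in> borel_measurable lborel" using assms by simp
  show ?thesis unfolding FT_def[abs_def]
    by (intro lborel.borel_measurable_lebesgue_integral) measurable
qed

lemma norm_FT_le:
  "norm (FT f \<xi>) \<le> (LINT x|lborel. norm (f x))"
proof -
  have "norm (FT f \<xi>) \<le> (LINT x|lborel. norm (cis (\<xi> \<bullet> x) * f x))"
    unfolding FT_def by (rule integral_norm_bound)
  then show ?thesis by (simp add: norm_mult)
qed

text \<open>
  As \<open>s\<close> tends to 0 the factor \<open>gaussian s\<close> tends to 1; it makes Fourier integrals absolutely convergent.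
\<close>
definition gaussian :: "real \<Rightarrow> 'a::euclidean_space \<Rightarrow> real" where
  "gaussian s x = exp (- (s\<^sup>2 * (norm x)\<^sup>2) / 2)"

text \<open>
  The density of the centred normal law with standard deviation \<open>s\<close> in each coordinate; an approximate
  identity as \<open>s\<close> tends to 0.
\<close>
definition heat_kernel :: "real \<Rightarrow> 'a::euclidean_space \<Rightarrow> real" where
  "heat_kernel s z = (\<Prod>b\<in>Basis. normal_density 0 s (z \<bullet> b))"

lemma gaussian_prod: "gaussian s x = (\<Prod>b\<in>Basis. exp (- (s\<^sup>2 * (x \<bullet> b)\<^sup>2) / 2))"
  unfolding gaussian_def norm_eq_sqrt_inner
  by (subst euclidean_inner) (simp flip: exp_sum add: sum_distrib_left sum_negf sum_divide_distrib sum_nonneg power2_eq_square)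

lemma heat_kernel_nonneg: "heat_kernel s z \<ge> 0"
  unfolding heat_kernel_def by (intro prod_nonneg) auto

lemma heat_kernel_measurable[measurable]: "heat_kernel s \<in> borel_measurable (borel :: 'a::euclidean_space measure)"
  unfolding heat_kernel_def[abs_def] by measurable

lemma gaussian_measurable[measurable]: "gaussian s \<in> borel_measurable (borel :: 'a::euclidean_space measure)"
  unfolding gaussian_def[abs_def] by measurable

lemma heat_kernel_integral:
  assumes "s > 0"
  shows "integrable lborel (heat_kernel s :: 'a::euclidean_space \<Rightarrow> real)" "(LINT z|lborel. heat_kernel s (z::'a)) = 1"
  unfolding heat_kernel_def[abs_def] using lborel_prod_Basis[of "\<lambda>_::'a. normal_density 0 s"] assms by auto

text \<open>
  This is the characteristic function of the standard normal law after the substitution \<open>t \<mapsto> s * t\<close>.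
\<close>
lemma gaussian_FT_1:
  assumes "s > 0"
  shows "integrable lborel (\<lambda>t. cis (t * z) * of_real (exp (- (s\<^sup>2 * t\<^sup>2) / 2)))"
    and "(LINT t|lborel. cis (t * z) * of_real (exp (- (s\<^sup>2 * t\<^sup>2) / 2))) =
      complex_of_real (2 * pi * normal_density 0 s z)"
proof -
  have nd: "exp (- (s\<^sup>2 * t\<^sup>2) / 2) = (sqrt (2 * pi) / s) * normal_density 0 (1/s) t" for t
    using assms by (simp add: normal_density_def real_sqrt_mult real_sqrt_divide field_simps)
  have int: "integrable lborel (\<lambda>t. exp (- (s\<^sup>2 * t\<^sup>2) / 2))"
    unfolding nd using assms by (intro integrable_mult_right) auto
  show "integrable lborel (\<lambda>t. cis (t * z) * of_real (exp (- (s\<^sup>2 * t\<^sup>2) / 2)))"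
    by (rule Bochner_Integration.integrable_bound[OF int]) (auto simp: norm_mult)
  have "char std_normal_distribution (z / s) = (CLINT t|lborel. std_normal_density t *\<^sub>R iexp (z / s * t))"
    unfolding char_def by (subst integral_density) auto
  then have c: "(CLINT t|lborel. std_normal_density t *\<^sub>R iexp (z / s * t)) = complex_of_real (exp (- ((z/s)\<^sup>2) / 2))"
    by (simp add: char_std_normal_distribution)
  have "(CLINT t|lborel. std_normal_density t *\<^sub>R iexp (z / s * t)) =
     s *\<^sub>R (CLINT t|lborel. std_normal_density (s * t) *\<^sub>R iexp (z / s * (s * t)))"
    using assms by (subst lborel_integral_real_affine[of s _ 0]) auto
  also have "(CLINT t|lborel. std_normal_density (s * t) *\<^sub>R iexp (z / s * (s * t))) =
     (1 / sqrt (2 * pi)) *\<^sub>R (LINT t|lborel. cis (t * z) * of_real (exp (- (s\<^sup>2 * t\<^sup>2) / 2)))"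
    using assms by (subst integral_scaleR_right[symmetric], intro Bochner_Integration.integral_cong)
      (auto simp: std_normal_density_def power_mult_distrib scaleR_conv_of_real cis_conv_exp mult_ac exp_of_real)
  finally have "(LINT t|lborel. cis (t * z) * of_real (exp (- (s\<^sup>2 * t\<^sup>2) / 2))) =
     (sqrt (2 * pi) / s) *\<^sub>R complex_of_real (exp (- ((z/s)\<^sup>2) / 2))"
    using assms c by (simp add: field_simps scaleR_conv_of_real)
  also have "\<dots> = complex_of_real ((sqrt (2 * pi) / s) * exp (- ((z/s)\<^sup>2) / 2))"
    by (simp add: scaleR_conv_of_real)
  also have "(sqrt (2 * pi) / s) * exp (- ((z/s)\<^sup>2) / 2) = 2 * pi * normal_density 0 s z"
    using assms by (simp add: normal_density_def real_sqrt_mult real_sqrt_divide field_simps power_divide)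
  finally show "(LINT t|lborel. cis (t * z) * of_real (exp (- (s\<^sup>2 * t\<^sup>2) / 2))) =
      complex_of_real (2 * pi * normal_density 0 s z)" .
qed

lemma prod_cis: "finite A \<Longrightarrow> (\<Prod>a\<in>A. cis (f a)) = cis (\<Sum>a\<in>A. f a)"
  by (induction A rule: finite_induct) (auto simp: cis_mult)

lemma gaussian_FT:
  fixes z :: "'a::euclidean_space"
  assumes "s > 0"
  shows "integrable lborel (\<lambda>\<xi>. gaussian s (\<xi>::'a))"
    and "FT (\<lambda>\<xi>. complex_of_real (gaussian s \<xi>)) z = of_real ((2 * pi) ^ DIM('a) * heat_kernel s z)"
proof -
  define h where "h b t = cis (t * (z \<bullet> b)) * complex_of_real (exp (- (s\<^sup>2 * t\<^sup>2) / 2))" for b t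
  have h: "integrable lborel (h b)" "(LINT t|lborel. h b t) = complex_of_real (2 * pi * normal_density 0 s (z \<bullet> b))" for b
    using gaussian_FT_1[OF assms, of "z \<bullet> b"] unfolding h_def[abs_def] by auto
  have "cis (z \<bullet> \<xi>) * complex_of_real (gaussian s \<xi>) = (\<Prod>b\<in>Basis. h b (\<xi> \<bullet> b))" for \<xi>
    unfolding gaussian_prod h_def prod.distrib prod_cis[OF finite_Basis] of_real_prod
    by (subst euclidean_inner) (simp add: mult.commute)
  then show "FT (\<lambda>\<xi>. complex_of_real (gaussian s \<xi>)) z = of_real ((2 * pi) ^ DIM('a) * heat_kernel s z)"
    unfolding FT_def heat_kernel_def using lborel_prod_Basis(2)[of h] h
    by (simp add: prod.distrib)
  have "integrable lborel (\<lambda>t. exp (- (s\<^sup>2 * t\<^sup>2) / 2))"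
    using integrable_norm[OF gaussian_FT_1(1)[OF assms, of 0]] by simp
  then show "integrable lborel (\<lambda>\<xi>. gaussian s (\<xi>::'a))"
    unfolding gaussian_prod using lborel_prod_Basis(1)[of "\<lambda>_::'a. \<lambda>t. exp (- (s\<^sup>2 * t\<^sup>2) / 2)"] by simp
qed

section \<open>Regularised Parseval identity\<close>

lemma lborel_integral_affine:
  fixes f :: "'a::euclidean_space \<Rightarrow> 'b::{banach, second_countable_topology}"
  assumes [measurable]: "f \<in> borel_measurable borel" and c: "c \<noteq> 0"
  shows "integrable lborel (\<lambda>x. f (t + c *\<^sub>R x)) \<longleftrightarrow> integrable lborel f"
    and "(LINT x|lborel. f x) = \<bar>c\<bar> ^ DIM('a) *\<^sub>R (LINT x|lborel. f (t + c *\<^sub>R x))"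
proof -
  have eq: "(lborel :: 'a measure) = density (distr lborel borel (\<lambda>x. t + c *\<^sub>R x)) (\<lambda>_. ennreal (\<bar>c\<bar>^DIM('a)))"
    using lborel_affine[OF c, of t] by (simp add: ennreal_power)
  have "integrable lborel f \<longleftrightarrow> integrable lborel (\<lambda>x. \<bar>c\<bar> ^ DIM('a) *\<^sub>R f (t + c *\<^sub>R x))"
    by (subst eq, subst integrable_density) (auto simp: integrable_distr_eq)
  then show "integrable lborel (\<lambda>x. f (t + c *\<^sub>R x)) \<longleftrightarrow> integrable lborel f"
    using c integrable_scaleR_right[of "1 / \<bar>c\<bar> ^ DIM('a)" lborel "\<lambda>x. \<bar>c\<bar> ^ DIM('a) *\<^sub>R f (t + c *\<^sub>R x)"]
      integrable_scaleR_right[of "\<bar>c\<bar> ^ DIM('a)" lborel "\<lambda>x. f (t + c *\<^sub>R x)"] by auto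
  have "(LINT x|lborel. f x) = (LINT x|lborel. \<bar>c\<bar> ^ DIM('a) *\<^sub>R f (t + c *\<^sub>R x))"
    by (subst eq, subst integral_density) (auto simp: integral_distr)
  then show "(LINT x|lborel. f x) = \<bar>c\<bar> ^ DIM('a) *\<^sub>R (LINT x|lborel. f (t + c *\<^sub>R x))"
    by simp
qed

lemma integrable_ball: "integrable lborel (\<lambda>x::'a::euclidean_space. indicator (cball 0 r) x :: real)"
  using lmeasurable_cball[of "0::'a" r] by (simp add: fmeasurable_def)

lemma integrable_dominated:
  fixes f :: "'a \<Rightarrow> 'b::{banach, second_countable_topology}" and g :: "'a \<Rightarrow> real"
  assumes g: "integrable M g" and f: "f \<in> borel_measurable M" and le: "\<And>x. norm (f x) \<le> g x"
  shows "integrable M f"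
proof (rule Bochner_Integration.integrable_bound[OF g f], rule AE_I2)
  show "norm (f x) \<le> norm (g x)" for x
    unfolding real_norm_def by (rule order_trans[OF le abs_ge_self])
qed

text \<open>
  Fatou's lemma in the form in which regularised bounds pass to the limit: integrability of the limit
  comes for free.
\<close>
lemma fatou_bound:
  fixes f :: "nat \<Rightarrow> 'a \<Rightarrow> real"
  assumes int: "\<And>n. integrable M (f n)" and nn: "\<And>n x. f n x \<ge> 0"
    and bd: "\<And>n. (LINT x|M. f n x) \<le> C"
    and g: "g \<in> borel_measurable M" and lim: "AE x in M. (\<lambda>n. f n x) \<longlonglongrightarrow> g x"
  shows "integrable M g" "(LINT x|M. g x) \<le> C"
proof -
  have C: "C \<ge> 0" using order_trans[OF Bochner_Integration.integral_nonneg bd] nn by blast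
  have gn: "AE x in M. g x \<ge> 0"
    using lim by eventually_elim (rule LIMSEQ_le_const, auto simp: nn)
  have "(\<integral>\<^sup>+x. ennreal (g x) \<partial>M) = (\<integral>\<^sup>+x. liminf (\<lambda>n. ennreal (f n x)) \<partial>M)"
  proof (rule nn_integral_cong_AE)
    show "AE x in M. ennreal (g x) = liminf (\<lambda>n. ennreal (f n x))"
      using lim
    proof eventually_elim
      case (elim x)
      then have "(\<lambda>n. ennreal (f n x)) \<longlonglongrightarrow> ennreal (g x)" by (rule tendsto_ennrealI)
      then show ?case by (simp add: lim_imp_Liminf)
    qed
  qed
  also have "\<dots> \<le> liminf (\<lambda>n. \<integral>\<^sup>+x. ennreal (f n x) \<partial>M)"
    by (rule nn_integral_liminf) (use int in auto)
  also have "\<dots> \<le> ennreal C"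
  proof (rule Liminf_le)
    show "\<forall>\<^sub>F n in sequentially. (\<integral>\<^sup>+x. ennreal (f n x) \<partial>M) \<le> ennreal C"
      using bd int nn by (intro always_eventually allI, subst nn_integral_eq_integral) (auto intro: ennreal_leI)
  qed simp
  finally have le: "(\<integral>\<^sup>+x. ennreal (g x) \<partial>M) \<le> ennreal C" .
  show gi: "integrable M g"
    by (rule integrableI_nonneg[OF g gn]) (use le in \<open>simp add: order_le_less_trans\<close>)
  show "(LINT x|M. g x) \<le> C"
    using le nn_integral_eq_integral[OF gi gn] C by simp
qed

text \<open>
  Integrate Young's inequality \<open>a * b \<le> (t * a\<^sup>2 + b\<^sup>2 / t) / 2\<close> and choose the optimal \<open>t\<close>.
\<close>
lemma cauchy_schwarz_integral:
  fixes f g :: "'a \<Rightarrow> complex"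
  assumes [measurable]: "f \<in> borel_measurable M" "g \<in> borel_measurable M"
    and f: "integrable M (\<lambda>x. (norm (f x))\<^sup>2)" and g: "integrable M (\<lambda>x. (norm (g x))\<^sup>2)"
  shows "integrable M (\<lambda>x. f x * g x)"
    and "norm (LINT x|M. f x * g x) \<le> sqrt (LINT x|M. (norm (f x))\<^sup>2) * sqrt (LINT x|M. (norm (g x))\<^sup>2)"
proof -
  let ?F = "LINT x|M. (norm (f x))\<^sup>2" and ?G = "LINT x|M. (norm (g x))\<^sup>2"
  have young: "norm (f x * g x) \<le> (t * (norm (f x))\<^sup>2 + (norm (g x))\<^sup>2 / t) / 2" if "t > 0" for t x
  proof -
    have "0 \<le> (sqrt t * norm (f x) - norm (g x) / sqrt t)\<^sup>2" by simp
    also have "\<dots> = t * (norm (f x))\<^sup>2 + (norm (g x))\<^sup>2 / t - 2 * (norm (f x) * norm (g x))"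
      using that by (simp add: power2_diff power_mult_distrib power_divide)
    finally show ?thesis by (simp add: norm_mult)
  qed
  show int: "integrable M (\<lambda>x. f x * g x)"
    by (rule Bochner_Integration.integrable_bound[of _ "\<lambda>x. (1 * (norm (f x))\<^sup>2 + (norm (g x))\<^sup>2 / 1) / 2"])
      (use f g young[of 1] in \<open>auto simp: abs_of_nonneg\<close>)
  have bd: "norm (LINT x|M. f x * g x) \<le> (t * ?F + ?G / t) / 2" if "t > 0" for t
  proof -
    have "norm (LINT x|M. f x * g x) \<le> (LINT x|M. norm (f x * g x))" by (rule integral_norm_bound)
    also have "\<dots> \<le> (LINT x|M. (t * (norm (f x))\<^sup>2 + (norm (g x))\<^sup>2 / t) / 2)"
      by (rule integral_mono) (use f g int young[OF that] in auto)
    finally show ?thesis using f g by simp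
  qed
  have F0: "?F \<ge> 0" and G0: "?G \<ge> 0" by (auto intro: Bochner_Integration.integral_nonneg)
  show "norm (LINT x|M. f x * g x) \<le> sqrt ?F * sqrt ?G"
  proof (cases "?F > 0 \<and> ?G > 0")
    case True
    then have "sqrt ?G / sqrt ?F * ?F = sqrt ?F * sqrt ?G" "?G / (sqrt ?G / sqrt ?F) = sqrt ?F * sqrt ?G"
      by (auto simp: field_simps)
    then show ?thesis using bd[of "sqrt ?G / sqrt ?F"] True by auto
  next
    case False
    then have "(AE x in M. f x = 0) \<or> (AE x in M. g x = 0)"
      using F0 G0 integral_nonneg_eq_0_iff_AE[OF f] integral_nonneg_eq_0_iff_AE[OF g] by auto
    then have "AE x in M. f x * g x = 0" by auto
    then have "(LINT x|M. f x * g x) = 0" by (rule integral_eq_zero_AE)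
    then show ?thesis using F0 G0 by simp
  qed
qed

lemma integrable_pair_mult:
  fixes f :: "'a::euclidean_space \<Rightarrow> complex" and g :: "'b::euclidean_space \<Rightarrow> complex"
  assumes f: "integrable lborel f" and g: "integrable lborel g"
  shows "integrable (lborel \<Otimes>\<^sub>M lborel) (\<lambda>(x, y). f x * g y)"
proof -
  have [measurable]: "f \<in> borel_measurable lborel" "g \<in> borel_measurable lborel"
    using f g by auto
  show ?thesis
    by (rule lborel_pair.Fubini_integrable) (use f g in \<open>auto simp: norm_mult\<close>)
qed

lemma heat_kernel_bounded: "s > 0 \<Longrightarrow> (2 * pi) ^ DIM('a) * heat_kernel s (z::'a::euclidean_space) \<le> (LINT \<xi>|lborel. gaussian s (\<xi>::'a))"
proof -
  assume s: "s > 0"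
  have "norm (FT (\<lambda>\<xi>. complex_of_real (gaussian s \<xi>)) z) \<le> (LINT \<xi>|lborel. norm (complex_of_real (gaussian s (\<xi>::'a))))"
    by (rule norm_FT_le)
  then show ?thesis unfolding gaussian_FT(2)[OF s]
    by (simp add: norm_mult norm_power heat_kernel_nonneg) (simp add: gaussian_def)
qed

text \<open>
  With the Gaussian factor the triple integral in \<open>x\<close>, \<open>y\<close> and \<open>\<xi>\<close> converges absolutely; integrating in \<open>\<xi>\<close> first
  produces the heat kernel. Bessel's inequality and Parseval's formula are the limits \<open>s \<rightarrow> 0\<close> of this identity.
\<close>
lemma FT_product_gaussian:
  fixes f g :: "'a::euclidean_space \<Rightarrow> complex"
  assumes f: "integrable lborel f" and g: "integrable lborel g" and s: "s > 0"
  shows "integrable (lborel \<Otimes>\<^sub>M lborel) (\<lambda>(x, y). f x * g y * of_real (heat_kernel s (x - y)))"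
    and "(LINT \<xi>|lborel. FT f \<xi> * FT g (-\<xi>) * of_real (gaussian s \<xi>)) =
      of_real ((2 * pi) ^ DIM('a)) * (LINT (x, y)|(lborel \<Otimes>\<^sub>M lborel). f x * g y * of_real (heat_kernel s (x - y)))"
proof -
  have [measurable]: "f \<in> borel_measurable borel" "g \<in> borel_measurable borel"
    using f g by auto
  let ?P = "lborel \<Otimes>\<^sub>M lborel :: ('a \<times> 'a) measure"
  interpret T: pair_sigma_finite lborel ?P ..
  let ?C = "LINT \<xi>|lborel. gaussian s (\<xi>::'a)"
  note fg = integrable_pair_mult[OF f g]
  show "integrable ?P (\<lambda>(x, y). f x * g y * of_real (heat_kernel s (x - y)))"
  proof (rule Bochner_Integration.integrable_bound[of _ "\<lambda>p. ?C * (case p of (x, y) \<Rightarrow> f x * g y)"])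
    have "heat_kernel s z \<le> ?C" for z :: 'a
    proof -
      have "heat_kernel s z * 1 \<le> heat_kernel s z * (2 * pi) ^ DIM('a)"
        using pi_gt3 by (intro mult_left_mono heat_kernel_nonneg one_le_power) auto
      then show ?thesis using heat_kernel_bounded[OF s, of z] by (simp add: mult.commute)
    qed
    moreover from this[of 0] have "?C \<ge> 0" using heat_kernel_nonneg[of s "0::'a"] by linarith
    ultimately show "AE p in ?P. norm (case p of (x, y) \<Rightarrow> f x * g y * of_real (heat_kernel s (x - y)))
      \<le> norm (complex_of_real ?C * (case p of (x, y) \<Rightarrow> f x * g y))"
      by (intro AE_I2) (auto simp: norm_mult heat_kernel_nonneg mult.commute[of _ "heat_kernel s _"] split: prod.split intro!: mult_right_mono)
  qed (use fg in auto)
  \<comment> \<open>the integrand before either integration, as a function of the frequency and of the pair of positions\<close>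
  define H where "H \<xi> p = (case p of (x, y) \<Rightarrow> cis (\<xi> \<bullet> (x - y)) * of_real (gaussian s \<xi>) * (f x * g y))" for \<xi> p
  have [measurable]: "(\<lambda>(\<xi>, p). H \<xi> p) \<in> borel_measurable (lborel \<Otimes>\<^sub>M ?P)"
    unfolding H_def[abs_def] by measurable
  have Hint: "integrable (lborel \<Otimes>\<^sub>M ?P) (\<lambda>(\<xi>, p). H \<xi> p)"
  proof (rule T.Fubini_integrable)
    have "(LINT p|?P. norm (H \<xi> p)) = gaussian s \<xi> * (LINT p|?P. norm (case p of (x, y) \<Rightarrow> f x * g y))" for \<xi>
    proof -
      have "norm (H \<xi> p) = gaussian s \<xi> * norm (case p of (x, y) \<Rightarrow> f x * g y)" for p
        by (auto simp: H_def norm_mult gaussian_def split: prod.splits)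
      then show ?thesis by simp
    qed
    then show "integrable lborel (\<lambda>\<xi>. LINT p|?P. norm (case (\<xi>, p) of (\<xi>, p) \<Rightarrow> H \<xi> p))"
      by (simp add: gaussian_FT(1)[OF s])
    show "AE \<xi> in lborel. integrable ?P (\<lambda>p. case (\<xi>, p) of (\<xi>, p) \<Rightarrow> H \<xi> p)"
    proof (rule AE_I2)
      fix \<xi> :: 'a
      have le: "norm (H \<xi> p) \<le> norm (complex_of_real (gaussian s \<xi>) * (case p of (x, y) \<Rightarrow> f x * g y))" for p
        by (auto simp: H_def norm_mult split: prod.splits)
      have "H \<xi> \<in> borel_measurable ?P"
        unfolding H_def[abs_def] by measurable
      then have "integrable ?P (H \<xi>)"
        by (rule Bochner_Integration.integrable_bound[OF integrable_mult_right[OF fg]]) (rule AE_I2[OF le])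
      then show "integrable ?P (\<lambda>p. case (\<xi>, p) of (\<xi>, p) \<Rightarrow> H \<xi> p)"
        unfolding prod.case .
    qed
  qed simp
  have lhs: "FT f \<xi> * FT g (-\<xi>) * of_real (gaussian s \<xi>) = (LINT p|?P. H \<xi> p)" for \<xi>
  proof -
    have "FT f \<xi> * FT g (-\<xi>) = (LINT x|lborel. cis (\<xi> \<bullet> x) * f x * (LINT y|lborel. cis (- \<xi> \<bullet> y) * g y))"
      unfolding FT_def by (rule integral_mult_left_zero[symmetric])
    also have "\<dots> = (LINT x|lborel. (LINT y|lborel. (cis (\<xi> \<bullet> x) * f x) * (cis (- \<xi> \<bullet> y) * g y)))"
      by (subst integral_mult_right_zero) (rule refl)
    also have "\<dots> = (LINT p|?P. (case p of (x, y) \<Rightarrow> (cis (\<xi> \<bullet> x) * f x) * (cis (- \<xi> \<bullet> y) * g y)))"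
      by (rule lborel_pair.integral_fst) (use integrable_pair_mult[OF integrable_cis_mult[OF f, of \<xi>] integrable_cis_mult[OF g, of "- \<xi>"]] in simp)
    finally have "FT f \<xi> * FT g (-\<xi>) * of_real (gaussian s \<xi>) = 
       (LINT p|?P. (case p of (x, y) \<Rightarrow> (cis (\<xi> \<bullet> x) * f x) * (cis (- \<xi> \<bullet> y) * g y))) * of_real (gaussian s \<xi>)" by simp
    also have "\<dots> = (LINT p|?P. (case p of (x, y) \<Rightarrow> (cis (\<xi> \<bullet> x) * f x) * (cis (- \<xi> \<bullet> y) * g y)) * of_real (gaussian s \<xi>))"
      by (rule integral_mult_left_zero[symmetric])
    also have "\<dots> = (LINT p|?P. H \<xi> p)"
    proof (rule Bochner_Integration.integral_cong)
      have "cis (\<xi> \<bullet> (x - y)) = cis (\<xi> \<bullet> x) * cis (- \<xi> \<bullet> y)" for x y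
        by (simp add: cis_mult inner_diff_right)
      then show "(case p of (x, y) \<Rightarrow> (cis (\<xi> \<bullet> x) * f x) * (cis (- \<xi> \<bullet> y) * g y)) * of_real (gaussian s \<xi>) = H \<xi> p" for p
        by (auto simp: H_def split: prod.split)
    qed simp
    finally show ?thesis .
  qed
  have "(LINT \<xi>|lborel. FT f \<xi> * FT g (-\<xi>) * of_real (gaussian s \<xi>)) = (LINT \<xi>|lborel. LINT p|?P. H \<xi> p)"
    using lhs by simp
  also have "\<dots> = (LINT p|?P. LINT \<xi>|lborel. H \<xi> p)"
    by (rule T.Fubini_integral[symmetric]) (use Hint in simp)
  also have "\<dots> = (LINT p|?P. of_real ((2 * pi) ^ DIM('a)) * (case p of (x, y) \<Rightarrow> f x * g y * of_real (heat_kernel s (x - y))))"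
  proof (rule Bochner_Integration.integral_cong)
    fix p :: "'a \<times> 'a"
    obtain x y where p: "p = (x, y)" by (cases p)
    have "(LINT \<xi>|lborel. H \<xi> p) = (LINT \<xi>|lborel. cis ((x - y) \<bullet> \<xi>) * of_real (gaussian s \<xi>)) * (f x * g y)"
      by (subst integral_mult_left_zero[symmetric]) (simp add: H_def p inner_commute)
    then show "(LINT \<xi>|lborel. H \<xi> p) = of_real ((2 * pi) ^ DIM('a)) * (case p of (x, y) \<Rightarrow> f x * g y * of_real (heat_kernel s (x - y)))"
      using gaussian_FT(2)[OF s, of "x - y"] by (simp add: FT_def p)
  qed simp
  also have "\<dots> = of_real ((2 * pi) ^ DIM('a)) * (LINT p|?P. (case p of (x, y) \<Rightarrow> f x * g y * of_real (heat_kernel s (x - y))))"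
    by (rule integral_mult_right_zero)
  finally show "(LINT \<xi>|lborel. FT f \<xi> * FT g (-\<xi>) * of_real (gaussian s \<xi>)) =
      of_real ((2 * pi) ^ DIM('a)) * (LINT (x, y)|?P. f x * g y * of_real (heat_kernel s (x - y)))" .
qed

section \<open>Bessel inequality and Parseval formula\<close>

lemma heat_kernel_minus: "heat_kernel s (- z) = heat_kernel s z"
  unfolding heat_kernel_def by (simp add: normal_density_def)

lemma heat_kernel_scale:
  assumes "s > 0"
  shows "s ^ DIM('a) * heat_kernel s (s *\<^sub>R z :: 'a::euclidean_space) = heat_kernel 1 z"
proof -
  have "s * normal_density 0 s (s * t) = normal_density 0 1 t" for t
    using assms by (simp add: normal_density_def real_sqrt_mult power_mult_distrib)
  then have "(\<Prod>b\<in>Basis. s * normal_density 0 s (s * (z \<bullet> b))) = (\<Prod>b\<in>Basis. normal_density 0 1 (z \<bullet> b))"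
    by simp
  then show ?thesis unfolding heat_kernel_def by (simp add: prod.distrib)
qed

lemma heat_kernel_integral_shift:
  assumes "s > 0"
  shows "integrable lborel (\<lambda>y::'a::euclidean_space. heat_kernel s (x - y))" "(LINT y|lborel. heat_kernel s (x - y :: 'a)) = 1"
  using lborel_integral_affine[of "heat_kernel s :: 'a \<Rightarrow> real" "-1" x] heat_kernel_integral[OF assms, where 'a='a] by auto

lemma FT_cnj: "FT (\<lambda>x. cnj (f x)) (- \<xi>) = cnj (FT f \<xi>)"
  unfolding FT_def by (subst Bochner_Integration.integral_cnj[symmetric]) (simp add: cis_cnj)

lemma gaussian_tendsto: "(\<lambda>n. gaussian (1 / real (Suc n)) \<xi>) \<longlonglongrightarrow> 1"
proof -
  have "(\<lambda>n. exp (- ((1 / real (Suc n))\<^sup>2 * (norm \<xi>)\<^sup>2) / 2)) \<longlonglongrightarrow> exp (- (0\<^sup>2 * (norm \<xi>)\<^sup>2) / 2)"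
    by (intro tendsto_intros LIMSEQ_Suc[OF lim_1_over_n]) auto
  then show ?thesis by (simp add: gaussian_def)
qed

lemma gaussian_bounds: "gaussian s \<xi> \<ge> 0" "gaussian s \<xi> \<le> 1"
  by (auto simp: gaussian_def)

text \<open>
  In the regularised identity bound \<open>norm (f x) * norm (f y)\<close> by the mean of the two squares; as the heat kernel has
  mass 1 in each variable, the double integral is at most the squared norm of \<open>f\<close>, uniformly in \<open>s\<close>.
\<close>
lemma bessel_FT:
  fixes f :: "'a::euclidean_space \<Rightarrow> complex"
  assumes f: "integrable lborel f" and f2: "integrable lborel (\<lambda>x. (norm (f x))\<^sup>2)"
  shows "integrable lborel (\<lambda>\<xi>. (norm (FT f \<xi>))\<^sup>2)"
    and "(LINT \<xi>|lborel. (norm (FT f \<xi>))\<^sup>2) \<le> (2 * pi) ^ DIM('a) * (LINT x|lborel. (norm (f x))\<^sup>2)"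
proof -
  let ?P = "lborel \<Otimes>\<^sub>M lborel :: ('a \<times> 'a) measure"
  have [measurable]: "f \<in> borel_measurable borel" using f by auto
  have fc: "integrable lborel (\<lambda>x. cnj (f x))" using f by simp
  have int: "integrable lborel (\<lambda>\<xi>. (norm (FT f \<xi>))\<^sup>2 * gaussian s \<xi>)" 
    and bd: "(LINT \<xi>|lborel. (norm (FT f \<xi>))\<^sup>2 * gaussian s \<xi>) \<le> (2 * pi) ^ DIM('a) * (LINT x|lborel. (norm (f x))\<^sup>2)"
    if s: "s > 0" for s
  proof -
    let ?B = "LINT x|lborel. norm (f x)"
    show "integrable lborel (\<lambda>\<xi>. (norm (FT f \<xi>))\<^sup>2 * gaussian s \<xi>)"
    proof (rule Bochner_Integration.integrable_bound[of _ "\<lambda>\<xi>. ?B\<^sup>2 * gaussian s \<xi>"])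
      show "AE \<xi> in lborel. norm ((norm (FT f \<xi>))\<^sup>2 * gaussian s \<xi>) \<le> norm (?B\<^sup>2 * gaussian s \<xi>)"
        using norm_FT_le[of f] by (intro AE_I2) (auto simp: abs_mult gaussian_bounds intro!: mult_right_mono power_mono)
    qed (auto simp: gaussian_FT(1)[OF s])
    note prod = FT_product_gaussian[OF f fc s]
    have "complex_of_real (LINT \<xi>|lborel. (norm (FT f \<xi>))\<^sup>2 * gaussian s \<xi>) =
       (LINT \<xi>|lborel. FT f \<xi> * FT (\<lambda>x. cnj (f x)) (-\<xi>) * of_real (gaussian s \<xi>))"
    proof -
      have "complex_of_real ((norm (FT f \<xi>))\<^sup>2 * gaussian s \<xi>) = FT f \<xi> * FT (\<lambda>x. cnj (f x)) (-\<xi>) * of_real (gaussian s \<xi>)" for \<xi>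
        by (simp only: of_real_mult complex_norm_square FT_cnj)
      then show ?thesis by (simp only: integral_complex_of_real[symmetric])
    qed
    also have "\<dots> = of_real ((2 * pi) ^ DIM('a)) * (LINT (x, y)|?P. f x * cnj (f y) * of_real (heat_kernel s (x - y)))"
      by (rule prod(2))
    finally have "norm (complex_of_real (LINT \<xi>|lborel. (norm (FT f \<xi>))\<^sup>2 * gaussian s \<xi>)) =
       norm (of_real ((2 * pi) ^ DIM('a)) * (LINT (x, y)|?P. f x * cnj (f y) * of_real (heat_kernel s (x - y))))"
      by (rule arg_cong)
    then have "\<bar>LINT \<xi>|lborel. (norm (FT f \<xi>))\<^sup>2 * gaussian s \<xi>\<bar> =
       (2 * pi) ^ DIM('a) * norm (LINT (x, y)|?P. f x * cnj (f y) * of_real (heat_kernel s (x - y)))"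
      unfolding norm_mult norm_of_real by simp
    also have "\<dots> \<le> (2 * pi) ^ DIM('a) * (LINT x|lborel. (norm (f x))\<^sup>2)"
    proof (intro mult_left_mono)
      define q where "q = (\<lambda>(x, y). (norm (f x))\<^sup>2 * heat_kernel s (x - y :: 'a))"
      define q' where "q' = (\<lambda>(x, y). (norm (f y))\<^sup>2 * heat_kernel s (x - y :: 'a))"
      have qm [measurable]: "q \<in> borel_measurable ?P" unfolding q_def by measurable
      have q: "integrable ?P q"
      proof (rule lborel_pair.Fubini_integrable)
        show "integrable lborel (\<lambda>x. LINT y|lborel. norm (q (x, y)))"
          using f2 by (simp add: q_def abs_mult heat_kernel_nonneg heat_kernel_integral_shift[OF s])
        show "AE x in lborel. integrable lborel (\<lambda>y. q (x, y))"
          by (simp add: q_def heat_kernel_integral_shift[OF s])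
      qed simp
      have qi: "(LINT p|?P. q p) = (LINT x|lborel. (norm (f x))\<^sup>2)"
        by (subst lborel_pair.integral_fst'[OF q, symmetric]) (simp add: q_def heat_kernel_integral_shift[OF s])
      have q'eq: "q' = (\<lambda>(x, y). q (y, x))"
        by (auto simp: q_def q'_def fun_eq_iff) (metis heat_kernel_minus minus_diff_eq)
      have q': "integrable ?P q'" unfolding q'eq by (rule lborel_pair.integrable_product_swap[OF q])
      have q'i: "(LINT p|?P. q' p) = (LINT x|lborel. (norm (f x))\<^sup>2)"
        unfolding q'eq qi[symmetric] by (rule lborel_pair.integral_product_swap) simp
      have "norm (LINT (x, y)|?P. f x * cnj (f y) * of_real (heat_kernel s (x - y)))
        \<le> (LINT p|?P. norm (case p of (x, y) \<Rightarrow> f x * cnj (f y) * of_real (heat_kernel s (x - y))))"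
        by (rule integral_norm_bound)
      also have "\<dots> \<le> (LINT p|?P. (q p + q' p) / 2)"
      proof (rule integral_mono)
        fix p :: "'a \<times> 'a"
        obtain x y where p: "p = (x, y)" by (cases p)
        have "0 \<le> (norm (f x) - norm (f y))\<^sup>2" by simp
        then have "norm (f x) * norm (f y) \<le> ((norm (f x))\<^sup>2 + (norm (f y))\<^sup>2) / 2"
          by (simp add: power2_diff)
        then have "norm (f x) * norm (f y) * heat_kernel s (x - y) \<le> ((norm (f x))\<^sup>2 + (norm (f y))\<^sup>2) / 2 * heat_kernel s (x - y)"
          by (rule mult_right_mono) (rule heat_kernel_nonneg)
        then show "norm (case p of (x, y) \<Rightarrow> f x * cnj (f y) * of_real (heat_kernel s (x - y))) \<le> (q p + q' p) / 2"
          by (simp add: p q_def q'_def norm_mult heat_kernel_nonneg algebra_simps)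
      qed (use prod(1) q q' in auto)
      also have "\<dots> = (LINT x|lborel. (norm (f x))\<^sup>2)"
        using q q' qi q'i by simp
      finally show "norm (LINT (x, y)|?P. f x * cnj (f y) * of_real (heat_kernel s (x - y))) \<le> (LINT x|lborel. (norm (f x))\<^sup>2)" .
    qed simp
    finally show "(LINT \<xi>|lborel. (norm (FT f \<xi>))\<^sup>2 * gaussian s \<xi>) \<le> (2 * pi) ^ DIM('a) * (LINT x|lborel. (norm (f x))\<^sup>2)"
      by linarith
  qed
  have lim: "(\<lambda>n. (norm (FT f \<xi>))\<^sup>2 * gaussian (1 / real (Suc n)) \<xi>) \<longlonglongrightarrow> (norm (FT f \<xi>))\<^sup>2" for \<xi>
    using tendsto_mult[OF tendsto_const gaussian_tendsto, of "(norm (FT f \<xi>))\<^sup>2" \<xi>] by simp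
  note fb = fatou_bound[of lborel "\<lambda>n \<xi>. (norm (FT f \<xi>))\<^sup>2 * gaussian (1 / real (Suc n)) \<xi>" "(2 * pi) ^ DIM('a) * (LINT x|lborel. (norm (f x))\<^sup>2)" "\<lambda>\<xi>. (norm (FT f \<xi>))\<^sup>2"]
  show "integrable lborel (\<lambda>\<xi>. (norm (FT f \<xi>))\<^sup>2)"
    by (rule fb) (use int bd lim in \<open>auto simp: gaussian_bounds\<close>)
  show "(LINT \<xi>|lborel. (norm (FT f \<xi>))\<^sup>2) \<le> (2 * pi) ^ DIM('a) * (LINT x|lborel. (norm (f x))\<^sup>2)"
    by (rule fb) (use int bd lim in \<open>auto simp: gaussian_bounds\<close>)
qed

text \<open>
  Letting \<open>s \<rightarrow> 0\<close> on the position side is harmless because \<open>\<phi>\<close> is bounded and continuous: its convolution with the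
  heat kernel converges pointwise. On the frequency side integrability of the product is assumed, which holds
  whenever both transforms are square-integrable.
\<close>
lemma parseval_FT:
  fixes f \<phi> :: "'a::euclidean_space \<Rightarrow> complex"
  assumes f: "integrable lborel f" and phi: "integrable lborel \<phi>"
    and cont: "continuous_on UNIV \<phi>" and bnd: "\<And>x. norm (\<phi> x) \<le> B"
    and int: "integrable lborel (\<lambda>\<xi>. FT f \<xi> * FT \<phi> (-\<xi>))"
  shows "(LINT \<xi>|lborel. FT f \<xi> * FT \<phi> (-\<xi>)) = of_real ((2 * pi) ^ DIM('a)) * (LINT x|lborel. f x * \<phi> x)"
proof (rule LIMSEQ_unique)
  have [measurable]: "f \<in> borel_measurable borel" "\<phi> \<in> borel_measurable borel"
    using f phi by auto
  have B: "B \<ge> 0" using bnd[of 0] norm_ge_zero order_trans by blast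
  define S where "S = (\<lambda>n. 1 / real (Suc n))"
  have S: "S n > 0" for n by (simp add: S_def)
  have S0: "S \<longlonglongrightarrow> 0" unfolding S_def by (rule LIMSEQ_Suc[OF lim_1_over_n])
  show "(\<lambda>n. LINT \<xi>|lborel. FT f \<xi> * FT \<phi> (-\<xi>) * of_real (gaussian (S n) \<xi>)) \<longlonglongrightarrow> (LINT \<xi>|lborel. FT f \<xi> * FT \<phi> (-\<xi>))"
  proof (rule integral_dominated_convergence)
    show "AE \<xi> in lborel. (\<lambda>n. FT f \<xi> * FT \<phi> (- \<xi>) * of_real (gaussian (S n) \<xi>)) \<longlonglongrightarrow> FT f \<xi> * FT \<phi> (- \<xi>)"
    proof (rule AE_I2)
      fix \<xi> :: 'a
      have "(\<lambda>n. FT f \<xi> * FT \<phi> (- \<xi>) * of_real (gaussian (S n) \<xi>)) \<longlonglongrightarrow> FT f \<xi> * FT \<phi> (- \<xi>) * of_real 1"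
        unfolding S_def by (intro tendsto_intros gaussian_tendsto)
      then show "(\<lambda>n. FT f \<xi> * FT \<phi> (- \<xi>) * of_real (gaussian (S n) \<xi>)) \<longlonglongrightarrow> FT f \<xi> * FT \<phi> (- \<xi>)" by simp
    qed
    show "AE \<xi> in lborel. norm (FT f \<xi> * FT \<phi> (- \<xi>) * of_real (gaussian (S n) \<xi>)) \<le> norm (FT f \<xi> * FT \<phi> (- \<xi>))" for n
      by (intro AE_I2) (auto simp: norm_mult gaussian_bounds intro!: mult_left_le)
  qed (use int in \<open>auto simp: borel_measurable_integrable\<close>)
  \<comment> \<open>rescaling \<open>y = x - s * z\<close> moves the dependence on \<open>s\<close> from the kernel into \<open>\<phi>\<close>\<close>
  have conv: "(LINT y|lborel. \<phi> y * of_real (heat_kernel (S n) (x - y))) = (LINT z|lborel. \<phi> (x - S n *\<^sub>R z) * of_real (heat_kernel 1 z))" for x n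
  proof -
    have "(LINT y|lborel. \<phi> y * of_real (heat_kernel (S n) (x - y))) =
      \<bar>- S n\<bar> ^ DIM('a) *\<^sub>R (LINT z|lborel. \<phi> (x + (- S n) *\<^sub>R z) * of_real (heat_kernel (S n) (x - (x + (- S n) *\<^sub>R z))))"
      by (rule lborel_integral_affine(2)) (use S[of n] in auto)
    also have "\<dots> = (LINT z|lborel. \<phi> (x - S n *\<^sub>R z) * of_real (heat_kernel 1 z))"
      using S[of n] by (subst integral_scaleR_right[symmetric], intro Bochner_Integration.integral_cong)
        (auto simp: scaleR_conv_of_real simp flip: heat_kernel_scale[OF S[of n]])
    finally show ?thesis .
  qed
  have convlim: "(\<lambda>n. LINT z|lborel. \<phi> (x - S n *\<^sub>R z) * of_real (heat_kernel 1 z)) \<longlonglongrightarrow> \<phi> x" for x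
  proof -
    have "(\<lambda>n. LINT z|lborel. \<phi> (x - S n *\<^sub>R z) * of_real (heat_kernel 1 z)) \<longlonglongrightarrow> (LINT z|lborel. \<phi> x * complex_of_real (heat_kernel 1 (z::'a)))"
    proof (rule integral_dominated_convergence)
      show "integrable lborel (\<lambda>z::'a. B * heat_kernel 1 z)" using heat_kernel_integral(1)[of 1, where 'a='a] by simp
      show "AE z in lborel. (\<lambda>n. \<phi> (x - S n *\<^sub>R z) * of_real (heat_kernel 1 z)) \<longlonglongrightarrow> \<phi> x * complex_of_real (heat_kernel 1 (z::'a))"
      proof (rule AE_I2)
        fix z :: 'a
        have "(\<lambda>n. x - S n *\<^sub>R z) \<longlonglongrightarrow> x - 0 *\<^sub>R z" by (intro tendsto_intros S0)
        then have "(\<lambda>n. \<phi> (x - S n *\<^sub>R z)) \<longlonglongrightarrow> \<phi> x"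
          using cont by (auto intro: continuous_on_tendsto_compose[of UNIV \<phi>])
        then show "(\<lambda>n. \<phi> (x - S n *\<^sub>R z) * of_real (heat_kernel 1 z)) \<longlonglongrightarrow> \<phi> x * complex_of_real (heat_kernel 1 (z::'a))"
          by (intro tendsto_intros)
      qed
      show "AE z in lborel. norm (\<phi> (x - S n *\<^sub>R z) * of_real (heat_kernel 1 z)) \<le> B * heat_kernel 1 z" for n
        by (intro AE_I2) (auto simp: norm_mult heat_kernel_nonneg intro!: mult_mono bnd B)
    qed auto
    then show ?thesis using heat_kernel_integral[of 1, where 'a='a] by (simp flip: of_real_def)
  qed
  have rhs: "(LINT \<xi>|lborel. FT f \<xi> * FT \<phi> (-\<xi>) * of_real (gaussian (S n) \<xi>)) =
     of_real ((2 * pi) ^ DIM('a)) * (LINT x|lborel. f x * (LINT z|lborel. \<phi> (x - S n *\<^sub>R z) * of_real (heat_kernel 1 z)))" for n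
  proof -
    note pr = FT_product_gaussian[OF f phi S[of n]]
    have "(LINT x|lborel. f x * (LINT z|lborel. \<phi> (x - S n *\<^sub>R z) * of_real (heat_kernel 1 z))) =
       (LINT x|lborel. LINT y|lborel. f x * \<phi> y * of_real (heat_kernel (S n) (x - y)))"
      unfolding conv[symmetric] by (subst integral_mult_right_zero[symmetric]) (simp add: mult.assoc)
    also have "\<dots> = (LINT (x, y)|(lborel \<Otimes>\<^sub>M lborel). f x * \<phi> y * of_real (heat_kernel (S n) (x - y)))"
      by (rule lborel_pair.integral_fst) (use pr(1) in simp)
    finally show ?thesis using pr(2) by simp
  qed
  have "(\<lambda>n. LINT x|lborel. f x * (LINT z|lborel. \<phi> (x - S n *\<^sub>R z) * of_real (heat_kernel 1 z))) \<longlonglongrightarrow> (LINT x|lborel. f x * \<phi> x)"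
  proof (rule integral_dominated_convergence)
    show "integrable lborel (\<lambda>x. B * norm (f x))" using f by simp
    show "AE x in lborel. (\<lambda>n. f x * (LINT z|lborel. \<phi> (x - S n *\<^sub>R z) * of_real (heat_kernel 1 z))) \<longlonglongrightarrow> f x * \<phi> x"
      by (intro AE_I2 tendsto_intros convlim)
    have "norm (LINT z|lborel. \<phi> (x - S n *\<^sub>R z) * of_real (heat_kernel 1 z)) \<le> B" for x n
    proof -
      have le: "norm (\<phi> (x - S n *\<^sub>R z) * of_real (heat_kernel 1 z)) \<le> B * heat_kernel 1 z" for z
        by (auto simp: norm_mult heat_kernel_nonneg intro!: mult_mono bnd B)
      have iB: "integrable lborel (\<lambda>z::'a. B * heat_kernel 1 z)" using heat_kernel_integral(1)[of 1, where 'a='a] by simp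
      have "norm (LINT z|lborel. \<phi> (x - S n *\<^sub>R z) * of_real (heat_kernel 1 z)) \<le> (LINT z|lborel. norm (\<phi> (x - S n *\<^sub>R z) * of_real (heat_kernel 1 z)))"
        by (rule integral_norm_bound)
      also have "\<dots> \<le> (LINT z|lborel. B * heat_kernel 1 (z::'a))"
        by (rule integral_mono[OF integrable_norm[OF integrable_dominated[OF iB _ le]] iB le]) measurable
      finally have "norm (LINT z|lborel. \<phi> (x - S n *\<^sub>R z) * of_real (heat_kernel 1 z)) \<le> (LINT z|lborel. B * heat_kernel 1 (z::'a))" .
      then show ?thesis using heat_kernel_integral[of 1, where 'a='a] by simp
    qed
    then show "AE x in lborel. norm (f x * (LINT z|lborel. \<phi> (x - S n *\<^sub>R z) * of_real (heat_kernel 1 z))) \<le> B * norm (f x)" for n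
      by (intro AE_I2) (auto simp: norm_mult mult.commute[of B] intro!: mult_left_mono)
  qed auto
  then have "(\<lambda>n. of_real ((2 * pi) ^ DIM('a)) * (LINT x|lborel. f x * (LINT z|lborel. \<phi> (x - S n *\<^sub>R z) * of_real (heat_kernel 1 z))))
     \<longlonglongrightarrow> of_real ((2 * pi) ^ DIM('a)) * (LINT x|lborel. f x * \<phi> x)"
    by (intro tendsto_intros)
  then show "(\<lambda>n. LINT \<xi>|lborel. FT f \<xi> * FT \<phi> (-\<xi>) * of_real (gaussian (S n) \<xi>)) \<longlonglongrightarrow>
     of_real ((2 * pi) ^ DIM('a)) * (LINT x|lborel. f x * \<phi> x)"
    unfolding rhs .
qed

section \<open>Fourier inversion in mean square\<close>

text \<open>
  Truncation of the modulus at \<open>k\<close> which keeps the argument, so that \<open>z * clip k (cnj z)\<close> is real and nonnegative.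
\<close>
definition clip :: "real \<Rightarrow> complex \<Rightarrow> complex" where
  "clip k z = z / of_real (max 1 (norm z / k))"

lemma norm_clip: "k > 0 \<Longrightarrow> norm (clip k z) = min (norm z) k"
  by (auto simp: clip_def norm_divide max_def min_def field_simps)

lemma continuous_clip: "k > 0 \<Longrightarrow> continuous_on UNIV (clip k)"
  unfolding clip_def[abs_def] by (intro continuous_intros) (auto simp: max_def)

lemma clip_cnj_mult: "k > 0 \<Longrightarrow> z * clip k (cnj z) = of_real (norm z * min (norm z) k)"
proof -
  assume k: "k > 0"
  have "z * clip k (cnj z) = z * cnj z / of_real (max 1 (norm z / k))"
    by (simp add: clip_def)
  also have "\<dots> = of_real ((norm z)\<^sup>2 / max 1 (norm z / k))"
    by (simp only: of_real_divide complex_norm_square)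
  also have "(norm z)\<^sup>2 / max 1 (norm z / k) = norm z * min (norm z) k"
    using k by (auto simp: max_def min_def field_simps power2_eq_square)
  finally show ?thesis .
qed

text \<open>
  The extremal test function is \<open>cnj D\<close> itself. It is replaced by a bounded function of compact support, and
  that one by continuous functions converging to it almost everywhere; dominated convergence carries
  the hypothesis over, and the truncations are removed by Fatou's lemma.
\<close>
lemma L2_bound_by_duality:
  fixes D :: "'a::euclidean_space \<Rightarrow> complex"
  assumes D[measurable]: "D \<in> borel_measurable borel"
    and loc: "\<And>k::nat. integrable lborel (\<lambda>x. indicator (cball 0 (real k)) x *\<^sub>R D x)"
    and C: "C \<ge> 0"
    and dual: "\<And>\<phi> k. continuous_on UNIV \<phi> \<Longrightarrow> (\<And>x. x \<notin> cball 0 (real k) \<Longrightarrow> \<phi> x = 0) \<Longrightarrow>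
       norm (LINT x|lborel. D x * \<phi> x) \<le> C * sqrt (LINT x|lborel. (norm (\<phi> x))\<^sup>2)"
  shows "integrable lborel (\<lambda>x. (norm (D x))\<^sup>2)" "(LINT x|lborel. (norm (D x))\<^sup>2) \<le> C\<^sup>2"
proof -
  have [measurable]: "(\<lambda>x. cnj (D x)) \<in> borel_measurable borel"
    by (intro borel_measurable_continuous_on[of cnj] continuous_intros) simp
  then have "(\<lambda>x. cnj (D x)) \<in> borel_measurable lebesgue"
    by (intro measurable_completion) simp
  then have "(\<lambda>x. cnj (D x)) measurable_on UNIV"
    by (intro lebesgue_measurable_imp_measurable_on) auto
  then obtain Z g where Z: "negligible Z" and g: "\<And>n. continuous_on UNIV (g n)"
    and gl: "\<And>x. x \<notin> Z \<Longrightarrow> (\<lambda>n::nat. g n x) \<longlonglongrightarrow> cnj (D x)"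
    unfolding measurable_on_def by auto
  have AEZ: "AE x in lborel. x \<notin> Z"
    using Z unfolding negligible_iff_null_sets by (metis AE_completion_iff AE_not_in)
  have [measurable]: "g n \<in> borel_measurable borel" for n
    using g by (rule borel_measurable_continuous_onI)
  \<comment> \<open>a continuous substitute for the indicator function of a ball\<close>
  define cut :: "nat \<Rightarrow> 'a \<Rightarrow> real" where "cut k x = max 0 (min 1 (real k + 1 - norm x))" for k x
  have cut01: "0 \<le> cut k x" "cut k x \<le> 1" for k x by (auto simp: cut_def)
  have cut0: "cut k x = 0" if "x \<notin> cball 0 (real (Suc k))" for k x
    using that by (auto simp: cut_def)
  have cut_ind: "cut k x \<le> indicator (cball 0 (real (Suc k))) x" for k x
    using cut0[of x k] cut01[of k x] by (auto simp: indicator_def)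
  have cutc: "continuous_on UNIV (cut k)" for k unfolding cut_def by (intro continuous_intros)
  then have [measurable]: "cut k \<in> borel_measurable borel" for k
    by (rule borel_measurable_continuous_onI)
  have cutl: "(\<lambda>k. cut k x) \<longlonglongrightarrow> 1" for x
  proof (rule tendsto_eventually, rule eventually_sequentiallyI)
    fix k assume "nat \<lceil>norm x\<rceil> \<le> k" then show "cut k x = 1" by (simp add: cut_def)
  qed
  \<comment> \<open>modulus of the truncated extremal test function\<close>
  define m where "m k x = cut k x * min (norm (D x)) (real (Suc k))" for k x
  have [measurable]: "m k \<in> borel_measurable borel" for k unfolding m_def by measurable
  have m0: "m k x \<ge> 0" for k x by (auto simp: m_def cut01)
  have main: "integrable lborel (\<lambda>x. (m k x)\<^sup>2) \<and> (LINT x|lborel. (m k x)\<^sup>2) \<le> C\<^sup>2" for k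
  proof -
    let ?K = "real (Suc k)"
    define \<phi> where "\<phi> n x = of_real (cut k x) * clip ?K (g n x)" for n x
    define \<phi>' where "\<phi>' x = of_real (cut k x) * clip ?K (cnj (D x))" for x
    have phic: "continuous_on UNIV (\<phi> n)" for n
      unfolding \<phi>_def[abs_def]
      by (intro continuous_intros cutc continuous_on_compose2[OF continuous_clip g]) auto
    have [measurable]: "\<phi> n \<in> borel_measurable borel" for n
      using phic by (rule borel_measurable_continuous_onI)
    have [measurable]: "\<phi>' \<in> borel_measurable borel"
      using borel_measurable_continuous_onI[OF continuous_clip[of ?K]] unfolding \<phi>'_def by measurable
    have phil: "AE x in lborel. (\<lambda>n. \<phi> n x) \<longlonglongrightarrow> \<phi>' x"
      using AEZ
    proof eventually_elim
      case (elim x)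
      then have "(\<lambda>n. clip ?K (g n x)) \<longlonglongrightarrow> clip ?K (cnj (D x))"
        by (intro continuous_on_tendsto_compose[OF continuous_clip gl]) auto
      then show ?case unfolding \<phi>_def \<phi>'_def by (intro tendsto_intros)
    qed
    have phib: "norm (\<phi> n x) \<le> ?K * indicator (cball 0 ?K) x" for n x
    proof -
      have "norm (\<phi> n x) = cut k x * min (norm (g n x)) ?K"
        by (simp add: \<phi>_def norm_mult cut01 norm_clip del: of_nat_Suc)
      also have "\<dots> \<le> indicator (cball 0 ?K) x * ?K"
        by (intro mult_mono cut_ind) (auto simp: cut01)
      finally show ?thesis by (simp add: mult.commute)
    qed
    have bnd: "norm (LINT x|lborel. D x * \<phi> n x) \<le> C * sqrt (LINT x|lborel. (norm (\<phi> n x))\<^sup>2)" for n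
      by (rule dual[OF phic, of "Suc k"]) (use cut0 in \<open>auto simp: \<phi>_def\<close>)
    have l1: "(\<lambda>n. LINT x|lborel. D x * \<phi> n x) \<longlonglongrightarrow> (LINT x|lborel. D x * \<phi>' x)"
    proof (rule integral_dominated_convergence)
      show "integrable lborel (\<lambda>x. ?K * norm (indicator (cball 0 ?K) x *\<^sub>R D x))"
        using loc[of "Suc k"] by (intro integrable_mult_right integrable_norm)
      show "AE x in lborel. (\<lambda>n. D x * \<phi> n x) \<longlonglongrightarrow> D x * \<phi>' x"
        using phil by eventually_elim (intro tendsto_intros)
      show "AE x in lborel. norm (D x * \<phi> n x) \<le> ?K * norm (indicator (cball 0 ?K) x *\<^sub>R D x)" for n
      proof (rule AE_I2)
        fix x
        have "norm (D x) * norm (\<phi> n x) \<le> norm (D x) * (?K * indicator (cball 0 ?K) x)"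
          by (intro mult_left_mono phib) auto
        then show "norm (D x * \<phi> n x) \<le> ?K * norm (indicator (cball 0 ?K) x *\<^sub>R D x)"
          by (simp add: norm_mult mult_ac)
      qed
    qed auto
    have l2: "(\<lambda>n. LINT x|lborel. (norm (\<phi> n x))\<^sup>2) \<longlonglongrightarrow> (LINT x|lborel. (norm (\<phi>' x))\<^sup>2)"
    proof (rule integral_dominated_convergence)
      show "integrable lborel (\<lambda>x::'a. ?K\<^sup>2 * indicator (cball 0 ?K) x)"
        using integrable_ball by (intro integrable_mult_right)
      show "AE x in lborel. (\<lambda>n. (norm (\<phi> n x))\<^sup>2) \<longlonglongrightarrow> (norm (\<phi>' x))\<^sup>2"
        using phil by eventually_elim (intro tendsto_intros)
      show "AE x in lborel. norm ((norm (\<phi> n x))\<^sup>2) \<le> ?K\<^sup>2 * indicator (cball 0 ?K) x" for n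
      proof (rule AE_I2)
        fix x
        have "(norm (\<phi> n x))\<^sup>2 \<le> (?K * indicator (cball 0 ?K) x)\<^sup>2"
          by (intro power_mono phib) auto
        then show "norm ((norm (\<phi> n x))\<^sup>2) \<le> ?K\<^sup>2 * indicator (cball 0 ?K) x"
          by (auto simp: indicator_def)
      qed
    qed auto
    have le: "norm (LINT x|lborel. D x * \<phi>' x) \<le> C * sqrt (LINT x|lborel. (norm (\<phi>' x))\<^sup>2)"
      by (rule LIMSEQ_le[OF tendsto_norm[OF l1] tendsto_mult[OF tendsto_const tendsto_real_sqrt[OF l2]]])
         (use bnd in auto)
    have phi'2: "norm (\<phi>' x) = m k x" for x
      by (simp add: \<phi>'_def m_def norm_mult cut01 norm_clip del: of_nat_Suc)
    have Dphi': "D x * \<phi>' x = of_real (m k x * norm (D x))" for x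
    proof -
      have "D x * \<phi>' x = of_real (cut k x) * (D x * clip ?K (cnj (D x)))" by (simp add: \<phi>'_def)
      then show ?thesis by (subst (asm) clip_cnj_mult) (auto simp: m_def)
    qed
    have mb: "m k x \<le> indicator (cball 0 ?K) x * ?K" for x
      unfolding m_def by (intro mult_mono cut_ind) auto
    have mi: "integrable lborel (\<lambda>x. (m k x)\<^sup>2)"
    proof (rule integrable_dominated[OF integrable_mult_right[OF integrable_ball]])
      show "norm ((m k x)\<^sup>2) \<le> ?K\<^sup>2 * indicator (cball 0 ?K) x" for x
        using power_mono[OF mb m0, of x 2] by (auto simp: indicator_def)
    qed simp
    have mDi: "integrable lborel (\<lambda>x. m k x * norm (D x))"
    proof (rule integrable_dominated[OF integrable_mult_right[OF integrable_norm[OF loc]]])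
      show "norm (m k x * norm (D x)) \<le> ?K * norm (indicator (cball 0 ?K) x *\<^sub>R D x)" for x
        using mult_right_mono[OF mb norm_ge_zero, of x "D x"] m0[of k x] by (simp add: abs_mult mult_ac)
    qed measurable
    let ?I = "LINT x|lborel. (m k x)\<^sup>2"
    have I0: "?I \<ge> 0" by (auto intro: Bochner_Integration.integral_nonneg)
    have "?I \<le> (LINT x|lborel. m k x * norm (D x))"
    proof (rule integral_mono[OF mi mDi])
      fix x
      have "cut k x * min (norm (D x)) ?K \<le> 1 * norm (D x)"
        by (intro mult_mono) (auto simp: cut01)
      then have "m k x \<le> norm (D x)" by (simp add: m_def)
      then show "(m k x)\<^sup>2 \<le> m k x * norm (D x)"
        unfolding power2_eq_square by (intro mult_left_mono m0)
    qed
    also have "\<dots> \<le> norm (LINT x|lborel. D x * \<phi>' x)"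
      unfolding Dphi' integral_complex_of_real norm_of_real by simp
    also have "\<dots> \<le> C * sqrt ?I" using le unfolding phi'2 .
    finally have "?I \<le> C * sqrt ?I" .
    then have le2: "sqrt ?I * sqrt ?I \<le> C * sqrt ?I" using I0 by simp
    have "sqrt ?I \<le> C"
    proof (cases "?I = 0")
      case False
      then have "sqrt ?I > 0" using I0 by (simp add: less_le)
      then show ?thesis by (rule mult_right_le_imp_le[OF le2])
    qed (use C in simp)
    then have "(sqrt ?I)\<^sup>2 \<le> C\<^sup>2" using I0 by (intro power_mono) auto
    then show ?thesis using mi I0 by simp
  qed
  have mlim: "(\<lambda>k. (m k x)\<^sup>2) \<longlonglongrightarrow> (norm (D x))\<^sup>2" for x
  proof -
    have "(\<lambda>k. min (norm (D x)) (real (Suc k))) \<longlonglongrightarrow> norm (D x)"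
    proof (rule tendsto_eventually, rule eventually_sequentiallyI)
      fix k assume "nat \<lceil>norm (D x)\<rceil> \<le> k"
      then show "min (norm (D x)) (real (Suc k)) = norm (D x)" by (simp add: min_def)
    qed
    then have "(\<lambda>k. (m k x)\<^sup>2) \<longlonglongrightarrow> (1 * norm (D x))\<^sup>2"
      unfolding m_def by (intro tendsto_intros cutl)
    then show ?thesis by simp
  qed
  note fb = fatou_bound[of lborel "\<lambda>k x. (m k x)\<^sup>2" "C\<^sup>2" "\<lambda>x. (norm (D x))\<^sup>2"]
  show "integrable lborel (\<lambda>x. (norm (D x))\<^sup>2)"
    by (rule fb) (use main mlim in auto)
  show "(LINT x|lborel. (norm (D x))\<^sup>2) \<le> C\<^sup>2"
    by (rule fb) (use main mlim in auto)
qed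

lemma compact_support_integrable:
  fixes \<phi> :: "'a::euclidean_space \<Rightarrow> complex"
  assumes c: "continuous_on UNIV \<phi>" and z: "\<And>x. x \<notin> cball 0 (real k) \<Longrightarrow> \<phi> x = 0"
  shows "integrable lborel \<phi>" "integrable lborel (\<lambda>x. (norm (\<phi> x))\<^sup>2)" "\<exists>B. \<forall>x. norm (\<phi> x) \<le> B"
proof -
  have [measurable]: "\<phi> \<in> borel_measurable borel" using c by (rule borel_measurable_continuous_onI)
  have "compact (\<phi> ` cball 0 (real k))"
    by (intro compact_continuous_image continuous_on_subset[OF c]) auto
  then obtain B where B: "\<And>x. x \<in> cball 0 (real k) \<Longrightarrow> norm (\<phi> x) \<le> B" "B > 0"
    using compact_imp_bounded bounded_pos by (metis imageI)
  have le: "norm (\<phi> x) \<le> B * indicator (cball 0 (real k)) x" for x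
    using B(1)[of x] z[of x] by (auto simp: indicator_def)
  then have "norm (\<phi> x) \<le> B" for x
    using B(2) by (intro order_trans[OF le]) (auto simp: indicator_def)
  then show "\<exists>B. \<forall>x. norm (\<phi> x) \<le> B" by blast
  show "integrable lborel \<phi>"
    by (rule integrable_dominated[OF integrable_mult_right[OF integrable_ball] _ le]) simp
  have "norm ((norm (\<phi> x))\<^sup>2) \<le> B\<^sup>2 * indicator (cball 0 (real k)) x" for x
    using power_mono[OF le[of x], of 2] by (auto simp: indicator_def)
  then show "integrable lborel (\<lambda>x. (norm (\<phi> x))\<^sup>2)"
    by (rule integrable_dominated[OF integrable_mult_right[OF integrable_ball], rotated]) simp
qed

text \<open>
  Parseval's formula shows that \<open>f\<close> pairs to 0 with every test function, so duality applies with \<open>C = 0\<close>.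
\<close>
lemma FT_zero_imp_zero:
  fixes f :: "'a::euclidean_space \<Rightarrow> complex"
  assumes f: "integrable lborel f" and 0: "\<And>\<xi>. FT f \<xi> = 0"
  shows "AE x in lborel. f x = 0"
proof -
  have dual: "norm (LINT x|lborel. f x * \<phi> x) \<le> 0 * sqrt (LINT x|lborel. (norm (\<phi> x))\<^sup>2)"
    if c: "continuous_on UNIV \<phi>" and z: "\<And>x. x \<notin> cball 0 (real k) \<Longrightarrow> \<phi> x = 0" for \<phi> k
  proof -
    note ci = compact_support_integrable[OF c z]
    obtain B where B: "\<And>x. norm (\<phi> x) \<le> B" using ci(3) by blast
    have "0 = of_real ((2 * pi) ^ DIM('a)) * (LINT x|lborel. f x * \<phi> x)"
      using parseval_FT[OF f ci(1) c B] 0 by simp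
    then show ?thesis by simp
  qed
  have loc: "integrable lborel (\<lambda>x. indicator (cball 0 (real k)) x *\<^sub>R f x)" for k
    using f by (intro integrable_mult_indicator) auto
  have "integrable lborel (\<lambda>x. (norm (f x))\<^sup>2)"
    by (rule L2_bound_by_duality(1)[OF _ loc _ dual]) (use f in auto)
  moreover have "(LINT x|lborel. (norm (f x))\<^sup>2) \<le> 0\<^sup>2"
    by (rule L2_bound_by_duality(2)[OF _ loc _ dual]) (use f in auto)
  moreover have "(LINT x|lborel. (norm (f x))\<^sup>2) \<ge> 0" by (auto intro: Bochner_Integration.integral_nonneg)
  ultimately have "AE x in lborel. (norm (f x))\<^sup>2 = 0"
    by (subst integral_nonneg_eq_0_iff_AE[symmetric]) auto
  then show ?thesis by simp
qed

text \<open>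
  Fubini's theorem; the sign makes the left-hand side a pairing with the inverse transform.
\<close>
lemma multiplication_formula:
  fixes u \<phi> :: "'a::euclidean_space \<Rightarrow> complex"
  assumes u: "integrable lborel u" and p: "integrable lborel \<phi>"
  shows "(LINT x|lborel. FT u (- x) * \<phi> x) = (LINT \<xi>|lborel. u \<xi> * FT \<phi> (- \<xi>))"
proof -
  have [measurable]: "u \<in> borel_measurable borel" "\<phi> \<in> borel_measurable borel"
    using u p by auto
  have int: "integrable (lborel \<Otimes>\<^sub>M lborel) (\<lambda>(x, \<xi>). cis (- x \<bullet> \<xi>) * u \<xi> * \<phi> x)"
    by (rule Bochner_Integration.integrable_bound[OF integrable_pair_mult[OF p u]])
       (auto simp: norm_mult mult_ac)
  have "(LINT x|lborel. FT u (- x) * \<phi> x) = (LINT x|lborel. LINT \<xi>|lborel. cis (- x \<bullet> \<xi>) * u \<xi> * \<phi> x)"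
    unfolding FT_def by (subst integral_mult_left_zero[symmetric]) (rule refl)
  also have "\<dots> = (LINT \<xi>|lborel. LINT x|lborel. cis (- x \<bullet> \<xi>) * u \<xi> * \<phi> x)"
    by (rule lborel_pair.Fubini_integral[symmetric]) (use int in simp)
  also have "\<dots> = (LINT \<xi>|lborel. u \<xi> * FT \<phi> (- \<xi>))"
    unfolding FT_def by (subst integral_mult_right_zero[symmetric]) (simp add: inner_commute mult_ac)
  finally show ?thesis .
qed

text \<open>
  By Parseval's formula and the multiplication formula, pairing \<open>f - FT u (- x)\<close> with \<open>\<phi>\<close> amounts to pairing \<open>E\<close> with
  the transform of \<open>\<phi>\<close>; Cauchy-Schwarz, Bessel's inequality for \<open>\<phi>\<close> and duality give the bound.
\<close>
lemma L2_inverse_FT_diff: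
  fixes f u :: "'a::euclidean_space \<Rightarrow> complex"
  assumes f: "integrable lborel f" and f2: "integrable lborel (\<lambda>x. (norm (f x))\<^sup>2)"
    and u: "integrable lborel u" and u2: "integrable lborel (\<lambda>x. (norm (u x))\<^sup>2)"
  defines "E \<equiv> \<lambda>\<xi>. FT f \<xi> / of_real ((2 * pi) ^ DIM('a)) - u \<xi>"
  shows "integrable lborel (\<lambda>\<xi>. (norm (E \<xi>))\<^sup>2)"
    and "integrable lborel (\<lambda>x. (norm (f x - FT u (- x)))\<^sup>2)"
    and "(LINT x|lborel. (norm (f x - FT u (- x)))\<^sup>2) \<le> (2 * pi) ^ DIM('a) * (LINT \<xi>|lborel. (norm (E \<xi>))\<^sup>2)"
proof -
  let ?d = "(2 * pi) ^ DIM('a)"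
  have [measurable]: "f \<in> borel_measurable borel" "u \<in> borel_measurable borel"
    using u f by auto
  have d0: "?d > 0" by simp
  have [measurable]: "E \<in> borel_measurable borel" unfolding E_def by measurable
  show E2: "integrable lborel (\<lambda>\<xi>. (norm (E \<xi>))\<^sup>2)"
  proof (rule integrable_dominated)
    show "integrable lborel (\<lambda>\<xi>. 2 * ((norm (FT f \<xi>))\<^sup>2 / ?d\<^sup>2) + 2 * (norm (u \<xi>))\<^sup>2)"
      using bessel_FT(1)[OF f f2] u2 by simp
    fix \<xi>
    let ?a = "FT f \<xi> / of_real ?d"
    have "(norm (E \<xi>))\<^sup>2 \<le> (norm ?a + norm (u \<xi>))\<^sup>2"
      unfolding E_def by (intro power_mono norm_triangle_ineq4) auto
    also have "\<dots> \<le> 2 * (norm ?a)\<^sup>2 + 2 * (norm (u \<xi>))\<^sup>2"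
      using sum_squares_bound[of "norm ?a" "norm (u \<xi>)"] by (simp add: power2_sum)
    also have "norm ?a = norm (FT f \<xi>) / ?d" unfolding norm_divide norm_of_real by simp
    finally show "norm ((norm (E \<xi>))\<^sup>2) \<le> 2 * ((norm (FT f \<xi>))\<^sup>2 / ?d\<^sup>2) + 2 * (norm (u \<xi>))\<^sup>2"
      by (simp add: power_divide)
  qed simp
  let ?D = "\<lambda>x. f x - FT u (- x)"
  define C where "C = sqrt (?d * (LINT \<xi>|lborel. (norm (E \<xi>))\<^sup>2))"
  have C: "C \<ge> 0" unfolding C_def by (auto intro!: mult_nonneg_nonneg Bochner_Integration.integral_nonneg)
  have C2: "C\<^sup>2 = ?d * (LINT \<xi>|lborel. (norm (E \<xi>))\<^sup>2)"
    unfolding C_def by (intro real_sqrt_pow2 mult_nonneg_nonneg Bochner_Integration.integral_nonneg) auto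
  have loc: "integrable lborel (\<lambda>x. indicator (cball 0 (real k)) x *\<^sub>R ?D x)" for k
  proof -
    have "integrable lborel (\<lambda>x. indicator (cball 0 (real k)) x *\<^sub>R FT u (- x))"
    proof (rule integrable_dominated[OF integrable_mult_right[OF integrable_ball]])
      show "norm (indicator (cball 0 (real k)) x *\<^sub>R FT u (- x))
         \<le> (LINT x|lborel. norm (u x)) * indicator (cball 0 (real k)) x" for x
        using norm_FT_le[of u] by (auto simp: indicator_def)
    qed (intro borel_measurable_scaleR borel_measurable_indicator; simp)
    moreover have "integrable lborel (\<lambda>x. indicator (cball 0 (real k)) x *\<^sub>R f x)"
      using f by (intro integrable_mult_indicator) auto
    ultimately show ?thesis by (simp add: scaleR_diff_right)
  qed
  have dual: "norm (LINT x|lborel. ?D x * \<phi> x) \<le> C * sqrt (LINT x|lborel. (norm (\<phi> x))\<^sup>2)"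
    if c: "continuous_on UNIV \<phi>" and z: "\<And>x. x \<notin> cball 0 (real k) \<Longrightarrow> \<phi> x = 0" for \<phi> k
  proof -
    note ci = compact_support_integrable[OF c z]
    obtain B where B: "\<And>x. norm (\<phi> x) \<le> B" using ci(3) by blast
    have [measurable]: "\<phi> \<in> borel_measurable borel" using ci(1) by auto
    have pc: "integrable lborel (\<lambda>x. cnj (\<phi> x))" "integrable lborel (\<lambda>x. (norm (cnj (\<phi> x)))\<^sup>2)" using ci by auto
    have nF: "norm (FT \<phi> (- \<xi>)) = norm (FT (\<lambda>x. cnj (\<phi> x)) \<xi>)" for \<xi>
      using FT_cnj[of "\<lambda>x. cnj (\<phi> x)" \<xi>] by simp
    note bs = bessel_FT[OF pc, folded nF]
    have i1: "integrable lborel (\<lambda>\<xi>. FT f \<xi> * FT \<phi> (- \<xi>))"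
      by (rule cauchy_schwarz_integral(1)) (use bs bessel_FT(1)[OF f f2] in auto)
    have i2: "integrable lborel (\<lambda>\<xi>. u \<xi> * FT \<phi> (- \<xi>))"
      by (rule cauchy_schwarz_integral(1)) (use bs u2 in auto)
    have i3: "integrable lborel (\<lambda>x. f x * \<phi> x)"
      by (rule cauchy_schwarz_integral(1)) (use f2 ci in auto)
    have i4: "integrable lborel (\<lambda>x. FT u (- x) * \<phi> x)"
    proof (rule integrable_dominated[OF integrable_mult_right[OF integrable_norm[OF ci(1)]]])
      show "norm (FT u (- x) * \<phi> x) \<le> (LINT x|lborel. norm (u x)) * norm (\<phi> x)" for x
        unfolding norm_mult by (intro mult_right_mono norm_FT_le) simp
    qed (use ci in auto)
    have "(LINT x|lborel. ?D x * \<phi> x) = (LINT x|lborel. f x * \<phi> x) - (LINT x|lborel. FT u (- x) * \<phi> x)"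
      using i3 i4 by (simp add: left_diff_distrib)
    also have "(LINT x|lborel. f x * \<phi> x) = (LINT \<xi>|lborel. FT f \<xi> * FT \<phi> (- \<xi>)) / of_real ?d"
      using parseval_FT[OF f ci(1) c B i1] d0 by simp
    also have "\<dots> = (LINT \<xi>|lborel. FT f \<xi> * FT \<phi> (- \<xi>) / of_real ?d)" by simp
    also have "(LINT x|lborel. FT u (- x) * \<phi> x) = (LINT \<xi>|lborel. u \<xi> * FT \<phi> (- \<xi>))"
      by (rule multiplication_formula[OF u ci(1)])
    also have "(LINT \<xi>|lborel. FT f \<xi> * FT \<phi> (- \<xi>) / of_real ?d) - (LINT \<xi>|lborel. u \<xi> * FT \<phi> (- \<xi>))
       = (LINT \<xi>|lborel. FT f \<xi> * FT \<phi> (- \<xi>) / of_real ?d - u \<xi> * FT \<phi> (- \<xi>))"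
      by (rule Bochner_Integration.integral_diff[symmetric]) (use i1 i2 in auto)
    also have "\<dots> = (LINT \<xi>|lborel. E \<xi> * FT \<phi> (- \<xi>))"
      by (simp add: E_def left_diff_distrib)
    finally have eq: "(LINT x|lborel. ?D x * \<phi> x) = (LINT \<xi>|lborel. E \<xi> * FT \<phi> (- \<xi>))" .
    have "norm (LINT x|lborel. ?D x * \<phi> x) \<le> sqrt (LINT \<xi>|lborel. (norm (E \<xi>))\<^sup>2) * sqrt (LINT \<xi>|lborel. (norm (FT \<phi> (- \<xi>)))\<^sup>2)"
      unfolding eq by (rule cauchy_schwarz_integral(2)) (use bs E2 in auto)
    also have "\<dots> \<le> sqrt (LINT \<xi>|lborel. (norm (E \<xi>))\<^sup>2) * sqrt (?d * (LINT x|lborel. (norm (\<phi> x))\<^sup>2))"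
      using bs(2) by (intro mult_left_mono) (auto intro: Bochner_Integration.integral_nonneg)
    also have "\<dots> = C * sqrt (LINT x|lborel. (norm (\<phi> x))\<^sup>2)"
      unfolding C_def by (simp add: real_sqrt_mult)
    finally show ?thesis .
  qed
  show "integrable lborel (\<lambda>x. (norm (?D x))\<^sup>2)"
    by (rule L2_bound_by_duality(1)[OF _ loc C dual]) auto
  show "(LINT x|lborel. (norm (?D x))\<^sup>2) \<le> ?d * (LINT \<xi>|lborel. (norm (E \<xi>))\<^sup>2)"
    unfolding C2[symmetric] by (rule L2_bound_by_duality(2)[OF _ loc C dual]) auto
qed

section \<open>Smooth plateau functions of one variable\<close>

text \<open>
  \<open>D n\<close> is the \<open>n\<close>-th derivative of \<open>D 0\<close>. Keeping all derivatives explicit lets one read off where they vanish.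
\<close>
definition derivative_chain :: "(nat \<Rightarrow> real \<Rightarrow> 'a::real_normed_vector) \<Rightarrow> bool" where
  "derivative_chain D \<longleftrightarrow> (\<forall>n t. (D n has_vector_derivative D (Suc n) t) (at t))"

lemma derivative_chainD: "derivative_chain D \<Longrightarrow> (D n has_vector_derivative D (Suc n) t) (at t)"
  by (simp add: derivative_chain_def)

text \<open>
  The chain of derivatives of the product of \<open>A 0\<close> and \<open>B 0\<close>.
\<close>
definition leibniz :: "(nat \<Rightarrow> real \<Rightarrow> 'a::real_normed_field) \<Rightarrow> (nat \<Rightarrow> real \<Rightarrow> 'a) \<Rightarrow> nat \<Rightarrow> real \<Rightarrow> 'a" where
  "leibniz A B n t = (\<Sum>i\<le>n. of_nat (n choose i) * A i t * B (n - i) t)"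

lemma derivative_chain_leibniz:
  assumes A: "derivative_chain A" and B: "derivative_chain B"
  shows "derivative_chain (leibniz A B)"
  unfolding derivative_chain_def
proof (intro allI)
  fix n t
  let ?T = "\<lambda>i. A i t * B (Suc n - i) t"
  have "(leibniz A B n has_vector_derivative
     (\<Sum>i\<le>n. of_nat (n choose i) * A i t * B (Suc (n - i)) t + of_nat (n choose i) * A (Suc i) t * B (n - i) t)) (at t)"
    unfolding leibniz_def[abs_def]
    by (intro derivative_intros derivative_chainD[OF A] derivative_chainD[OF B] | simp)+
  also have "(\<Sum>i\<le>n. of_nat (n choose i) * A i t * B (Suc (n - i)) t + of_nat (n choose i) * A (Suc i) t * B (n - i) t)
      = (\<Sum>i\<le>n. of_nat (n choose i) * ?T i) + (\<Sum>i\<le>n. of_nat (n choose i) * ?T (Suc i))"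
    unfolding sum.distrib by (intro arg_cong2[where f="(+)"] sum.cong) (auto simp: Suc_diff_le mult.assoc)
  also have "(\<Sum>i\<le>n. of_nat (n choose i) * ?T i) = (\<Sum>i\<le>Suc n. of_nat (n choose i) * ?T i)"
    by simp
  also have "(\<Sum>i\<le>n. of_nat (n choose i) * ?T (Suc i)) = (\<Sum>i\<le>Suc n. of_nat (case i of 0 \<Rightarrow> 0 | Suc j \<Rightarrow> n choose j) * ?T i)"
    by (subst sum.atMost_Suc_shift) simp
  also have "(\<Sum>i\<le>Suc n. of_nat (n choose i) * ?T i) + \<dots> = (\<Sum>i\<le>Suc n. of_nat (Suc n choose i) * ?T i)"
    unfolding sum.distrib[symmetric]
    by (intro sum.cong refl) (auto split: nat.split simp: algebra_simps)
  also have "\<dots> = leibniz A B (Suc n) t" by (simp add: leibniz_def mult.assoc)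
  finally show "(leibniz A B n has_vector_derivative leibniz A B (Suc n) t) (at t)" .
qed

lemma derivative_chain_affine:
  assumes A: "derivative_chain A"
  shows "derivative_chain (\<lambda>n t. c ^ n *\<^sub>R A n (c * t + b))"
  unfolding derivative_chain_def
proof (intro allI)
  fix n t
  have "((\<lambda>t. c * t + b) has_vector_derivative c) (at t)"
    by (auto intro!: derivative_eq_intros)
  from vector_diff_chain_at[OF this derivative_chainD[OF A, of n]]
  have "((\<lambda>t. A n (c * t + b)) has_vector_derivative c *\<^sub>R A (Suc n) (c * t + b)) (at t)"
    by (simp add: o_def)
  then have "((\<lambda>t. c ^ n *\<^sub>R A n (c * t + b)) has_vector_derivative c ^ n *\<^sub>R (c *\<^sub>R A (Suc n) (c * t + b))) (at t)"
    by (intro derivative_eq_intros) auto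
  then show "((\<lambda>t. c ^ n *\<^sub>R A n (c * t + b)) has_vector_derivative c ^ Suc n *\<^sub>R A (Suc n) (c * t + b)) (at t)"
    by (simp add: mult.commute)
qed

text \<open>
  The \<open>n\<close>-th derivative of \<open>exp (- (1 / t))\<close> is a polynomial in \<open>1 / t\<close> times \<open>exp (- (1 / t))\<close>.
\<close>
fun flat_poly :: "nat \<Rightarrow> real poly" where
  "flat_poly 0 = 1"
| "flat_poly (Suc n) = [:0, 0, 1:] * (flat_poly n - pderiv (flat_poly n))"

definition flat :: "nat \<Rightarrow> real \<Rightarrow> real" where
  "flat n t = (if t > 0 then poly (flat_poly n) (1 / t) * exp (- (1 / t)) else 0)"

lemma poly_exp_tendsto_0: "((\<lambda>y. poly p y * exp (- y)) \<longlongrightarrow> 0) at_top" for p :: "real poly"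
proof -
  have "((\<lambda>y. \<Sum>i\<le>degree p. coeff p i * (y ^ i / exp y)) \<longlongrightarrow> (\<Sum>i\<le>degree p. coeff p i * 0)) at_top"
    by (intro tendsto_intros tendsto_power_div_exp_0)
  then show ?thesis by (simp add: poly_altdef sum_distrib_right exp_minus divide_inverse mult.assoc)
qed

lemma derivative_chain_flat: "derivative_chain flat"
  unfolding derivative_chain_def
proof (intro allI)
  fix n t
  consider "t > 0" | "t < 0" | "t = (0::real)" by linarith
  then show "(flat n has_vector_derivative flat (Suc n) t) (at t)"
  proof cases
    case 1
    have y: "((\<lambda>t. 1 / t) has_real_derivative - (1 / t\<^sup>2)) (at t)"
      using 1 by (auto intro!: derivative_eq_intros simp: power2_eq_square)
    have "((\<lambda>t. poly (flat_poly n) (1 / t) * exp (- (1 / t))) has_real_derivative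
      poly (pderiv (flat_poly n)) (1 / t) * (- (1 / t\<^sup>2)) * exp (- (1 / t)) + poly (flat_poly n) (1 / t) * (exp (- (1 / t)) * (1 / t\<^sup>2))) (at t)"
      by (rule DERIV_cong[OF DERIV_mult[OF DERIV_chain2[OF poly_DERIV y] DERIV_chain2[OF DERIV_exp DERIV_minus[OF y]]]])
         (simp add: algebra_simps)
    also have "poly (pderiv (flat_poly n)) (1 / t) * (- (1 / t\<^sup>2)) * exp (- (1 / t)) + poly (flat_poly n) (1 / t) * (exp (- (1 / t)) * (1 / t\<^sup>2)) = flat (Suc n) t"
      using 1 by (simp add: flat_def algebra_simps power2_eq_square)
    finally have "((\<lambda>t. poly (flat_poly n) (1 / t) * exp (- (1 / t))) has_vector_derivative flat (Suc n) t) (at t)"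
      by (simp add: has_real_derivative_iff_has_vector_derivative)
    then show ?thesis
      by (rule has_vector_derivative_transform_within_open[of _ _ _ "{0<..}"]) (use 1 in \<open>auto simp: flat_def\<close>)
  next
    case 2
    have "((\<lambda>t. 0) has_vector_derivative flat (Suc n) t) (at t)"
      using 2 by (auto simp: flat_def)
    then show ?thesis
      by (rule has_vector_derivative_transform_within_open[of _ _ _ "{..<0}"]) (use 2 in \<open>auto simp: flat_def\<close>)
  next
    case 3
    have "((\<lambda>h. (flat n h - flat n 0) / (h - 0)) \<longlongrightarrow> 0) (at 0)"
    proof (rule filterlim_split_at)
      show "((\<lambda>h. (flat n h - flat n 0) / (h - 0)) \<longlongrightarrow> 0) (at_left 0)"
        by (rule tendsto_eventually) (auto simp: flat_def eventually_at_left_field intro: exI[of _ "-1"])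
      have "((\<lambda>h. poly ([:0, 1:] * flat_poly n) (inverse h) * exp (- (inverse h))) \<longlongrightarrow> 0) (at_right 0)"
        by (rule filterlim_compose[OF poly_exp_tendsto_0 filterlim_inverse_at_top_right])
      moreover have "eventually (\<lambda>h. poly ([:0, 1:] * flat_poly n) (inverse h) * exp (- (inverse h)) = (flat n h - flat n 0) / (h - 0)) (at_right (0::real))"
        unfolding eventually_at_right_field
        by (intro exI[of _ 1]) (simp add: flat_def inverse_eq_divide)
      ultimately show "((\<lambda>h. (flat n h - flat n 0) / (h - 0)) \<longlongrightarrow> 0) (at_right 0)"
        by (rule Lim_transform_eventually)
    qed
    then have "(flat n has_real_derivative 0) (at 0)"
      by (simp add: has_field_derivative_iff)
    then show ?thesis
      using 3 by (simp add: has_real_derivative_iff_has_vector_derivative) (simp add: flat_def)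
  qed
qed

text \<open>
  The derivatives of \<open>flat 0 (1 + t) * flat 0 (1 - t)\<close>, a nonnegative function supported in \<open>[-1, 1]\<close>.
\<close>
definition bump :: "nat \<Rightarrow> real \<Rightarrow> real" where
  "bump = leibniz (\<lambda>n t. 1 ^ n *\<^sub>R flat n (1 * t + 1)) (\<lambda>n t. (-1) ^ n *\<^sub>R flat n (-1 * t + 1))"

lemma derivative_chain_bump: "derivative_chain bump"
  unfolding bump_def by (intro derivative_chain_leibniz derivative_chain_affine derivative_chain_flat)

lemma bump_zero: "\<bar>t\<bar> \<ge> 1 \<Longrightarrow> bump n t = 0"
  unfolding bump_def leibniz_def by (rule sum.neutral) (auto simp: flat_def)

lemma bump_0: "bump 0 t = flat 0 (t + 1) * flat 0 (1 - t)"
  by (simp add: bump_def leibniz_def)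

lemma bump_nonneg: "bump 0 t \<ge> 0" and bump_0_pos: "bump 0 0 > 0"
  unfolding bump_0 by (auto simp: flat_def)

lemma bump_continuous: "continuous_on S (bump n)"
  using derivative_chainD[OF derivative_chain_bump]
  by (auto intro!: continuous_at_imp_continuous_on has_vector_derivative_continuous)

definition bump_mass :: real where "bump_mass = integral {-2..2} (bump 0)"

text \<open>
  The normalised primitive of the bump and its derivatives: a smooth transition from 0 on \<open>(-\<infinity>, -1]\<close> to 1 on \<open>[1, \<infinity>)\<close>.
  The lower limit \<open>-2\<close> is any number below the support.
\<close>
definition step :: "nat \<Rightarrow> real \<Rightarrow> real" where
  "step n t = (case n of 0 \<Rightarrow> integral {-2..t} (bump 0) / bump_mass | Suc k \<Rightarrow> bump k t / bump_mass)"

lemma bump_integrable: "bump 0 integrable_on {a..b}"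
  by (rule integrable_continuous_interval) (rule bump_continuous)

lemma bump_mass_pos: "bump_mass > 0"
proof -
  have "bump_mass \<ge> 0" unfolding bump_mass_def
    by (rule Henstock_Kurzweil_Integration.integral_nonneg[OF bump_integrable]) (rule bump_nonneg)
  moreover have "bump_mass \<noteq> 0"
  proof
    assume "bump_mass = 0"
    then have "(bump 0 has_integral 0) (cbox (-2) 2)"
      using bump_integrable[of "-2" 2] unfolding bump_mass_def by (simp add: has_integral_iff)
    from has_integral_0_cbox_imp_0[OF bump_continuous bump_nonneg this, of 0]
    have "bump 0 0 = 0" by (auto simp: box_real)
    then show False using bump_0_pos by simp
  qed
  ultimately show ?thesis by linarith
qed

lemma step_left: "t \<le> -1 \<Longrightarrow> step 0 t = 0"
proof -
  assume t: "t \<le> -1"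
  have "integral {-2..t} (bump 0) = integral {-2..t} (\<lambda>_. 0)"
    by (rule Henstock_Kurzweil_Integration.integral_cong) (use t in \<open>auto intro!: bump_zero\<close>)
  then show ?thesis by (simp add: step_def)
qed

lemma step_right: "t \<ge> 1 \<Longrightarrow> step 0 t = 1"
proof -
  assume t: "t \<ge> 1"
  have "integral {-2..t} (bump 0) = integral {-2..1} (bump 0)" if "t \<ge> 1" for t
  proof -
    have "integral {1..t} (bump 0) = integral {1..t} (\<lambda>_. 0)"
      by (rule Henstock_Kurzweil_Integration.integral_cong) (auto intro!: bump_zero)
    moreover have "integral {-2..1} (bump 0) + integral {1..t} (bump 0) = integral {-2..t} (bump 0)"
      by (rule Henstock_Kurzweil_Integration.integral_combine) (use that bump_integrable in auto)
    ultimately show ?thesis by simp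
  qed
  from this[OF t] this[of 2] have "integral {-2..t} (bump 0) = bump_mass" by (simp add: bump_mass_def)
  then show ?thesis using bump_mass_pos by (simp add: step_def)
qed

lemma step_Suc_zero: "\<bar>t\<bar> \<ge> 1 \<Longrightarrow> step (Suc n) t = 0"
  by (simp add: step_def bump_zero)

lemma derivative_chain_step: "derivative_chain step"
  unfolding derivative_chain_def
proof (intro allI)
  fix n t
  show "(step n has_vector_derivative step (Suc n) t) (at t)"
  proof (cases n)
    case (Suc k)
    have "((\<lambda>t. bump k t / bump_mass) has_vector_derivative bump (Suc k) t / bump_mass) (at t)"
      by (intro has_vector_derivative_divide derivative_chainD[OF derivative_chain_bump])
    then show ?thesis unfolding Suc step_def[abs_def] by simp
  next
    case 0
    show ?thesis
    proof (cases "t < -1")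
      case True
      have "((\<lambda>t. 0) has_vector_derivative step (Suc n) t) (at t)"
        using True by (simp add: step_Suc_zero)
      then show ?thesis unfolding 0
        by (rule has_vector_derivative_transform_within_open[of _ _ _ "{..<-1}"]) (use True in \<open>auto simp: step_left\<close>)
    next
      case False
      have "((\<lambda>t. integral {-2..t} (bump 0)) has_vector_derivative bump 0 t) (at t within {-2..t+1})"
        by (rule integral_has_vector_derivative[OF bump_continuous]) (use False in auto)
      then have "((\<lambda>t. integral {-2..t} (bump 0)) has_vector_derivative bump 0 t) (at t)"
        using False by (subst (asm) at_within_interior) auto
      then have "((\<lambda>t. integral {-2..t} (bump 0) / bump_mass) has_vector_derivative bump 0 t / bump_mass) (at t)"
        by (intro has_vector_derivative_divide)
      then show ?thesis unfolding 0 step_def[abs_def] by simp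
    qed
  qed
qed

text \<open>
  A difference of two shifted steps equals 1 on \<open>[-(b - 1), b - 1]\<close> and, if \<open>b \<ge> 0\<close>, 0 outside \<open>[-(b + 1), b + 1]\<close>. Its derivatives
  vanish identically on the former interval, so products with it are differentiated there as if it were absent.
\<close>
definition plateau :: "real \<Rightarrow> nat \<Rightarrow> real \<Rightarrow> complex" where
  "plateau b n t = of_real (step n (t + b) - step n (t - b))"

lemma derivative_chain_plateau: "derivative_chain (plateau b)"
  unfolding derivative_chain_def
proof (intro allI)
  fix n t
  have sh: "((\<lambda>t. step n (t + c)) has_vector_derivative step (Suc n) (t + c)) (at t)" for c
    using derivative_chainD[OF derivative_chain_affine[OF derivative_chain_step, of 1 c], of n t] by simp
  have "((\<lambda>t. step n (t + b) - step n (t + (- b))) has_real_derivative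
    step (Suc n) (t + b) - step (Suc n) (t + (- b))) (at t)"
    unfolding has_real_derivative_iff_has_vector_derivative by (intro has_vector_derivative_diff sh)
  then have "((\<lambda>t. complex_of_real (step n (t + b) - step n (t + (- b)))) has_vector_derivative
    complex_of_real (step (Suc n) (t + b) - step (Suc n) (t + (- b)))) (at t)"
    by (rule has_vector_derivative_of_real)
  then show "(plateau b n has_vector_derivative plateau b (Suc n) t) (at t)"
    unfolding plateau_def[abs_def] by simp
qed

lemma plateau_one: "\<bar>t\<bar> \<le> b - 1 \<Longrightarrow> plateau b 0 t = 1"
  by (simp add: plateau_def step_right step_left)

lemma plateau_deriv_zero: "\<bar>t\<bar> \<le> b - 1 \<Longrightarrow> plateau b (Suc n) t = 0"
  by (simp add: plateau_def step_Suc_zero)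

lemma plateau_outside: "\<bar>t\<bar> \<ge> b + 1 \<Longrightarrow> b \<ge> 0 \<Longrightarrow> plateau b 0 t = 0"
  by (cases "t \<ge> 0") (auto simp: plateau_def step_right step_left)

text \<open>
  The derivatives of the one-dimensional wave \<open>cis (a * t)\<close>.
\<close>
definition wave :: "real \<Rightarrow> nat \<Rightarrow> real \<Rightarrow> complex" where
  "wave a n t = (\<i> * of_real a) ^ n * cis (a * t)"

lemma derivative_chain_wave: "derivative_chain (wave a)"
  unfolding derivative_chain_def
proof (intro allI)
  fix n t
  have "((\<lambda>t. cis (a * t)) has_vector_derivative \<i> * of_real a * cis (a * t)) (at t)"
  proof -
    have "((\<lambda>z. exp (\<i> * of_real a * z)) has_field_derivative \<i> * of_real a * exp (\<i> * of_real a * of_real t)) (at (of_real t))"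
      by (auto intro!: derivative_eq_intros)
    from has_vector_derivative_real_field[OF this] show ?thesis
      by (simp add: cis_conv_exp mult.assoc)
  qed
  then have "((\<lambda>t. (\<i> * of_real a) ^ n * cis (a * t)) has_vector_derivative (\<i> * of_real a) ^ n * (\<i> * of_real a * cis (a * t))) (at t)"
    by (intro derivative_eq_intros) auto
  then show "(wave a n has_vector_derivative wave a (Suc n) t) (at t)"
    unfolding wave_def[abs_def] by (simp add: mult_ac)
qed

section \<open>Cut-off plane waves as test functions\<close>

lemma mem_cube: "x \<in> cube c \<longleftrightarrow> (\<forall>j. \<bar>x $ j\<bar> \<le> c)"
  unfolding cube_def mem_box_cart by (auto simp: abs_le_iff minus_le_iff)

lemma prod_coordinates_has_derivative:
  fixes A :: "'d::finite \<Rightarrow> nat \<Rightarrow> real \<Rightarrow> complex"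
  assumes A: "\<And>j. derivative_chain (A j)"
  shows "((\<lambda>x. \<Prod>j\<in>UNIV. A j (k j) (x $ j)) has_derivative
     (\<lambda>y. \<Sum>i\<in>UNIV. (y $ i *\<^sub>R A i (Suc (k i)) (x $ i)) * (\<Prod>j\<in>UNIV - {i}. A j (k j) (x $ j)))) (at x)"
proof (rule has_derivative_prod)
  fix i
  have "((\<lambda>x. x $ i) has_derivative (\<lambda>x. x $ i)) (at x)"
    by (rule bounded_linear_imp_has_derivative) (rule bounded_linear_vec_nth)
  from has_derivative_compose[OF this derivative_chainD[OF A, unfolded has_vector_derivative_def]]
  show "((\<lambda>x. A i (k i) (x $ i)) has_derivative (\<lambda>y. y $ i *\<^sub>R A i (Suc (k i)) (x $ i))) (at x)" .
qed

text \<open>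
  Each partial derivative advances one of the chains, so only the number of derivatives in each coordinate matters.
\<close>
lemma partials_prod_coordinates:
  fixes A :: "'d::finite \<Rightarrow> nat \<Rightarrow> real \<Rightarrow> complex"
  assumes A: "\<And>j. derivative_chain (A j)"
  shows "partials js (\<lambda>x. \<Prod>j\<in>UNIV. A j 0 (x $ j)) = (\<lambda>x. \<Prod>j\<in>UNIV. A j (count_list js j) (x $ j))"
proof (induction js)
  case Nil
  then show ?case by (simp add: partials_def)
next
  case (Cons i js)
  let ?k = "count_list js"
  have "partials (i # js) (\<lambda>x. \<Prod>j\<in>UNIV. A j 0 (x $ j)) = partial i (\<lambda>x. \<Prod>j\<in>UNIV. A j (?k j) (x $ j))"
    using Cons by (simp add: partials_def)
  also have "\<dots> = (\<lambda>x. \<Prod>j\<in>UNIV. A j (count_list (i # js) j) (x $ j))"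
  proof (rule ext)
    fix x
    have "partial i (\<lambda>x. \<Prod>j\<in>UNIV. A j (?k j) (x $ j)) x =
       (\<Sum>l\<in>UNIV. (axis i 1 $ l *\<^sub>R A l (Suc (?k l)) (x $ l)) * (\<Prod>j\<in>UNIV - {l}. A j (?k j) (x $ j)))"
        unfolding partial_def frechet_derivative_at[symmetric, OF prod_coordinates_has_derivative[of A, OF A]] ..
    also have "\<dots> = (\<Sum>l\<in>UNIV. if l = i then A i (Suc (?k i)) (x $ i) * (\<Prod>j\<in>UNIV - {i}. A j (?k j) (x $ j)) else 0)"
      by (rule sum.cong) (auto simp: axis_def)
    also have "\<dots> = A i (Suc (?k i)) (x $ i) * (\<Prod>j\<in>UNIV - {i}. A j (?k j) (x $ j))"
      by simp
    also have "(\<Prod>j\<in>UNIV - {i}. A j (?k j) (x $ j)) = (\<Prod>j\<in>UNIV - {i}. A j (count_list (i # js) j) (x $ j))"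
      by (rule prod.cong) auto
    also have "A i (Suc (?k i)) (x $ i) * \<dots> = (\<Prod>j\<in>UNIV. A j (count_list (i # js) j) (x $ j))"
      by (subst prod.remove[of UNIV i]) auto
    finally show "partial i (\<lambda>x. \<Prod>j\<in>UNIV. A j (?k j) (x $ j)) x = (\<Prod>j\<in>UNIV. A j (count_list (i # js) j) (x $ j))" .
  qed
  finally show ?case .
qed

definition cutoff :: "real \<Rightarrow> real^'d \<Rightarrow> complex" where
  "cutoff b x = (\<Prod>j\<in>UNIV. plateau b 0 (x $ j))"

text \<open>
  A plane wave times a plateau in each coordinate, defined as a product of functions of one coordinate
  so that its iterated partial derivatives are explicit.
\<close>
definition cut_wave :: "real \<Rightarrow> real^'d \<Rightarrow> real^'d \<Rightarrow> complex" where
  "cut_wave b \<xi> x = (\<Prod>j\<in>UNIV. leibniz (plateau b) (wave (\<xi> $ j)) 0 (x $ j))"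

lemma cut_wave_eq: "cut_wave b \<xi> x = cutoff b x * cis (\<xi> \<bullet> x)"
  by (simp add: cut_wave_def cutoff_def leibniz_def wave_def prod.distrib prod_cis inner_vec_def)

lemma cutoff_one: "x \<in> cube (b - 1) \<Longrightarrow> cutoff b x = 1"
  unfolding cutoff_def mem_cube by (intro prod.neutral ballI plateau_one) auto

lemma cutoff_outside: "b \<ge> 0 \<Longrightarrow> x \<notin> cube (b + 1) \<Longrightarrow> cutoff b x = 0"
proof -
  assume b: "b \<ge> 0" and "x \<notin> cube (b + 1)"
  then obtain j where "\<bar>x $ j\<bar> \<ge> b + 1" unfolding mem_cube by (meson linear)
  then have "plateau b 0 (x $ j) = 0" using b by (rule plateau_outside)
  then show ?thesis unfolding cutoff_def by (intro prod_zero) auto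
qed

lemma cutoff_continuous: "continuous_on UNIV (cutoff b :: real^'d \<Rightarrow> complex)"
proof -
  have "continuous_on UNIV (plateau b 0)"
    by (intro continuous_at_imp_continuous_on ballI has_vector_derivative_continuous[OF derivative_chainD[OF derivative_chain_plateau]])
  then have "continuous_on UNIV (\<lambda>x::real^'d. plateau b 0 (x $ j))" for j
    by (rule continuous_on_compose2) (auto intro: continuous_intros)
  then show ?thesis unfolding cutoff_def[abs_def] by (rule continuous_on_prod)
qed

lemma cut_wave_continuous: "continuous_on UNIV (cut_wave b \<xi>)"
  unfolding cut_wave_eq[abs_def] cis_conv_exp by (intro continuous_intros cutoff_continuous)

text \<open>
  On the inner cube the cutoff is locally constant, hence the function is differentiated like a plane wave.
\<close>
lemma cut_wave_partials:
  assumes x: "x \<in> cube (b - 1)"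
  shows "partials (replicate m i) (cut_wave b \<xi>) x = (\<i> * of_real (\<xi> $ i)) ^ m * cis (\<xi> \<bullet> x)"
proof -
  have ch: "derivative_chain (leibniz (plateau b) (wave (\<xi> $ j)))" for j
    by (intro derivative_chain_leibniz derivative_chain_plateau derivative_chain_wave)
  have l: "leibniz (plateau b) (wave a) n t = wave a n t" if t: "\<bar>t\<bar> \<le> b - 1" for a n t
  proof -
    have "(\<Sum>i\<le>n. of_nat (n choose i) * plateau b i t * wave a (n - i) t)
      = (\<Sum>i\<in>{0}. of_nat (n choose i) * plateau b i t * wave a (n - i) t)"
    proof (rule sum.mono_neutral_right)
      show "\<forall>i\<in>{..n} - {0}. of_nat (n choose i) * plateau b i t * wave a (n - i) t = 0"
      proof
        fix i assume "i \<in> {..n} - {0}"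
        then obtain k where "i = Suc k" by (cases i) auto
        then show "of_nat (n choose i) * plateau b i t * wave a (n - i) t = 0"
          using plateau_deriv_zero[OF t] by simp
      qed
    qed auto
    then show ?thesis using plateau_one[OF t] by (simp add: leibniz_def)
  qed
  have "partials (replicate m i) (cut_wave b \<xi>) x = (\<Prod>j\<in>UNIV. wave (\<xi> $ j) (count_list (replicate m i) j) (x $ j))"
    unfolding cut_wave_def[abs_def] partials_prod_coordinates[of "\<lambda>j. leibniz (plateau b) (wave (\<xi> $ j))", OF ch]
    using x by (intro prod.cong l) (auto simp: mem_cube)
  also have "\<dots> = (\<Prod>j\<in>UNIV. (\<i> * of_real (\<xi> $ j)) ^ (count_list (replicate m i) j)) * cis (\<xi> \<bullet> x)"
    by (simp add: wave_def prod.distrib prod_cis inner_vec_def)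
  also have "(\<Prod>j\<in>UNIV. (\<i> * of_real (\<xi> $ j)) ^ (count_list (replicate m i) j))
     = (\<Prod>j\<in>UNIV. if j = i then (\<i> * of_real (\<xi> $ i)) ^ m else 1)"
    by (intro prod.cong refl) (induction m; auto)
  finally show ?thesis by simp
qed

lemma cut_wave_test_function:
  assumes b: "b \<ge> 0"
  shows "test_function (cut_wave b \<xi>)"
proof -
  have ch: "derivative_chain (leibniz (plateau b) (wave (\<xi> $ j)))" for j
    by (intro derivative_chain_leibniz derivative_chain_plateau derivative_chain_wave)
  have "{x. cut_wave b \<xi> x \<noteq> 0} \<subseteq> cube (b + 1)"
    using cutoff_outside[OF b] by (auto simp: cut_wave_eq)
  then have "bounded {x. cut_wave b \<xi> x \<noteq> 0}"
    unfolding cube_def by (rule bounded_subset[OF bounded_cbox])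
  moreover have "partials js (cut_wave b \<xi>) differentiable (at x)" for js x
    unfolding cut_wave_def[abs_def] partials_prod_coordinates[of "\<lambda>j. leibniz (plateau b) (wave (\<xi> $ j))", OF ch]
    using prod_coordinates_has_derivative[of "\<lambda>j. leibniz (plateau b) (wave (\<xi> $ j))", OF ch]
    by (auto simp: differentiable_def)
  ultimately show ?thesis by (simp add: test_function_def)
qed


section \<open>Plancherel inequalities for Lebesgue measurable functions\<close>

lemma borel_version:
  fixes f :: "'a::euclidean_space \<Rightarrow> complex"
  assumes f: "f \<in> borel_measurable lebesgue"
  obtains f' where "f' \<in> borel_measurable borel" "AE x in lebesgue. f x = f' x"
proof -
  have "(\<lambda>x. Re (f x)) \<in> borel_measurable lebesgue" "(\<lambda>x. Im (f x)) \<in> borel_measurable lebesgue"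
    using f by auto
  then obtain g h where [measurable]: "g \<in> borel_measurable lborel" "h \<in> borel_measurable lborel"
    and ae: "AE x in lborel. Re (f x) = g x" "AE x in lborel. Im (f x) = h x"
    using completion_ex_borel_measurable_real[of "\<lambda>x. Re (f x)" lborel]
      completion_ex_borel_measurable_real[of "\<lambda>x. Im (f x)" lborel] by auto
  have "AE x in lborel. f x = Complex (g x) (h x)"
    using ae by eventually_elim (simp add: complex_eq_iff)
  moreover have "(\<lambda>x. Complex (g x) (h x)) = (\<lambda>x. of_real (g x) + \<i> * of_real (h x))"
    by (simp add: Complex_eq)
  then have "(\<lambda>x. Complex (g x) (h x)) \<in> borel_measurable borel" by simp
  ultimately show ?thesis by (intro that) (auto intro: AE_completion)
qed

lemma borel_to_lebesgue: "f \<in> borel_measurable borel \<Longrightarrow> f \<in> borel_measurable lebesgue"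
  by (rule measurable_completion) simp

lemma borel_version_integral:
  fixes f f' :: "'a::euclidean_space \<Rightarrow> 'b::{banach,second_countable_topology}"
  assumes f: "f \<in> borel_measurable lebesgue" and f': "f' \<in> borel_measurable borel"
    and ae: "AE x in lebesgue. f x = f' x"
  shows "integrable lebesgue f \<longleftrightarrow> integrable lborel f'"
    and "(LINT x|lebesgue. f x) = (LINT x|lborel. f' x)"
proof -
  have m: "f' \<in> borel_measurable lborel" using f' by simp
  have "integrable lebesgue f \<longleftrightarrow> integrable lebesgue f'"
    by (rule integrable_cong_AE[OF f borel_to_lebesgue[OF f'] ae])
  also have "\<dots> \<longleftrightarrow> integrable lborel f'"
    by (rule integrable_completion[OF m])
  finally show "integrable lebesgue f \<longleftrightarrow> integrable lborel f'" .
  have "(LINT x|lebesgue. f x) = (LINT x|lebesgue. f' x)"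
    by (rule integral_cong_AE[OF f borel_to_lebesgue[OF f'] ae])
  also have "\<dots> = (LINT x|lborel. f' x)" by (rule integral_completion[OF m])
  finally show "(LINT x|lebesgue. f x) = (LINT x|lborel. f' x)" .
qed

text \<open>
  The transform of a Lebesgue measurable function. It agrees with \<open>FT\<close> of any Borel representative.
\<close>
definition FTL :: "('a::euclidean_space \<Rightarrow> complex) \<Rightarrow> 'a \<Rightarrow> complex" where
  "FTL f \<xi> = (LINT x|lebesgue. cis (\<xi> \<bullet> x) * f x)"

lemma cis_lebesgue[measurable]: "(\<lambda>x. cis (\<xi> \<bullet> x)) \<in> borel_measurable lebesgue"
  by (rule borel_to_lebesgue) measurable

lemma FTL_eq_FT:
  assumes f: "f \<in> borel_measurable lebesgue" and f': "f' \<in> borel_measurable borel"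
    and ae: "AE x in lebesgue. f x = f' x"
  shows "FTL f = FT f'"
  unfolding FTL_def[abs_def] FT_def[abs_def]
proof (rule ext)
  fix \<xi>
  have [measurable]: "f \<in> borel_measurable lebesgue" "f' \<in> borel_measurable borel" by fact+
  show "(LINT x|lebesgue. cis (\<xi> \<bullet> x) * f x) = (LINT x|lborel. cis (\<xi> \<bullet> x) * f' x)"
    by (rule borel_version_integral(2)) (use ae in auto)
qed

lemma fourier_FTL: "fourier f \<xi> = FTL f \<xi> / of_real ((2 * pi) ^ CARD('d))" for f :: "real^'d \<Rightarrow> complex"
  by (simp add: fourier_def FTL_def cis_conv_exp)

lemma inv_fourier_FTL: "inv_fourier u x = FTL u (- x)"
  by (simp add: inv_fourier_def FTL_def cis_conv_exp inner_commute)

lemma FTL_zero_imp_zero: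
  fixes f :: "'a::euclidean_space \<Rightarrow> complex"
  assumes f: "integrable lebesgue f" and 0: "\<And>\<xi>. FTL f \<xi> = 0"
  shows "AE x in lebesgue. f x = 0"
proof -
  have fm: "f \<in> borel_measurable lebesgue" using f by auto
  then obtain f' where f': "f' \<in> borel_measurable borel" "AE x in lebesgue. f x = f' x"
    by (rule borel_version)
  have "AE x in lborel. f' x = 0"
    by (rule FT_zero_imp_zero)
       (use f 0 borel_version_integral(1)[OF fm f'] FTL_eq_FT[OF fm f'] in auto)
  then have "AE x in lebesgue. f' x = 0" by (rule AE_completion)
  with f'(2) show ?thesis by eventually_elim simp
qed

lemma fourier_bounded: "norm (fourier f \<xi>) \<le> (LINT x|lebesgue. norm (f x)) / (2 * pi) ^ CARD('d)" for f :: "real^'d \<Rightarrow> complex"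
proof -
  have "norm (FTL f \<xi>) \<le> (LINT x|lebesgue. norm (cis (\<xi> \<bullet> x) * f x))"
    unfolding FTL_def by (rule integral_norm_bound)
  then show ?thesis unfolding fourier_FTL norm_divide norm_of_real
    by (simp add: norm_mult divide_right_mono)
qed

lemma fourier_borel:
  fixes f :: "real^'d \<Rightarrow> complex"
  assumes f: "f \<in> borel_measurable lebesgue"
  shows "fourier f \<in> borel_measurable borel"
proof -
  obtain f' where f': "f' \<in> borel_measurable borel" "AE x in lebesgue. f x = f' x"
    using f by (rule borel_version)
  have [measurable]: "f' \<in> borel_measurable borel" by fact
  show ?thesis unfolding fourier_FTL[abs_def] FTL_eq_FT[OF f f'] by measurable
qed

lemma L2_norm_power2: "(L2_norm f)\<^sup>2 = (LINT x|lebesgue. (norm (f x))\<^sup>2)"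
  unfolding L2_norm_def by (intro real_sqrt_pow2 Bochner_Integration.integral_nonneg) simp

text \<open>
  Bessel's inequality in the normalisation of \<open>fourier\<close>.
\<close>
lemma fourier_L2:
  fixes f :: "real^'d \<Rightarrow> complex"
  assumes f: "integrable lebesgue f" and f2: "square_integrable f"
  shows "square_integrable (fourier f)" "(2 * pi) ^ CARD('d) * (L2_norm (fourier f))\<^sup>2 \<le> (L2_norm f)\<^sup>2"
proof -
  let ?d = "(2 * pi) ^ CARD('d)"
  have fm: "f \<in> borel_measurable lebesgue" using f by auto
  then obtain f' where f': "f' \<in> borel_measurable borel" "AE x in lebesgue. f x = f' x"
    by (rule borel_version)
  have [measurable]: "f' \<in> borel_measurable borel" "f \<in> borel_measurable lebesgue" by fact+
  have F: "fourier f = (\<lambda>\<xi>. FT f' \<xi> / of_real ?d)"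
    unfolding fourier_FTL[abs_def] FTL_eq_FT[OF fm f'] ..
  have [measurable]: "fourier f \<in> borel_measurable borel" by (rule fourier_borel[OF fm])
  have i1: "integrable lborel f'" using f borel_version_integral(1)[OF fm f'] by simp
  have sq: "integrable lebesgue (\<lambda>x. (norm (f x))\<^sup>2) \<longleftrightarrow> integrable lborel (\<lambda>x. (norm (f' x))\<^sup>2)"
    "(LINT x|lebesgue. (norm (f x))\<^sup>2) = (LINT x|lborel. (norm (f' x))\<^sup>2)"
    by (rule borel_version_integral; use f'(2) in auto)+
  have i2: "integrable lborel (\<lambda>x. (norm (f' x))\<^sup>2)" using f2 sq unfolding square_integrable_def by simp
  note bs = bessel_FT[OF i1 i2]
  have eq: "(norm (fourier f \<xi>))\<^sup>2 = (norm (FT f' \<xi>))\<^sup>2 / ?d\<^sup>2" for \<xi>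
    unfolding F norm_divide norm_of_real power_divide by simp
  have ib: "integrable lborel (\<lambda>\<xi>. (norm (fourier f \<xi>))\<^sup>2)" unfolding eq using bs(1) by simp
  show "square_integrable (fourier f)"
    unfolding square_integrable_def using ib
    by (auto intro!: borel_to_lebesgue simp: integrable_completion)
  have "(L2_norm (fourier f))\<^sup>2 = (LINT \<xi>|lborel. (norm (FT f' \<xi>))\<^sup>2) / ?d\<^sup>2"
    unfolding L2_norm_power2 by (subst integral_completion) (simp_all add: eq)
  then have "?d * (L2_norm (fourier f))\<^sup>2 = (LINT \<xi>|lborel. (norm (FT f' \<xi>))\<^sup>2) / ?d"
    by (simp add: power2_eq_square)
  also have "\<dots> \<le> (LINT x|lborel. (norm (f' x))\<^sup>2)"
    using bs(2) by (simp add: field_simps)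
  finally show "?d * (L2_norm (fourier f))\<^sup>2 \<le> (L2_norm f)\<^sup>2" unfolding L2_norm_power2 sq(2) .
qed

lemma L2_inverse_fourier_diff:
  fixes f u :: "real^'d \<Rightarrow> complex"
  assumes f: "integrable lebesgue f" and f2: "square_integrable f"
    and u: "integrable lebesgue u" and u2: "square_integrable u"
  shows "square_integrable (\<lambda>x. f x - inv_fourier u x)"
    and "(L2_norm (\<lambda>x. f x - inv_fourier u x))\<^sup>2 \<le> (2 * pi) ^ CARD('d) * (L2_norm (\<lambda>\<xi>. fourier f \<xi> - u \<xi>))\<^sup>2"
proof -
  let ?d = "(2 * pi) ^ CARD('d)"
  have fm: "f \<in> borel_measurable lebesgue" and um: "u \<in> borel_measurable lebesgue" using f u by auto
  obtain f' where f': "f' \<in> borel_measurable borel" "AE x in lebesgue. f x = f' x"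
    using fm by (rule borel_version)
  obtain u' where u': "u' \<in> borel_measurable borel" "AE x in lebesgue. u x = u' x"
    using um by (rule borel_version)
  have [measurable]: "f' \<in> borel_measurable borel" "f \<in> borel_measurable lebesgue"
    "u' \<in> borel_measurable borel" "u \<in> borel_measurable lebesgue" by fact+
  have i: "integrable lborel f'" "integrable lborel u'"
    using f borel_version_integral(1)[OF fm f'] u borel_version_integral(1)[OF um u'] by auto
  have sqf: "integrable lebesgue (\<lambda>x. (norm (f x))\<^sup>2) \<longleftrightarrow> integrable lborel (\<lambda>x. (norm (f' x))\<^sup>2)"
    by (rule borel_version_integral; use f'(2) in auto)
  have squ: "integrable lebesgue (\<lambda>x. (norm (u x))\<^sup>2) \<longleftrightarrow> integrable lborel (\<lambda>x. (norm (u' x))\<^sup>2)"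
    by (rule borel_version_integral; use u'(2) in auto)
  have i2: "integrable lborel (\<lambda>x. (norm (f' x))\<^sup>2)" "integrable lborel (\<lambda>x. (norm (u' x))\<^sup>2)"
    using f2 u2 sqf squ unfolding square_integrable_def by auto
  note main = L2_inverse_FT_diff[OF i(1) i2(1) i(2) i2(2)]
  have F: "fourier f \<xi> = FT f' \<xi> / of_real ?d" for \<xi>
    unfolding fourier_FTL FTL_eq_FT[OF fm f'] ..
  have iu: "inv_fourier u x = FT u' (- x)" for x
    unfolding inv_fourier_FTL FTL_eq_FT[OF um u'] ..
  have [measurable]: "fourier f \<in> borel_measurable lebesgue"
    by (rule borel_to_lebesgue[OF fourier_borel[OF fm]])
  have [measurable]: "inv_fourier u \<in> borel_measurable lebesgue"
    unfolding iu[abs_def] by (rule borel_to_lebesgue) measurable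
  have A: "integrable lebesgue (\<lambda>x. (norm (f x - inv_fourier u x))\<^sup>2) \<longleftrightarrow> integrable lborel (\<lambda>x. (norm (f' x - FT u' (- x)))\<^sup>2)"
    "(LINT x|lebesgue. (norm (f x - inv_fourier u x))\<^sup>2) = (LINT x|lborel. (norm (f' x - FT u' (- x)))\<^sup>2)"
  proof -
    have ae: "AE x in lebesgue. (norm (f x - inv_fourier u x))\<^sup>2 = (norm (f' x - FT u' (- x)))\<^sup>2"
      using f'(2) by eventually_elim (simp add: iu)
    have m: "(\<lambda>x. (norm (f x - inv_fourier u x))\<^sup>2) \<in> borel_measurable lebesgue"
      "(\<lambda>x. (norm (f' x - FT u' (- x)))\<^sup>2) \<in> borel_measurable borel" by measurable
    show "integrable lebesgue (\<lambda>x. (norm (f x - inv_fourier u x))\<^sup>2) \<longleftrightarrow> integrable lborel (\<lambda>x. (norm (f' x - FT u' (- x)))\<^sup>2)"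
      "(LINT x|lebesgue. (norm (f x - inv_fourier u x))\<^sup>2) = (LINT x|lborel. (norm (f' x - FT u' (- x)))\<^sup>2)"
      by (rule borel_version_integral[OF m ae])+
  qed
  have B: "(LINT \<xi>|lebesgue. (norm (fourier f \<xi> - u \<xi>))\<^sup>2) = (LINT \<xi>|lborel. (norm (FT f' \<xi> / of_real ?d - u' \<xi>))\<^sup>2)"
  proof -
    have ae: "AE \<xi> in lebesgue. (norm (fourier f \<xi> - u \<xi>))\<^sup>2 = (norm (FT f' \<xi> / of_real ?d - u' \<xi>))\<^sup>2"
      using u'(2) by eventually_elim (simp only: F)
    show ?thesis by (rule borel_version_integral(2)[OF _ _ ae]) measurable
  qed
  show "square_integrable (\<lambda>x. f x - inv_fourier u x)"
    unfolding square_integrable_def A(1) using main(2) by simp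
  show "(L2_norm (\<lambda>x. f x - inv_fourier u x))\<^sup>2 \<le> ?d * (L2_norm (\<lambda>\<xi>. fourier f \<xi> - u \<xi>))\<^sup>2"
    unfolding L2_norm_power2 A(2) B using main(3) by simp
qed

section \<open>Fourier transforms of weak derivatives\<close>

lemma compact_cube: "compact (cube c)" unfolding cube_def by simp

lemma cube_mono: "x \<in> cube a \<Longrightarrow> a \<le> b \<Longrightarrow> x \<in> cube b"
  unfolding mem_cube by (meson order_trans)

lemma cube_borel[measurable]: "cube c \<in> sets borel" unfolding cube_def by simp

lemma cube_lebesgue[measurable]: "cube c \<in> sets lebesgue" unfolding cube_def by simp

lemma continuous_cube_bound:
  fixes \<phi> :: "real^'d \<Rightarrow> complex"
  assumes c: "continuous_on UNIV \<phi>" and z: "\<And>x. x \<notin> cube c \<Longrightarrow> \<phi> x = 0"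
  obtains B where "B > 0" "\<And>x. norm (\<phi> x) \<le> B * indicator (cube c) x"
proof -
  have "compact (\<phi> ` cube c)"
    by (intro compact_continuous_image continuous_on_subset[OF c] compact_cube) auto
  then obtain B where B: "B > 0" "\<forall>y\<in>\<phi> ` cube c. norm y \<le> B"
    using compact_imp_bounded bounded_pos by metis
  show ?thesis
  proof (rule that[OF B(1)])
    fix x show "norm (\<phi> x) \<le> B * indicator (cube c) x"
    proof (cases "x \<in> cube c")
      case True
      then have "norm (\<phi> x) \<le> B" using B(2) by blast
      then show ?thesis using True by simp
    qed (simp add: z)
  qed
qed

lemma locally_integrable_mult:
  fixes \<phi> :: "real^'d \<Rightarrow> complex"
  assumes f: "locally_integrable f"
    and c: "continuous_on UNIV \<phi>" and z: "\<And>x. x \<notin> cube c \<Longrightarrow> \<phi> x = 0"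
  shows "integrable lebesgue (\<lambda>x. f x * \<phi> x)"
proof -
  obtain B where B: "B > 0" "\<And>x. norm (\<phi> x) \<le> B * indicator (cube c) x"
    using continuous_cube_bound[OF c z] by metis
  have i: "integrable lebesgue (\<lambda>x. indicator (cube c) x *\<^sub>R f x)"
    using f compact_cube unfolding locally_integrable_def set_integrable_def by blast
  have "\<phi> \<in> borel_measurable lebesgue"
    by (rule borel_to_lebesgue[OF borel_measurable_continuous_onI[OF c]])
  then have "(\<lambda>x. (indicator (cube c) x *\<^sub>R f x) * \<phi> x) \<in> borel_measurable lebesgue"
    using i by (intro borel_measurable_times) auto
  also have "(\<lambda>x. (indicator (cube c) x *\<^sub>R f x) * \<phi> x) = (\<lambda>x. f x * \<phi> x)"
    using z by (auto simp: indicator_def)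
  finally have m: "(\<lambda>x. f x * \<phi> x) \<in> borel_measurable lebesgue" .
  show ?thesis
  proof (rule integrable_dominated[OF integrable_mult_right[OF integrable_norm[OF i]] m])
    fix x
    have "norm (f x) * norm (\<phi> x) \<le> norm (f x) * (B * indicator (cube c) x)"
      by (intro mult_left_mono B) simp
    also have "\<dots> = B * norm (indicator (cube c) x *\<^sub>R f x)"
      by (simp add: indicator_def)
    finally show "norm (f x * \<phi> x) \<le> B * norm (indicator (cube c) x *\<^sub>R f x)"
      by (simp only: norm_mult)
  qed
qed

lemma locally_integrable_measurable:
  assumes "locally_integrable f"
  shows "f \<in> borel_measurable lebesgue"
proof (rule borel_measurable_LIMSEQ_metric)
  fix n :: nat
  have "integrable lebesgue (\<lambda>x. indicator (cball 0 (real n)) x *\<^sub>R f x)"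
    using assms compact_cball unfolding locally_integrable_def set_integrable_def by blast
  then show "(\<lambda>x. indicator (cball 0 (real n)) x *\<^sub>R f x) \<in> borel_measurable lebesgue" by auto
next
  fix x :: "real^'a"
  show "(\<lambda>n. indicator (cball 0 (real n)) x *\<^sub>R f x) \<longlonglongrightarrow> f x"
  proof (rule tendsto_eventually, rule eventually_sequentiallyI)
    fix n assume "nat \<lceil>norm x\<rceil> \<le> n"
    then show "indicator (cball 0 (real n)) x *\<^sub>R f x = f x" by (simp add: indicator_def)
  qed
qed

lemma cut_wave_outside: "b \<ge> 0 \<Longrightarrow> x \<notin> cube (b + 1) \<Longrightarrow> cut_wave b \<xi> x = 0"
  by (simp add: cut_wave_eq cutoff_outside)

lemma norm_mem_cube: "norm x \<le> c \<Longrightarrow> x \<in> cube c"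
  unfolding mem_cube by (meson component_le_norm_cart order_trans)

text \<open>
  A variant of the fundamental lemma of the calculus of variations: the hypothesis says that every \<open>h\<close> times a
  cutoff has vanishing Fourier transform, hence vanishes almost everywhere.
\<close>
lemma locally_integrable_zero:
  assumes h: "locally_integrable h"
    and 0: "\<And>b \<xi>. b \<ge> 0 \<Longrightarrow> (LINT x|lebesgue. h x * cut_wave b \<xi> x) = 0"
  shows "AE x in lebesgue. h x = 0"
proof -
  have "AE x in lebesgue. h x * cutoff (real n + 1) x = 0" for n :: nat
  proof (rule FTL_zero_imp_zero)
    show "integrable lebesgue (\<lambda>x. h x * cutoff (real n + 1) x)"
      by (rule locally_integrable_mult[OF h cutoff_continuous cutoff_outside]) auto
    show "FTL (\<lambda>x. h x * cutoff (real n + 1) x) \<xi> = 0" for \<xi>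
      using 0[of "real n + 1" \<xi>] by (simp add: FTL_def cut_wave_eq mult_ac)
  qed
  then have "AE x in lebesgue. \<forall>n::nat. h x * cutoff (real n + 1) x = 0"
    by (subst AE_all_countable) blast
  then show ?thesis
  proof eventually_elim
    case (elim x)
    have "x \<in> cube (real (nat \<lceil>norm x\<rceil>) + 1 - 1)" by (rule norm_mem_cube) simp
    from cutoff_one[OF this] show ?case using elim[rule_format, of "nat \<lceil>norm x\<rceil>"] by simp
  qed
qed

lemma has_weak_derivative_unique:
  assumes g1: "has_weak_derivative v js g1" and g2: "has_weak_derivative v js g2"
  shows "AE x in lebesgue. g1 x = g2 x"
proof -
  have l: "locally_integrable g1" "locally_integrable g2"
    using g1 g2 by (auto simp: has_weak_derivative_def)
  have "locally_integrable (\<lambda>x. g1 x - g2 x)"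
    using l unfolding locally_integrable_def by (auto intro: set_integral_diff)
  moreover have "(LINT x|lebesgue. (g1 x - g2 x) * cut_wave b \<xi> x) = 0" if b: "b \<ge> 0" for b \<xi>
  proof -
    have i: "integrable lebesgue (\<lambda>x. g1 x * cut_wave b \<xi> x)" "integrable lebesgue (\<lambda>x. g2 x * cut_wave b \<xi> x)"
      by (rule locally_integrable_mult[OF _ cut_wave_continuous cut_wave_outside]; use b l in auto)+
    have "(-1) ^ length js * (LINT x|lebesgue. g1 x * cut_wave b \<xi> x) = (-1) ^ length js * (LINT x|lebesgue. g2 x * cut_wave b \<xi> x)"
    proof -
      have "(LINT x|lebesgue. v x * partials js (cut_wave b \<xi>) x) = (-1) ^ length js * (LINT x|lebesgue. g x * cut_wave b \<xi> x)"
        if "has_weak_derivative v js g" for g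
        using that cut_wave_test_function[OF b, of \<xi>] by (simp add: has_weak_derivative_def)
      from this[OF g1] this[OF g2] show ?thesis by (rule trans[OF sym])
    qed
    then show ?thesis using i by (simp add: left_diff_distrib)
  qed
  ultimately have "AE x in lebesgue. g1 x - g2 x = 0" by (rule locally_integrable_zero)
  then show ?thesis by simp
qed

text \<open>
  A weak derivative is tested with cut-off plane waves whose plateau covers the support of \<open>v\<close>. The right-hand
  side then does not depend on the plateau, so \<open>g\<close> times the difference of two cutoffs has vanishing
  transform. Hence \<open>g\<close> coincides almost everywhere with \<open>g\<close> times a cutoff; this makes it integrable and
  identifies its transform.
\<close>
lemma weak_derivative_FTL:
  fixes v :: "real^'d \<Rightarrow> complex"
  assumes g: "has_weak_derivative v (replicate m i) g"
    and v: "integrable lebesgue v"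
    and supp: "AE x in lebesgue. x \<notin> cube s \<longrightarrow> v x = 0" and s: "s \<ge> 0"
  shows "integrable lebesgue g" "FTL g \<xi> = (- (\<i> * of_real (\<xi> $ i))) ^ m * FTL v \<xi>"
proof -
  have l: "locally_integrable g" using g by (auto simp: has_weak_derivative_def)
  have gi: "integrable lebesgue (\<lambda>x. g x * cut_wave b \<xi> x)" if "b \<ge> 0" for b \<xi>
    by (rule locally_integrable_mult[OF l cut_wave_continuous cut_wave_outside]) (use that in auto)
  have gc: "integrable lebesgue (\<lambda>x. g x * cutoff b x)" if "b \<ge> 0" for b
    by (rule locally_integrable_mult[OF l cutoff_continuous cutoff_outside]) (use that in auto)
  have [measurable]: "v \<in> borel_measurable lebesgue" "g \<in> borel_measurable lebesgue"
    using v locally_integrable_measurable[OF l] by auto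
  have key: "(LINT x|lebesgue. g x * cut_wave b \<xi> x) = (- (\<i> * of_real (\<xi> $ i))) ^ m * FTL v \<xi>" if b: "b \<ge> s + 1" for b \<xi>
  proof -
    have b0: "b \<ge> 0" using b s by simp
    let ?p = "partials (replicate m i) (cut_wave b \<xi>)"
    have "continuous_on UNIV ?p"
      using cut_wave_test_function[OF b0, of \<xi>] unfolding test_function_def
      by (intro continuous_at_imp_continuous_on ballI differentiable_imp_continuous_within) blast
    then have [measurable]: "?p \<in> borel_measurable lebesgue"
      by (intro borel_to_lebesgue borel_measurable_continuous_onI)
    have "(LINT x|lebesgue. v x * ?p x) = (-1) ^ m * (LINT x|lebesgue. g x * cut_wave b \<xi> x)"
      using g cut_wave_test_function[OF b0, of \<xi>] by (simp add: has_weak_derivative_def)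
    then have "(LINT x|lebesgue. g x * cut_wave b \<xi> x) = (-1) ^ m * (LINT x|lebesgue. v x * ?p x)"
      by (simp flip: mult.assoc power_mult_distrib)
    also have "(LINT x|lebesgue. v x * ?p x) = (LINT x|lebesgue. (\<i> * of_real (\<xi> $ i)) ^ m * (cis (\<xi> \<bullet> x) * v x))"
    proof (rule integral_cong_AE)
      show "AE x in lebesgue. v x * ?p x = (\<i> * of_real (\<xi> $ i)) ^ m * (cis (\<xi> \<bullet> x) * v x)"
        using supp
      proof eventually_elim
        case (elim x)
        show ?case
        proof (cases "x \<in> cube s")
          case True
          then have "x \<in> cube (b - 1)" by (rule cube_mono) (use b in simp)
          then show ?thesis by (simp add: cut_wave_partials)
        qed (use elim in simp)
      qed
    qed measurable
    also have "\<dots> = (\<i> * of_real (\<xi> $ i)) ^ m * FTL v \<xi>"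
      unfolding FTL_def by (rule integral_mult_right_zero)
    finally show ?thesis by (simp flip: mult.assoc power_mult_distrib)
  qed
  let ?b = "s + 1"
  have "AE x in lebesgue. g x * cutoff (?b + real n) x - g x * cutoff ?b x = 0" for n :: nat
  proof (rule FTL_zero_imp_zero)
    show "integrable lebesgue (\<lambda>x. g x * cutoff (?b + real n) x - g x * cutoff ?b x)"
      using gc s by (intro Bochner_Integration.integrable_diff) auto
    fix \<xi>
    have "FTL (\<lambda>x. g x * cutoff (?b + real n) x - g x * cutoff ?b x) \<xi> =
      (LINT x|lebesgue. g x * cut_wave (?b + real n) \<xi> x - g x * cut_wave ?b \<xi> x)"
      unfolding FTL_def by (intro Bochner_Integration.integral_cong refl) (simp add: cut_wave_eq algebra_simps)
    also have "\<dots> = 0"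
      using gi s key[of "?b + real n" \<xi>] key[of ?b \<xi>] by (subst Bochner_Integration.integral_diff) auto
    finally show "FTL (\<lambda>x. g x * cutoff (?b + real n) x - g x * cutoff ?b x) \<xi> = 0" .
  qed
  then have "AE x in lebesgue. \<forall>n::nat. g x * cutoff (?b + real n) x - g x * cutoff ?b x = 0"
    by (subst AE_all_countable) blast
  then have ae: "AE x in lebesgue. g x = g x * cutoff ?b x"
  proof eventually_elim
    case (elim x)
    have "x \<in> cube (?b + real (nat \<lceil>norm x\<rceil>) - 1)" by (rule norm_mem_cube) (use s in linarith)
    from cutoff_one[OF this] show ?case using elim[rule_format, of "nat \<lceil>norm x\<rceil>"] by simp
  qed
  have [measurable]: "cutoff ?b \<in> borel_measurable lebesgue"
    by (intro borel_to_lebesgue borel_measurable_continuous_onI cutoff_continuous)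
  have "integrable lebesgue g \<longleftrightarrow> integrable lebesgue (\<lambda>x. g x * cutoff ?b x)"
    by (rule integrable_cong_AE[OF _ _ ae]) auto
  then show "integrable lebesgue g" using gc s by simp
  have "FTL g \<xi> = (LINT x|lebesgue. g x * cut_wave ?b \<xi> x)"
    unfolding FTL_def
  proof (rule integral_cong_AE)
    show "AE x in lebesgue. cis (\<xi> \<bullet> x) * g x = g x * cut_wave ?b \<xi> x"
      using ae by eventually_elim (simp add: cut_wave_eq mult_ac)
  qed (auto simp: cut_wave_eq)
  then show "FTL g \<xi> = (- (\<i> * of_real (\<xi> $ i))) ^ m * FTL v \<xi>" using key[of ?b \<xi>] by simp
qed

text \<open>
  Off the cube some \<open>\<bar>\<xi> $ j\<bar>\<close> exceeds \<open>R\<close>, so \<open>R ^ m * norm (fourier v \<xi>)\<close> is at most the modulus of the transform of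
  the \<open>m\<close>-th derivative in direction \<open>j\<close>; Bessel's inequality is applied to each of these derivatives.
\<close>
lemma Sobolev_fourier_tail:
  fixes v :: "real^'d \<Rightarrow> complex"
  assumes S: "in_Sobolev m v" and v: "integrable lebesgue v"
    and supp: "AE x in lebesgue. x \<notin> cube s \<longrightarrow> v x = 0" and s: "s \<ge> 0" and R: "R \<ge> 0"
  shows "(2 * pi) ^ CARD('d) * (R ^ m)\<^sup>2 * (LINT \<xi>|lebesgue. indicator (- cube R) \<xi> * (norm (fourier v \<xi>))\<^sup>2) \<le> (Sobolev_seminorm m v)\<^sup>2"
proof -
  define g where "g j = weak_derivative (replicate m j) v" for j
  have v2: "square_integrable v" using S by (simp add: in_Sobolev_def)
  have g: "has_weak_derivative v (replicate m j) (g j)" "square_integrable (g j)" for j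
  proof -
    obtain h where h: "square_integrable h" "has_weak_derivative v (replicate m j) h"
      using S unfolding in_Sobolev_def by (metis length_replicate order_refl)
    \<comment> \<open>the chosen weak derivative inherits square-integrability from any other one by uniqueness\<close>
    show w: "has_weak_derivative v (replicate m j) (g j)"
      unfolding g_def weak_derivative_def by (rule someI[of "\<lambda>g. has_weak_derivative v (replicate m j) g", OF h(2)])
    have ae: "AE x in lebesgue. h x = g j x" by (rule has_weak_derivative_unique[OF h(2) w])
    have [measurable]: "g j \<in> borel_measurable lebesgue" "h \<in> borel_measurable lebesgue"
      using locally_integrable_measurable w h by (auto simp: has_weak_derivative_def square_integrable_def)
    have "integrable lebesgue (\<lambda>x. (norm (h x))\<^sup>2) \<longleftrightarrow> integrable lebesgue (\<lambda>x. (norm (g j x))\<^sup>2)"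
      by (rule integrable_cong_AE) (use ae in auto)
    then show "square_integrable (g j)" using h(1) by (simp add: square_integrable_def)
  qed
  have gi: "integrable lebesgue (g j)" for j by (rule weak_derivative_FTL[OF g(1) v supp s])
  have ng: "norm (fourier (g j) \<xi>) = \<bar>\<xi> $ j\<bar> ^ m * norm (fourier v \<xi>)" for j \<xi>
    unfolding fourier_FTL weak_derivative_FTL(2)[OF g(1) v supp s]
    by (simp add: norm_mult norm_divide norm_power)
  have fi: "integrable lebesgue (\<lambda>\<xi>. (norm (fourier (g j) \<xi>))\<^sup>2)" for j
    using fourier_L2(1)[OF gi g(2)] by (simp add: square_integrable_def)
  have fv: "integrable lebesgue (\<lambda>\<xi>. (norm (fourier v \<xi>))\<^sup>2)"
    using fourier_L2(1)[OF v v2] by (simp add: square_integrable_def)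
  have pt: "(R ^ m)\<^sup>2 * (indicator (- cube R) \<xi> * (norm (fourier v \<xi>))\<^sup>2) \<le> (\<Sum>j\<in>UNIV. (norm (fourier (g j) \<xi>))\<^sup>2)" for \<xi>
  proof (cases "\<xi> \<in> cube R")
    case False
    then obtain j where j: "\<bar>\<xi> $ j\<bar> > R" by (auto simp: mem_cube not_le)
    have "(R ^ m)\<^sup>2 * (norm (fourier v \<xi>))\<^sup>2 \<le> (\<bar>\<xi> $ j\<bar> ^ m)\<^sup>2 * (norm (fourier v \<xi>))\<^sup>2"
      using j R by (intro mult_right_mono power_mono) auto
    also have "\<dots> = (norm (fourier (g j) \<xi>))\<^sup>2" unfolding ng by (simp add: power_mult_distrib)
    also have "\<dots> \<le> (\<Sum>j\<in>UNIV. (norm (fourier (g j) \<xi>))\<^sup>2)"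
      by (rule member_le_sum) auto
    finally show ?thesis using False by simp
  qed (simp add: sum_nonneg)
  have ii: "integrable lebesgue (\<lambda>\<xi>. indicator (- cube R) \<xi> * (norm (fourier v \<xi>))\<^sup>2)"
    using integrable_mult_indicator[OF _ fv, of "- cube R"] by simp
  have "(R ^ m)\<^sup>2 * (LINT \<xi>|lebesgue. indicator (- cube R) \<xi> * (norm (fourier v \<xi>))\<^sup>2)
     = (LINT \<xi>|lebesgue. (R ^ m)\<^sup>2 * (indicator (- cube R) \<xi> * (norm (fourier v \<xi>))\<^sup>2))"
    by simp
  also have "\<dots> \<le> (LINT \<xi>|lebesgue. (\<Sum>j\<in>UNIV. (norm (fourier (g j) \<xi>))\<^sup>2))"
    by (rule integral_mono) (use ii fi pt in auto)
  also have "\<dots> = (\<Sum>j\<in>UNIV. (L2_norm (fourier (g j)))\<^sup>2)"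
    using fi by (simp add: L2_norm_power2)
  finally have "(2 * pi) ^ CARD('d) * ((R ^ m)\<^sup>2 * (LINT \<xi>|lebesgue. indicator (- cube R) \<xi> * (norm (fourier v \<xi>))\<^sup>2))
     \<le> (2 * pi) ^ CARD('d) * (\<Sum>j\<in>UNIV. (L2_norm (fourier (g j)))\<^sup>2)"
    by (intro mult_left_mono) auto
  also have "\<dots> = (\<Sum>j\<in>UNIV. (2 * pi) ^ CARD('d) * (L2_norm (fourier (g j)))\<^sup>2)"
    by (rule sum_distrib_left)
  also have "\<dots> \<le> (\<Sum>j\<in>UNIV. (L2_norm (g j))\<^sup>2)"
    by (intro sum_mono fourier_L2(2) gi g)
  also have "\<dots> = (Sobolev_seminorm m v)\<^sup>2"
    unfolding Sobolev_seminorm_def g_def by (rule real_sqrt_pow2[symmetric]) (simp add: sum_nonneg)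
  finally show ?thesis by (simp add: mult.assoc)
qed

text \<open>
  The complement of the support is a union of possibly uncountably many open sets on which \<open>f\<close> vanishes almost
  everywhere; by Lindelof's theorem countably many of them suffice.
\<close>
lemma ess_support_AE:
  fixes f :: "real^'d \<Rightarrow> complex"
  shows "AE x in lebesgue. x \<notin> ess_support f \<longrightarrow> f x = 0"
proof -
  let ?U = "{U. open U \<and> (AE x in lebesgue. x \<in> U \<longrightarrow> f x = 0)}"
  obtain D where D: "D \<subseteq> ?U" "countable D" "\<Union>D = \<Union>?U"
    using Lindelof[of ?U] by auto
  have "AE x in lebesgue. \<forall>U\<in>D. x \<in> U \<longrightarrow> f x = 0"
    using D(1,2) by (subst AE_ball_countable) auto
  then show ?thesis
    unfolding ess_support_def D(3)[symmetric] by eventually_elim auto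
qed

section \<open>Chebyshev polynomials of one variable\<close>

lemma poly_eq_on_interval:
  fixes p q :: "real poly"
  assumes "\<And>t. t \<in> {-1..1} \<Longrightarrow> poly p t = poly q t"
  shows "p = q"
proof -
  have "{-1..1} \<subseteq> {t. poly (p - q) t = 0}" using assms by auto
  moreover have "infinite {-1..1::real}" by (simp add: infinite_Icc)
  ultimately have "p - q = 0" using poly_roots_finite finite_subset by blast
  then show "p = q" by simp
qed

lemma chebyshev_0: "chebyshev 0 = 1"
  by (rule poly_eq_on_interval) (subst poly_chebyshev, auto)

lemma chebyshev_1: "chebyshev (Suc 0) = [:0, 1:]"
  by (rule poly_eq_on_interval) (subst poly_chebyshev, auto)

lemma chebyshev_rec: "chebyshev (Suc (Suc k)) = [:0, 2:] * chebyshev (Suc k) - chebyshev k"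
proof (rule poly_eq_on_interval)
  fix t :: real assume t: "t \<in> {-1..1}"
  define \<theta> where "\<theta> = arccos t"
  have c: "cos \<theta> = t" using t by (simp add: \<theta>_def)
  have "cos (real (Suc (Suc k)) * \<theta>) = 2 * (cos (real (Suc k) * \<theta>) * cos \<theta>) - cos (real k * \<theta>)"
    unfolding cos_times_cos by (simp add: algebra_simps)
  then show "poly (chebyshev (Suc (Suc k))) t = poly ([:0, 2:] * chebyshev (Suc k) - chebyshev k) t"
    using c t by (simp add: poly_chebyshev flip: \<theta>_def)
qed

lemma chebyshev_induct [case_names 0 1 step]:
  "P 0 \<Longrightarrow> P (Suc 0) \<Longrightarrow> (\<And>k. P k \<Longrightarrow> P (Suc k) \<Longrightarrow> P (Suc (Suc k))) \<Longrightarrow> P (k::nat)"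
  by (induction k rule: induct_nat_012) auto

text \<open>
  The substitution \<open>t = (z + 1 / z) / 2\<close> parametrises the arguments outside \<open>[-1, 1]\<close>, where \<open>arccos\<close> is not available.
\<close>
lemma poly_chebyshev_joukowski:
  assumes z: "z \<noteq> 0"
  shows "poly (chebyshev k) ((z + 1 / z) / 2) = (z ^ k + 1 / z ^ k) / 2"
proof (induction k rule: chebyshev_induct)
  case (step k)
  have "poly (chebyshev (Suc (Suc k))) ((z + 1 / z) / 2) = (z + 1 / z) * ((z ^ Suc k + 1 / z ^ Suc k) / 2) - (z ^ k + 1 / z ^ k) / 2"
    unfolding chebyshev_rec step[symmetric] by simp
  also have "\<dots> = (z ^ Suc (Suc k) + 1 / z ^ Suc (Suc k)) / 2"
    using z by (simp add: field_simps)
  finally show ?case .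
qed (auto simp: chebyshev_0 chebyshev_1)

lemma poly_chebyshev_minus: "poly (chebyshev k) (- t) = (-1) ^ k * poly (chebyshev k) t"
  by (induction k rule: chebyshev_induct) (auto simp: chebyshev_0 chebyshev_1 chebyshev_rec algebra_simps)

text \<open>
  Outside \<open>[-1, 1]\<close> write \<open>t = (y + 1 / y) / 2\<close> with \<open>y > 1\<close>; monotonicity of \<open>y + 1 / y\<close> gives \<open>y \<le> z\<close>.
\<close>
lemma chebyshev_growth:
  assumes z: "z \<ge> 1" and t: "\<bar>t\<bar> \<le> (z + 1 / z) / 2"
  shows "\<bar>poly (chebyshev k) t\<bar> \<le> z ^ k"
proof -
  have big: "\<bar>poly (chebyshev k) t\<bar> \<le> z ^ k" if t1: "t > 1" and t: "t \<le> (z + 1 / z) / 2" for t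
  proof -
    define y where "y = t + sqrt (t\<^sup>2 - 1)"
    have t2: "t\<^sup>2 - 1 > 0" using t1 by (simp add: power2_eq_square less_1_mult)
    have y1: "y > 1" using t1 t2 real_sqrt_gt_zero[OF t2] unfolding y_def by linarith
    have "y * (t - sqrt (t\<^sup>2 - 1)) = 1"
      using t2 by (simp add: y_def algebra_simps flip: power2_eq_square)
    then have "1 / y = t - sqrt (t\<^sup>2 - 1)" using y1 by (simp add: field_simps)
    then have ty: "t = (y + 1 / y) / 2" by (simp add: y_def)
    have yz: "y \<le> z"
    proof (rule ccontr)
      assume "\<not> y \<le> z"
      then have "(y - z) * (1 - 1 / (y * z)) > 0"
        using y1 z by (intro mult_pos_pos) (auto simp: less_1_mult field_simps intro: less_le_trans[of 1 y "y * z"])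
      moreover have "(y - z) * (1 - 1 / (y * z)) = (y + 1 / y) - (z + 1 / z)"
        using y1 z by (simp add: field_simps)
      ultimately show False using t ty by simp
    qed
    have "poly (chebyshev k) t = (y ^ k + 1 / y ^ k) / 2"
      unfolding ty by (rule poly_chebyshev_joukowski) (use y1 in auto)
    moreover have "1 / y ^ k \<ge> 0" "1 / y ^ k \<le> 1" "1 \<le> y ^ k" using y1 by (auto simp: one_le_power)
    moreover have "\<bar>T\<bar> \<le> p" if "T = (p + q) / 2" "0 \<le> q" "q \<le> 1" "1 \<le> p" for T p q :: real
      using that by (auto simp: abs_le_iff)
    ultimately have "\<bar>poly (chebyshev k) t\<bar> \<le> y ^ k" by blast
    also have "\<dots> \<le> z ^ k" using yz y1 by (intro power_mono) auto
    finally show ?thesis .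
  qed
  consider "\<bar>t\<bar> \<le> 1" | "t > 1" | "- t > 1" by linarith
  then show ?thesis
  proof cases
    case 1
    then have "\<bar>poly (chebyshev k) t\<bar> \<le> 1" by (subst poly_chebyshev) auto
    also have "\<dots> \<le> z ^ k" using z by (rule one_le_power)
    finally show ?thesis .
  next
    case 2
    then show ?thesis using big t by auto
  next
    case 3
    then have "\<bar>poly (chebyshev k) (- t)\<bar> \<le> z ^ k" using big t by auto
    then show ?thesis by (simp add: poly_chebyshev_minus abs_mult)
  qed
qed

definition cheb_cone :: "nat \<Rightarrow> (real \<Rightarrow> real) \<Rightarrow> bool" where
  "cheb_cone n f \<longleftrightarrow> (\<exists>c::nat \<Rightarrow> real. (\<forall>j. c j \<ge> 0) \<and> (\<forall>t. f t = (\<Sum>j\<le>n. c j * poly (chebyshev j) t)))"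

lemma cheb_cone_add: "cheb_cone n f \<Longrightarrow> cheb_cone n g \<Longrightarrow> cheb_cone n (\<lambda>t. f t + g t)"
  unfolding cheb_cone_def
proof (elim exE conjE)
  fix c d assume "\<forall>j. c j \<ge> (0::real)" "\<forall>t. f t = (\<Sum>j\<le>n. c j * poly (chebyshev j) t)"
    "\<forall>j. d j \<ge> (0::real)" "\<forall>t. g t = (\<Sum>j\<le>n. d j * poly (chebyshev j) t)"
  then show "\<exists>c. (\<forall>j. 0 \<le> c j) \<and> (\<forall>t. f t + g t = (\<Sum>j\<le>n. c j * poly (chebyshev j) t))"
    by (intro exI[of _ "\<lambda>j. c j + d j"]) (auto simp: distrib_right sum.distrib)
qed

lemma cheb_cone_scale: "cheb_cone n f \<Longrightarrow> a \<ge> 0 \<Longrightarrow> cheb_cone n (\<lambda>t. a * f t)"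
  unfolding cheb_cone_def
proof (elim exE conjE)
  fix c assume "a \<ge> 0" "\<forall>j. c j \<ge> (0::real)" "\<forall>t. f t = (\<Sum>j\<le>n. c j * poly (chebyshev j) t)"
  then show "\<exists>c. (\<forall>j. 0 \<le> c j) \<and> (\<forall>t. a * f t = (\<Sum>j\<le>n. c j * poly (chebyshev j) t))"
    by (intro exI[of _ "\<lambda>j. a * c j"]) (auto simp: sum_distrib_left mult.assoc)
qed

lemma cheb_cone_sum: "finite A \<Longrightarrow> (\<And>i. i \<in> A \<Longrightarrow> cheb_cone n (f i)) \<Longrightarrow> cheb_cone n (\<lambda>t. \<Sum>i\<in>A. f i t)"
proof (induction A rule: finite_induct)
  case empty
  show ?case unfolding cheb_cone_def by (intro exI[of _ "\<lambda>_. 0"]) simp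
qed (auto intro: cheb_cone_add)

lemma cheb_cone_chebyshev: "j \<le> n \<Longrightarrow> cheb_cone n (poly (chebyshev j))"
  unfolding cheb_cone_def
  by (intro exI[of _ "\<lambda>i. if i = j then 1 else 0"]) (auto simp: if_distrib[of "\<lambda>c. c * _"] cong: if_cong)

text \<open>
  Multiplication by \<open>t\<close> preserves nonnegativity of the coefficients, since \<open>t * T_j = (T_(j+1) + T_(j-1)) / 2\<close>.
\<close>
lemma cheb_cone_power: "cheb_cone n (\<lambda>t. t ^ n)"
proof (induction n)
  case 0
  have "poly (1 :: real poly) = (\<lambda>t. t ^ 0)" by (simp add: fun_eq_iff)
  then show ?case using cheb_cone_chebyshev[of 0 0] by (simp only: chebyshev_0)
next
  case (Suc n)
  then obtain c where c: "\<forall>j. c j \<ge> (0::real)" and eq: "\<forall>t. t ^ n = (\<Sum>j\<le>n. c j * poly (chebyshev j) t)"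
    unfolding cheb_cone_def by blast
  have "cheb_cone (Suc n) (\<lambda>t. \<Sum>j\<le>n. c j * (t * poly (chebyshev j) t))"
  proof (intro cheb_cone_sum cheb_cone_scale)
    fix j assume j: "j \<in> {..n}"
    show "cheb_cone (Suc n) (\<lambda>t. t * poly (chebyshev j) t)"
    proof (cases j)
      case 0
      have "poly (chebyshev (Suc 0)) = (\<lambda>t. t * poly (chebyshev 0) t)"
        by (simp add: chebyshev_0 chebyshev_1 fun_eq_iff)
      then show ?thesis using cheb_cone_chebyshev[of "Suc 0" "Suc n"] 0 by simp
    next
      case (Suc i)
      have eq: "(\<lambda>t. t * poly (chebyshev j) t) = (\<lambda>t. 1/2 * poly (chebyshev (Suc (Suc i))) t + 1/2 * poly (chebyshev i) t)"
        unfolding Suc chebyshev_rec by (auto simp: algebra_simps)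
      show ?thesis unfolding eq
        using j Suc by (intro cheb_cone_add cheb_cone_scale cheb_cone_chebyshev) auto
    qed
  qed (use c in auto)
  also have "(\<lambda>t. \<Sum>j\<le>n. c j * (t * poly (chebyshev j) t)) = (\<lambda>t. t ^ Suc n)"
    using eq by (auto simp: sum_distrib_left mult_ac)
  finally show ?case .
qed

lemma power_chebyshev_expansion:
  obtains c :: "nat \<Rightarrow> nat \<Rightarrow> real"
  where "\<And>a j. c a j \<ge> 0" "\<And>a M t. a \<le> M \<Longrightarrow> t ^ a = (\<Sum>j\<le>M. c a j * poly (chebyshev j) t)"
proof -
  have "\<exists>c. (\<forall>j. c j \<ge> (0::real)) \<and> (\<forall>M\<ge>a. \<forall>t. t ^ a = (\<Sum>j\<le>M. c j * poly (chebyshev j) t))" for a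
  proof -
    obtain c where c: "\<forall>j. c j \<ge> (0::real)" and eq: "\<forall>t. t ^ a = (\<Sum>j\<le>a. c j * poly (chebyshev j) t)"
      using cheb_cone_power[of a] unfolding cheb_cone_def by blast
    have "t ^ a = (\<Sum>j\<le>M. (if j \<le> a then c j else 0) * poly (chebyshev j) t)" if "a \<le> M" for M t
    proof -
      have "(\<Sum>j\<le>M. (if j \<le> a then c j else 0) * poly (chebyshev j) t) = (\<Sum>j\<le>a. (if j \<le> a then c j else 0) * poly (chebyshev j) t)"
        using that by (intro sum.mono_neutral_right) auto
      also have "\<dots> = (\<Sum>j\<le>a. c j * poly (chebyshev j) t)" by (rule sum.cong) auto
      finally show ?thesis using eq by simp
    qed
    then show ?thesis using c by (intro exI[of _ "\<lambda>j. if j \<le> a then c j else 0"]) auto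
  qed
  then show ?thesis using that by metis
qed

lemma cos_has_integral: "((\<lambda>\<theta>. cos (of_int n * \<theta>)) has_integral (if n = 0 then pi else 0)) {0..pi}"
proof (cases "n = 0")
  case True
  then show ?thesis using has_integral_const_real[of "1::real" 0 pi] by simp
next
  case False
  have "((\<lambda>\<theta>. cos (of_int n * \<theta>)) has_integral (sin (of_int n * pi) / of_int n - sin (of_int n * 0) / of_int n)) {0..pi}"
  proof (rule fundamental_theorem_of_calculus)
    fix x
    have "((\<lambda>\<theta>. sin (of_int n * \<theta>) / of_int n) has_real_derivative cos (of_int n * x)) (at x)"
      using False by (auto intro!: derivative_eq_intros)
    then show "((\<lambda>\<theta>. sin (of_int n * \<theta>) / of_int n) has_vector_derivative cos (of_int n * x)) (at x within {0..pi})"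
      by (simp add: has_real_derivative_iff_has_vector_derivative has_vector_derivative_at_within)
  qed simp
  moreover have "sin (of_int n * pi) = 0" using sin_npi_int[of n] by (simp add: mult.commute)
  ultimately show ?thesis using False by simp
qed

text \<open>
  The weight of the coefficient functional in one variable. It vanishes at \<open>t = r\<close> and \<open>t = -r\<close>, where the
  division is by zero.
\<close>
definition cheb_density :: "real \<Rightarrow> nat \<Rightarrow> real \<Rightarrow> real" where
  "cheb_density r k t = indicator {-r..r} t * ((2 ^ (if k > 0 then 1 else 0) * poly (chebyshev k) (t / r)) / (pi * sqrt (r\<^sup>2 - t\<^sup>2)))"

text \<open>
  The substitution \<open>t = r * cos \<theta>\<close> turns the integral into that of \<open>cos (k * \<theta>) * cos (l * \<theta>)\<close> over \<open>[0, pi]\<close>.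
\<close>
lemma cheb_density_ortho:
  assumes r: "r > 0"
  shows "integrable lborel (\<lambda>t. cheb_density r k t * poly (chebyshev l) (t / r))"
    and "(LINT t|lborel. cheb_density r k t * poly (chebyshev l) (t / r)) = (if k = l then 1 else 0)"
proof -
  let ?e = "2 ^ (if k > 0 then 1 else 0) :: real"
  let ?S = "{0<..<pi}"
  let ?g = "\<lambda>\<theta>. r * cos \<theta>"
  let ?f = "\<lambda>t. cheb_density r k t * poly (chebyshev l) (t / r)"
  let ?b = "if k = l then 1 else 0 :: real"
  have img: "?g ` ?S = {-r<..<r}"
  proof
    show "?g ` ?S \<subseteq> {-r<..<r}"
    proof
      fix t assume "t \<in> ?g ` ?S"
      then obtain \<theta> where \<theta>: "\<theta> \<in> ?S" "t = r * cos \<theta>" by auto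
      have "cos pi < cos \<theta>" "cos \<theta> < cos 0" using \<theta> cos_monotone_0_pi[of \<theta> pi] cos_monotone_0_pi[of 0 \<theta>] by auto
      then have "r * (-1) < r * cos \<theta>" "r * cos \<theta> < r * 1" using r by (simp_all only: mult_less_cancel_left_pos cos_pi cos_zero)
      then show "t \<in> {-r<..<r}" using \<theta> by simp
    qed
    show "{-r<..<r} \<subseteq> ?g ` ?S"
    proof
      fix t assume t: "t \<in> {-r<..<r}"
      then have "t / r > -1" "t / r < 1" using r by (auto simp: field_simps)
      then have "arccos (t / r) \<in> ?S" "cos (arccos (t / r)) = t / r" using arccos_lt_bounded by auto
      then show "t \<in> ?g ` ?S" using r by (intro image_eqI[of _ _ "arccos (t / r)"]) auto
    qed
  qed
  have inj: "inj_on ?g ?S"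
    using r by (auto simp: inj_on_def intro!: cos_inj_pi)
  have sub: "\<bar>- (r * sin \<theta>)\<bar> * ?f (?g \<theta>) = ?e / pi * (cos (real k * \<theta>) * cos (real l * \<theta>))" if \<theta>: "\<theta> \<in> ?S" for \<theta>
  proof -
    have s: "sin \<theta> > 0" using \<theta> by (auto intro: sin_gt_zero)
    have "r\<^sup>2 - (r * cos \<theta>)\<^sup>2 = (r * sin \<theta>)\<^sup>2"
      by (simp add: power_mult_distrib sin_squared_eq algebra_simps)
    then have "sqrt (r\<^sup>2 - (r * cos \<theta>)\<^sup>2) = r * sin \<theta>" using r s by simp
    moreover have "?g \<theta> \<in> {-r..r}" using imageI[OF \<theta>, of ?g] unfolding img by auto
    moreover have "poly (chebyshev j) (r * cos \<theta> / r) = cos (real j * \<theta>)" for j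
      using r \<theta> by (simp add: poly_chebyshev arccos_cos)
    ultimately show ?thesis using r s by (simp add: cheb_density_def abs_mult)
  qed
  have I: "((\<lambda>\<theta>. ?e / pi * (cos (real k * \<theta>) * cos (real l * \<theta>))) has_integral ?b) {0..pi}"
  proof -
    have "((\<lambda>\<theta>. ?e / pi * ((cos (of_int (int k - int l) * \<theta>) + cos (of_int (int k + int l) * \<theta>)) / 2)) has_integral
       ?e / pi * (((if int k - int l = 0 then pi else 0) + (if int k + int l = 0 then pi else 0)) / 2)) {0..pi}"
      by (intro has_integral_mult_right has_integral_divide has_integral_add cos_has_integral)
    moreover have "?e / pi * (((if int k - int l = 0 then pi else 0) + (if int k + int l = 0 then pi else 0)) / 2) = ?b"
      by auto
    ultimately show ?thesis by (simp add: cos_times_cos algebra_simps)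
  qed
  have "(\<lambda>\<theta>. ?e / pi * (cos (real k * \<theta>) * cos (real l * \<theta>))) absolutely_integrable_on {0..pi}"
    by (intro absolutely_integrable_continuous_real continuous_intros)
  then have "(\<lambda>\<theta>. ?e / pi * (cos (real k * \<theta>) * cos (real l * \<theta>))) absolutely_integrable_on ?S"
    by (rule set_integrable_subset) auto
  then have A: "(\<lambda>\<theta>. \<bar>- (r * sin \<theta>)\<bar> * ?f (?g \<theta>)) absolutely_integrable_on ?S"
    by (subst set_integrable_cong[OF refl refl sub]) auto
  have "((\<lambda>\<theta>. ?e / pi * (cos (real k * \<theta>) * cos (real l * \<theta>))) has_integral ?b) ?S"
    using I by (simp add: has_integral_Icc_iff_Ioo)
  then have "((\<lambda>\<theta>. \<bar>- (r * sin \<theta>)\<bar> * ?f (?g \<theta>)) has_integral ?b) ?S"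
    by (rule has_integral_eq[rotated]) (use sub in auto)
  then have B: "integral ?S (\<lambda>\<theta>. \<bar>- (r * sin \<theta>)\<bar> * ?f (?g \<theta>)) = ?b" by (rule integral_unique)
  have "?f absolutely_integrable_on (?g ` ?S) \<and> integral (?g ` ?S) ?f = ?b"
    by (subst has_absolute_integral_change_of_variables_1'[of ?S ?g "\<lambda>\<theta>. - (r * sin \<theta>)", symmetric])
       (use A B inj in \<open>auto intro!: derivative_eq_intros\<close>)
  then have C: "?f absolutely_integrable_on {-r<..<r}" "integral {-r<..<r} ?f = ?b"
    unfolding img by auto
  \<comment> \<open>the end points, which the substitution misses, contribute nothing\<close>
  have fz: "indicator {-r<..<r} t *\<^sub>R ?f t = ?f t" for t
    using r by (cases "t = r \<or> t = -r") (auto simp: indicator_def cheb_density_def)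
  have [measurable]: "poly p \<in> borel_measurable borel" for p :: "real poly"
    by (intro borel_measurable_continuous_onI continuous_intros)
  have m: "?f \<in> borel_measurable lborel" unfolding cheb_density_def by simp
  have "integrable lebesgue ?f" using C(1) unfolding set_integrable_def fz .
  then show "integrable lborel ?f" by (simp add: integrable_completion[OF m])
  have "(LINT t:{-r<..<r}|lebesgue. ?f t) = ?b"
    using set_lebesgue_integral_eq_integral(2)[OF C(1)] C(2) by simp
  then show "(LINT t|lborel. ?f t) = ?b"
    unfolding set_lebesgue_integral_def fz by (simp add: integral_completion[OF m])
qed

lemma cheb_density_bound:
  assumes r: "r > 0"
  shows "\<bar>cheb_density r k t\<bar> \<le> 2 ^ (if k > 0 then 1 else 0) * cheb_density r 0 t"
proof (cases "t \<in> {-r..r}")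
  case True
  then have t: "t / r \<in> {-1..1}" using r by (auto simp: field_simps)
  have "-r \<le> t" "t \<le> r" using True by auto
  then have "\<bar>t\<bar> \<le> \<bar>r\<bar>" by linarith
  then have "t\<^sup>2 \<le> r\<^sup>2" by (simp only: abs_le_square_iff)
  then have D: "pi * sqrt (r\<^sup>2 - t\<^sup>2) \<ge> 0" by simp
  have "\<bar>poly (chebyshev k) (t / r)\<bar> \<le> 1" using t by (simp add: poly_chebyshev)
  then have "\<bar>2 ^ (if k > 0 then 1 else 0) * poly (chebyshev k) (t / r)\<bar> \<le> 2 ^ (if k > 0 then 1 else 0)"
    by (auto simp: abs_mult)
  then have "\<bar>2 ^ (if k > 0 then 1 else 0) * poly (chebyshev k) (t / r)\<bar> / (pi * sqrt (r\<^sup>2 - t\<^sup>2))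
    \<le> 2 ^ (if k > 0 then 1 else 0) / (pi * sqrt (r\<^sup>2 - t\<^sup>2))" using D by (rule divide_right_mono)
  moreover have "\<bar>cheb_density r k t\<bar> = \<bar>2 ^ (if k > 0 then 1 else 0) * poly (chebyshev k) (t / r)\<bar> / (pi * sqrt (r\<^sup>2 - t\<^sup>2))"
    using True by (simp only: cheb_density_def indicator_simps mult_1 abs_divide abs_of_nonneg[OF D])
  moreover have "cheb_density r 0 t = 1 / (pi * sqrt (r\<^sup>2 - t\<^sup>2))"
    using True by (simp add: cheb_density_def chebyshev_0)
  ultimately show ?thesis by simp
qed (simp add: cheb_density_def)

lemma cheb_density_measurable[measurable]: "cheb_density r k \<in> borel_measurable borel"
proof -
  have [measurable]: "poly p \<in> borel_measurable borel" for p :: "real poly"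
    by (intro borel_measurable_continuous_onI continuous_intros)
  show ?thesis unfolding cheb_density_def[abs_def] by measurable
qed

section \<open>Chebyshev expansions of plane waves and Fourier transforms\<close>

lemma lborel_prod_cart:
  fixes f :: "'d::finite \<Rightarrow> real \<Rightarrow> 'c::{real_normed_field,banach,second_countable_topology}"
  assumes f: "\<And>j. integrable lborel (f j)"
  shows "integrable lborel (\<lambda>x::real^'d. \<Prod>j\<in>UNIV. f j (x $ j))"
    and "(LINT x|lborel. (\<Prod>j\<in>UNIV. f j ((x::real^'d) $ j))) = (\<Prod>j\<in>UNIV. LINT t|lborel. f j t)"
proof -
  let ?a = "\<lambda>i::'d. axis i (1::real)"
  have inj: "inj ?a" by (auto simp: inj_on_def axis_eq_axis)
  have B: "(Basis :: (real^'d) set) = range ?a" by (auto simp: Basis_vec_def)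
  define g where "g b = f (inv ?a b)" for b
  have g: "g (?a i) = f i" for i unfolding g_def inv_f_f[OF inj] ..
  have p: "(\<Prod>b\<in>Basis. h b) = (\<Prod>j\<in>UNIV. h (?a j))" for h :: "real^'d \<Rightarrow> 'c"
    unfolding B by (subst prod.reindex[OF inj]) simp
  note lb = lborel_prod_Basis[of g]
  have gi: "integrable lborel (g b)" for b unfolding g_def by (rule f)
  show "integrable lborel (\<lambda>x::real^'d. \<Prod>j\<in>UNIV. f j (x $ j))"
    using lb(1)[OF gi] unfolding p g by (simp add: inner_axis)
  show "(LINT x|lborel. (\<Prod>j\<in>UNIV. f j ((x::real^'d) $ j))) = (\<Prod>j\<in>UNIV. LINT t|lborel. f j t)"
    using lb(2)[OF gi] unfolding p g by (simp add: inner_axis)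
qed

text \<open>
  Conjugation converts the formula for the inverse transform into the one for the transform itself.
\<close>
lemma FT_multiplication:
  fixes u \<phi> :: "'a::euclidean_space \<Rightarrow> complex"
  assumes u: "integrable lborel u" and p: "integrable lborel \<phi>"
  shows "(LINT x|lborel. FT u x * \<phi> x) = (LINT \<xi>|lborel. u \<xi> * FT \<phi> \<xi>)"
proof -
  have "cnj (LINT x|lborel. FT u x * \<phi> x) = (LINT x|lborel. FT (\<lambda>x. cnj (u x)) (- x) * cnj (\<phi> x))"
    by (subst Bochner_Integration.integral_cnj[symmetric]) (simp add: FT_cnj)
  also have "\<dots> = (LINT \<xi>|lborel. cnj (u \<xi>) * FT (\<lambda>x. cnj (\<phi> x)) (- \<xi>))"
    by (rule multiplication_formula) (use u p in auto)
  also have "\<dots> = cnj (LINT \<xi>|lborel. u \<xi> * FT \<phi> \<xi>)"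
    by (subst Bochner_Integration.integral_cnj[symmetric]) (simp add: FT_cnj)
  finally show ?thesis by simp
qed

text \<open>
  The Chebyshev coefficient of index \<open>k\<close> is the integral against this kernel, which is supported in the cube.
\<close>
definition cheb_kernel :: "real \<Rightarrow> ('d \<Rightarrow> nat) \<Rightarrow> real^'d \<Rightarrow> real" where
  "cheb_kernel r k \<xi> = (\<Prod>j\<in>UNIV. cheb_density r (k j) (\<xi> $ j))"

definition cheb_prod :: "real \<Rightarrow> ('d \<Rightarrow> nat) \<Rightarrow> real^'d \<Rightarrow> real" where
  "cheb_prod r k \<xi> = (\<Prod>j\<in>UNIV. poly (chebyshev (k j)) (\<xi> $ j / r))"

abbreviation cheb_sum :: "real \<Rightarrow> nat \<Rightarrow> (('d::finite \<Rightarrow> nat) \<Rightarrow> complex) \<Rightarrow> real^'d \<Rightarrow> complex" where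
  "cheb_sum r n c \<xi> \<equiv> \<Sum>k | (\<Sum>j\<in>UNIV. k j) < n. c k * of_real (cheb_prod r k \<xi>)"

definition cheb_fac :: "('d::finite \<Rightarrow> nat) \<Rightarrow> real" where
  "cheb_fac k = (\<Prod>j\<in>UNIV. 2 ^ (if k j > 0 then 1 else 0))"

lemma cheb_fac_ge_1: "cheb_fac k \<ge> 1" unfolding cheb_fac_def by (rule prod_ge_1) auto

lemma cheb_kernel_indicator: "cheb_kernel r k \<xi> = indicator (cube r) \<xi> *
   (\<Prod>j\<in>UNIV. (2 ^ (if k j > 0 then 1 else 0) * poly (chebyshev (k j)) (\<xi> $ j / r)) / (pi * sqrt (r\<^sup>2 - (\<xi> $ j)\<^sup>2)))"
proof (cases "\<xi> \<in> cube r")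
  case True
  then have "\<xi> $ j \<in> {-r..r}" for j by (simp add: mem_cube abs_le_iff minus_le_iff)
  then show ?thesis using True by (simp add: cheb_kernel_def cheb_density_def)
next
  case False
  then obtain j where "\<xi> $ j \<notin> {-r..r}" by (auto simp: mem_cube abs_le_iff minus_le_iff)
  then have "cheb_density r (k j) (\<xi> $ j) = 0" unfolding cheb_density_def by simp
  then have "cheb_kernel r k \<xi> = 0" unfolding cheb_kernel_def by (intro prod_zero) auto
  then show ?thesis using False by simp
qed

lemma cheb_kernel_measurable[measurable]: "cheb_kernel r k \<in> borel_measurable (borel :: (real^'d) measure)"
proof -
  have "(\<lambda>x::real^'d. x $ j) \<in> borel_measurable borel" for j
    by (intro borel_measurable_continuous_onI continuous_intros)
  then show ?thesis unfolding cheb_kernel_def[abs_def]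
    by (intro borel_measurable_prod measurable_compose[OF _ cheb_density_measurable])
qed

lemma cheb_kernel_bound: "r > 0 \<Longrightarrow> \<bar>cheb_kernel r k \<xi>\<bar> \<le> cheb_fac k * cheb_kernel r (\<lambda>_. 0) \<xi>"
  unfolding cheb_kernel_def cheb_fac_def abs_prod prod.distrib[symmetric]
  by (intro prod_mono conjI abs_ge_zero cheb_density_bound)

lemma cheb_kernel_ortho:
  assumes r: "r > 0"
  shows "integrable lborel (\<lambda>\<xi>. cheb_kernel r k \<xi> * cheb_prod r l \<xi>)"
    and "(LINT \<xi>|lborel. cheb_kernel r k \<xi> * cheb_prod r l (\<xi>::real^'d)) = (if k = l then 1 else 0)"
proof -
  note o = cheb_density_ortho[OF r]
  note p = lborel_prod_cart[of "\<lambda>j t. cheb_density r (k j) t * poly (chebyshev (l j)) (t / r)", OF o(1)]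
  show "integrable lborel (\<lambda>\<xi>. cheb_kernel r k \<xi> * cheb_prod r l \<xi>)"
    unfolding cheb_kernel_def cheb_prod_def prod.distrib[symmetric] by (rule p(1))
  have "(LINT \<xi>|lborel. cheb_kernel r k \<xi> * cheb_prod r l (\<xi>::real^'d)) = (\<Prod>j\<in>UNIV. if k j = l j then 1 else 0)"
    unfolding cheb_kernel_def cheb_prod_def prod.distrib[symmetric] p(2) o(2) ..
  also have "\<dots> = (if k = l then 1 else 0)"
    by (auto simp: fun_eq_iff)
  finally show "(LINT \<xi>|lborel. cheb_kernel r k \<xi> * cheb_prod r l (\<xi>::real^'d)) = (if k = l then 1 else 0)" .
qed

lemma cheb_prod_0: "cheb_prod r (\<lambda>_. 0) \<xi> = 1"
  by (simp add: cheb_prod_def chebyshev_0)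

lemma cheb_kernel_0_integral:
  assumes r: "r > 0"
  shows "integrable lborel (cheb_kernel r (\<lambda>_. 0))" "(LINT \<xi>|lborel. cheb_kernel r (\<lambda>_. 0) (\<xi>::real^'d)) = 1"
  using cheb_kernel_ortho[OF r, of "\<lambda>_. 0" "\<lambda>_. 0"] by (auto simp: cheb_prod_0)

lemma cheb_kernel_integrable:
  assumes r: "r > 0"
  shows "integrable lborel (cheb_kernel r k)"
  using cheb_kernel_ortho(1)[OF r, of k "\<lambda>_. 0"] by (simp add: cheb_prod_0)

lemma cheb_coeff_eq: "cheb_coeff r w k = (LINT \<xi>|lebesgue. w \<xi> * of_real (cheb_kernel r k \<xi>))"
  unfolding cheb_coeff_def set_lebesgue_integral_def cheb_kernel_indicator
  by (intro Bochner_Integration.integral_cong refl) (simp add: indicator_def)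

text \<open>
  The kernel with index 0 is a probability density on the cube and dominates all others up to \<open>cheb_fac\<close>.
\<close>
lemma cheb_coeff_bound:
  fixes u :: "real^'d \<Rightarrow> complex"
  assumes r: "r > 0" and um: "u \<in> borel_measurable (lebesgue_on (cube r))"
    and bd: "AE \<xi> in lebesgue. \<xi> \<in> cube r \<longrightarrow> norm (u \<xi>) \<le> B"
  shows "integrable lebesgue (\<lambda>\<xi>. u \<xi> * of_real (cheb_kernel r k \<xi>))"
    and "norm (cheb_coeff r u k) \<le> B * cheb_fac k"
proof -
  let ?W = "\<lambda>\<xi>::real^'d. B * cheb_fac k * cheb_kernel r (\<lambda>_. 0) \<xi>"
  have "integrable lebesgue (cheb_kernel r (\<lambda>_. 0) :: real^'d \<Rightarrow> real)"
    by (subst integrable_completion) (auto intro: cheb_kernel_0_integral(1)[OF r])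
  then have iW: "integrable lebesgue ?W" by simp
  have "(LINT \<xi>|lebesgue. cheb_kernel r (\<lambda>_. 0) (\<xi>::real^'d)) = 1"
    by (subst integral_completion) (auto simp: cheb_kernel_0_integral(2)[OF r])
  then have W1: "(LINT \<xi>|lebesgue. ?W \<xi>) = B * cheb_fac k" by simp
  have "(\<lambda>\<xi>. indicator (cube r) \<xi> *\<^sub>R u \<xi>) \<in> borel_measurable lebesgue"
    using um by (subst (asm) borel_measurable_restrict_space_iff) auto
  moreover have "(\<lambda>\<xi>. complex_of_real (cheb_kernel r k \<xi>)) \<in> borel_measurable lebesgue"
    by (rule borel_to_lebesgue) measurable
  ultimately have "(\<lambda>\<xi>. (indicator (cube r) \<xi> *\<^sub>R u \<xi>) * of_real (cheb_kernel r k \<xi>)) \<in> borel_measurable lebesgue"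
    by (rule borel_measurable_times)
  moreover have "(indicator (cube r) \<xi> *\<^sub>R u \<xi>) * of_real (cheb_kernel r k \<xi>) = u \<xi> * of_real (cheb_kernel r k \<xi>)" for \<xi>
    by (cases "\<xi> \<in> cube r") (auto simp: cheb_kernel_indicator)
  ultimately have m: "(\<lambda>\<xi>. u \<xi> * of_real (cheb_kernel r k \<xi>)) \<in> borel_measurable lebesgue"
    by simp
  have le: "AE \<xi> in lebesgue. norm (u \<xi> * of_real (cheb_kernel r k \<xi>)) \<le> ?W \<xi>"
    using bd
  proof eventually_elim
    case (elim \<xi>)
    show ?case
    proof (cases "\<xi> \<in> cube r")
      case True
      have "norm (u \<xi>) * \<bar>cheb_kernel r k \<xi>\<bar> \<le> B * (cheb_fac k * cheb_kernel r (\<lambda>_. 0) \<xi>)"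
        using elim True by (intro mult_mono cheb_kernel_bound[OF r]) (auto intro: order_trans[OF norm_ge_zero])
      then show ?thesis by (simp add: norm_mult)
    qed (simp add: cheb_kernel_indicator)
  qed
  show i: "integrable lebesgue (\<lambda>\<xi>. u \<xi> * of_real (cheb_kernel r k \<xi>))"
    by (rule Bochner_Integration.integrable_bound[OF iW m]) (use le in \<open>eventually_elim, simp\<close>)
  have "norm (cheb_coeff r u k) \<le> (LINT \<xi>|lebesgue. norm (u \<xi> * of_real (cheb_kernel r k \<xi>)))"
    unfolding cheb_coeff_eq by (rule integral_norm_bound)
  also have "\<dots> \<le> (LINT \<xi>|lebesgue. ?W \<xi>)"
    by (rule integral_mono_AE) (use i iW le in auto)
  finally show "norm (cheb_coeff r u k) \<le> B * cheb_fac k" unfolding W1 .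
qed

text \<open>
  Replacing the plane wave in each coordinate by a Taylor polynomial makes all Chebyshev expansions finite.
\<close>
definition taylor_wave :: "real^'d \<Rightarrow> nat \<Rightarrow> real^'d \<Rightarrow> complex" where
  "taylor_wave x M \<xi> = (\<Prod>j\<in>UNIV. \<Sum>a\<le>M. (\<i> * of_real (x $ j * \<xi> $ j)) ^ a / fact a)"

lemma taylor_wave_tendsto: "(\<lambda>M. taylor_wave x M \<xi>) \<longlonglongrightarrow> cis (x \<bullet> \<xi>)"
proof -
  have "(\<lambda>M. \<Sum>a\<le>M. (\<i> * of_real t) ^ a / fact a) \<longlonglongrightarrow> cis t" for t
    using exp_converges[of "\<i> * of_real t"]
    by (simp add: sums_def_le cis_conv_exp scaleR_conv_of_real divide_inverse mult.commute)
  then have "(\<lambda>M. taylor_wave x M \<xi>) \<longlonglongrightarrow> (\<Prod>j\<in>UNIV. cis (x $ j * \<xi> $ j))"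
    unfolding taylor_wave_def by (intro tendsto_prod)
  then show ?thesis by (simp add: prod_cis inner_vec_def)
qed

lemma exp_partial_sum_le: "t \<ge> 0 \<Longrightarrow> (\<Sum>a\<le>M. t ^ a / fact a) \<le> exp (t::real)"
proof -
  assume t: "t \<ge> 0"
  have s: "(\<lambda>a. t ^ a / fact a) sums exp t"
    using exp_converges[of t] by (simp add: divide_inverse mult.commute)
  have "(\<Sum>a\<le>M. t ^ a / fact a) \<le> (\<Sum>a. t ^ a / fact a)"
    by (rule sum_le_suminf) (use s t in \<open>auto simp: sums_iff\<close>)
  then show ?thesis using s by (simp add: sums_iff)
qed

lemma taylor_wave_bound:
  assumes "\<xi> \<in> cube r"
  shows "norm (taylor_wave x M \<xi>) \<le> (\<Prod>j\<in>UNIV. exp (\<bar>x $ j\<bar> * r))"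
  unfolding taylor_wave_def prod_norm[symmetric]
proof (intro prod_mono conjI norm_ge_zero)
  fix j
  have "norm (\<Sum>a\<le>M. (\<i> * of_real (x $ j * \<xi> $ j)) ^ a / fact a) \<le> (\<Sum>a\<le>M. \<bar>x $ j * \<xi> $ j\<bar> ^ a / fact a)"
    by (rule order_trans[OF norm_sum]) (simp add: norm_divide norm_power norm_mult abs_mult)
  also have "\<dots> \<le> exp \<bar>x $ j * \<xi> $ j\<bar>" by (rule exp_partial_sum_le) simp
  also have "\<dots> \<le> exp (\<bar>x $ j\<bar> * r)" using assms by (auto simp: abs_mult mem_cube intro!: mult_left_mono)
  finally show "norm (\<Sum>a\<le>M. (\<i> * of_real (x $ j * \<xi> $ j)) ^ a / fact a) \<le> exp (\<bar>x $ j\<bar> * r)" .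
qed

lemma taylor_wave_measurable[measurable]: "taylor_wave x M \<in> borel_measurable borel"
  unfolding taylor_wave_def[abs_def] by (intro borel_measurable_continuous_onI continuous_intros) auto

lemma taylor_wave_coeff_tendsto:
  assumes r: "r > 0"
  shows "(\<lambda>M. LINT \<xi>|lborel. taylor_wave x M \<xi> * of_real (cheb_kernel r k \<xi>)) \<longlonglongrightarrow> FT (\<lambda>\<xi>. of_real (cheb_kernel r k \<xi>)) x"
  unfolding FT_def
proof (rule integral_dominated_convergence)
  let ?E = "\<Prod>j\<in>UNIV. exp (\<bar>x $ j\<bar> * r)"
  show "integrable lborel (\<lambda>\<xi>. ?E * \<bar>cheb_kernel r k \<xi>\<bar>)"
    using cheb_kernel_integrable[OF r] by (intro integrable_mult_right integrable_abs)
  show "AE \<xi> in lborel. (\<lambda>M. taylor_wave x M \<xi> * of_real (cheb_kernel r k \<xi>)) \<longlonglongrightarrow> cis (x \<bullet> \<xi>) * of_real (cheb_kernel r k \<xi>)"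
    by (intro AE_I2 tendsto_intros taylor_wave_tendsto)
  show "AE \<xi> in lborel. norm (taylor_wave x M \<xi> * of_real (cheb_kernel r k \<xi>)) \<le> ?E * \<bar>cheb_kernel r k \<xi>\<bar>" for M
  proof (rule AE_I2)
    fix \<xi>
    show "norm (taylor_wave x M \<xi> * of_real (cheb_kernel r k \<xi>)) \<le> ?E * \<bar>cheb_kernel r k \<xi>\<bar>"
    proof (cases "\<xi> \<in> cube r")
      case True
      then show ?thesis unfolding norm_mult norm_of_real
        by (intro mult_right_mono taylor_wave_bound) auto
    qed (simp add: cheb_kernel_indicator)
  qed
qed measurable

lemma degree_set_subset: "{k::'d::finite \<Rightarrow> nat. (\<Sum>j\<in>UNIV. k j) < n} \<subseteq> PiE UNIV (\<lambda>_. {..n})"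
proof
  fix k :: "'d \<Rightarrow> nat" assume k: "k \<in> {k. (\<Sum>j\<in>UNIV. k j) < n}"
  have "k j \<le> (\<Sum>j\<in>UNIV. k j)" for j by (rule member_le_sum) auto
  then show "k \<in> PiE UNIV (\<lambda>_. {..n})" using k by (auto simp: PiE_UNIV_domain intro: order_trans less_imp_le)
qed

text \<open>
  In each coordinate the Taylor polynomial has a finite Chebyshev expansion with coefficients \<open>\<beta> j l\<close>, bounded by
  \<open>B j l \<ge> 0\<close>, the coefficients of the Taylor polynomial of \<open>exp (\<bar>x $ j\<bar> * r * t)\<close>. The error consists of the
  terms of total degree at least \<open>n\<close>. Each of them is multiplied by \<open>\<rho> ^ (degree - n) \<ge> 1\<close> and the sum extended
  to all indices, where it factorises; as \<open>(\<rho> * z) ^ l \<le> 2 * T_l ((\<rho> * z + 1 / (\<rho> * z)) / 2)\<close>, every factor is a Taylor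
  polynomial of an exponential. The bound does not depend on \<open>M\<close>.
\<close>
lemma taylor_wave_truncation:
  fixes x \<xi> :: "real^'d"
  assumes r: "r > 0" and z: "z \<ge> 1" and \<rho>: "\<rho> \<ge> 1" and nM: "n \<le> M"
    and \<xi>: "\<xi> \<in> cube (r * ((z + 1 / z) / 2))"
  shows "norm (taylor_wave x M \<xi> - cheb_sum r n (\<lambda>k. (LINT \<eta>|lborel. taylor_wave x M \<eta> * of_real (cheb_kernel r k \<eta>))) \<xi>)
    \<le> 2 ^ CARD('d) / \<rho> ^ n * exp (r * (\<rho> * ((z + 1 / z) / 2)) * (\<Sum>j\<in>UNIV. \<bar>x $ j\<bar>))"
proof -
  obtain c :: "nat \<Rightarrow> nat \<Rightarrow> real" where c0: "\<And>a j. c a j \<ge> 0"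
    and c: "\<And>a M t. a \<le> M \<Longrightarrow> t ^ a = (\<Sum>j\<le>M. c a j * poly (chebyshev j) t)"
    using power_chebyshev_expansion by blast
  define \<beta> where "\<beta> j l = (\<Sum>a\<le>M. (\<i> * of_real (x $ j * r)) ^ a / fact a * of_real (c a l))" for j l
  define B where "B j l = (\<Sum>a\<le>M. (\<bar>x $ j\<bar> * r) ^ a / fact a * c a l)" for j l
  let ?P = "PiE UNIV (\<lambda>_. {..M}) :: ('d \<Rightarrow> nat) set"
  let ?D = "{k::'d \<Rightarrow> nat. (\<Sum>j\<in>UNIV. k j) < n}"
  have finP: "finite ?P" by (intro finite_PiE) auto
  have DP: "?D \<subseteq> ?P" using degree_set_subset[of n] nM by (force simp: PiE_UNIV_domain)
  have B0: "B j l \<ge> 0" for j l unfolding B_def using r c0 by (intro sum_nonneg mult_nonneg_nonneg divide_nonneg_nonneg) auto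
  have bB: "norm (\<beta> j l) \<le> B j l" for j l
    unfolding \<beta>_def B_def using r c0
    by (intro order_trans[OF norm_sum] sum_mono) (simp add: norm_mult norm_divide norm_power abs_mult)
  have expand1: "(\<Sum>a\<le>M. (\<i> * of_real (x $ j * \<eta> $ j)) ^ a / fact a) = (\<Sum>l\<le>M. \<beta> j l * of_real (poly (chebyshev l) (\<eta> $ j / r)))" for j \<eta>
  proof -
    have "(\<i> * of_real (x $ j * \<eta> $ j)) ^ a / fact a = (\<Sum>l\<le>M. (\<i> * of_real (x $ j * r)) ^ a / fact a * of_real (c a l) * of_real (poly (chebyshev l) (\<eta> $ j / r)))"
      if "a \<le> M" for a
    proof -
      have "\<i> * of_real (x $ j * \<eta> $ j) = (\<i> * of_real (x $ j * r)) * complex_of_real (\<eta> $ j / r)" using r by simp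
      then have "(\<i> * of_real (x $ j * \<eta> $ j)) ^ a / fact a = (\<i> * of_real (x $ j * r)) ^ a / fact a * of_real ((\<eta> $ j / r) ^ a)"
        by (simp only: power_mult_distrib of_real_power times_divide_eq_left)
      also have "(\<eta> $ j / r) ^ a = (\<Sum>l\<le>M. c a l * poly (chebyshev l) (\<eta> $ j / r))" by (rule c[OF that])
      finally show ?thesis by (simp only: of_real_sum of_real_mult sum_distrib_left mult.assoc)
    qed
    then have "(\<Sum>a\<le>M. (\<i> * of_real (x $ j * \<eta> $ j)) ^ a / fact a) = 
      (\<Sum>a\<le>M. \<Sum>l\<le>M. (\<i> * of_real (x $ j * r)) ^ a / fact a * of_real (c a l) * of_real (poly (chebyshev l) (\<eta> $ j / r)))"
      by (intro sum.cong refl) auto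
    also have "\<dots> = (\<Sum>l\<le>M. \<beta> j l * of_real (poly (chebyshev l) (\<eta> $ j / r)))"
      unfolding \<beta>_def sum_distrib_right by (rule sum.swap)
    finally show ?thesis .
  qed
  define b where "b k = (\<Prod>j\<in>UNIV. \<beta> j (k j))" for k
  have expand: "taylor_wave x M \<eta> = (\<Sum>l\<in>?P. b l * of_real (cheb_prod r l \<eta>))" for \<eta>
    unfolding taylor_wave_def expand1 b_def cheb_prod_def of_real_prod prod.distrib[symmetric]
    by (rule prod_sum_PiE) auto
  have coeff: "(LINT \<eta>|lborel. taylor_wave x M \<eta> * of_real (cheb_kernel r k \<eta>)) = b k" if k: "k \<in> ?P" for k
  proof -
    have i: "integrable lborel (\<lambda>\<eta>. b l * complex_of_real (cheb_kernel r k \<eta> * cheb_prod r l \<eta>))" for l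
      using cheb_kernel_ortho(1)[OF r, of k l] by (intro integrable_mult_right integrable_of_real)
    have "(LINT \<eta>|lborel. taylor_wave x M \<eta> * of_real (cheb_kernel r k \<eta>)) =
      (LINT \<eta>|lborel. (\<Sum>l\<in>?P. b l * complex_of_real (cheb_kernel r k \<eta> * cheb_prod r l \<eta>)))"
      unfolding expand sum_distrib_right
      by (intro Bochner_Integration.integral_cong sum.cong refl) (simp add: mult_ac)
    also have "\<dots> = (\<Sum>l\<in>?P. LINT \<eta>|lborel. b l * complex_of_real (cheb_kernel r k \<eta> * cheb_prod r l \<eta>))"
      by (rule Bochner_Integration.integral_sum) (rule i)
    also have "\<dots> = (\<Sum>l\<in>?P. b l * of_real (if k = l then 1 else 0))"
      unfolding integral_mult_right_zero integral_complex_of_real cheb_kernel_ortho(2)[OF r] ..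
    also have "\<dots> = b k" using k finP by (simp add: if_distrib[of "\<lambda>t. _ * complex_of_real t"] cong: if_cong)
    finally show ?thesis .
  qed
  let ?L = "(\<rho> * z + 1 / (\<rho> * z)) / 2"
  let ?Q = "\<rho> * ((z + 1 / z) / 2)"
  have LQ: "?L \<le> ?Q"
  proof -
    have "1 / (\<rho> * z) \<le> 1 / z" using \<rho> z by (intro divide_left_mono) auto
    also have "\<dots> \<le> \<rho> / z" using \<rho> z by (intro divide_right_mono) auto
    finally have "1 / (\<rho> * z) \<le> \<rho> / z" .
    then have "?L \<le> (\<rho> * z + \<rho> / z) / 2" by (intro divide_right_mono add_left_mono) auto
    also have "\<dots> = ?Q" by (simp add: distrib_left)
    finally show ?thesis .
  qed
  have factor: "(\<Sum>l\<le>M. B j l * (\<rho> * z) ^ l) \<le> 2 * exp (\<bar>x $ j\<bar> * r * ?Q)" for j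
  proof -
    have T: "(\<rho> * z) ^ l \<le> 2 * poly (chebyshev l) ?L" for l
      using \<rho> z by (subst poly_chebyshev_joukowski) auto
    have L0: "?L \<ge> 0" using \<rho> z by simp
    have "(\<Sum>l\<le>M. B j l * (\<rho> * z) ^ l) \<le> (\<Sum>l\<le>M. B j l * (2 * poly (chebyshev l) ?L))"
      by (intro sum_mono mult_left_mono T B0)
    also have "\<dots> = 2 * (\<Sum>a\<le>M. (\<bar>x $ j\<bar> * r) ^ a / fact a * (\<Sum>l\<le>M. c a l * poly (chebyshev l) ?L))"
      unfolding B_def sum_distrib_right sum_distrib_left
      by (subst sum.swap) (simp add: mult_ac)
    also have "\<dots> = 2 * (\<Sum>a\<le>M. (\<bar>x $ j\<bar> * r) ^ a / fact a * ?L ^ a)"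
      by (intro arg_cong2[where f="(*)"] sum.cong refl) (simp only: c[symmetric] atMost_iff)
    also have "\<dots> = 2 * (\<Sum>a\<le>M. (\<bar>x $ j\<bar> * r * ?L) ^ a / fact a)"
      by (simp only: power_mult_distrib[of "\<bar>x $ j\<bar> * r" ?L] times_divide_eq_left)
    also have "\<dots> \<le> 2 * exp (\<bar>x $ j\<bar> * r * ?L)"
      using r L0 by (intro mult_left_mono exp_partial_sum_le mult_nonneg_nonneg) auto
    also have "\<dots> \<le> 2 * exp (\<bar>x $ j\<bar> * r * ?Q)"
    proof -
      have "\<bar>x $ j\<bar> * r * ?L \<le> \<bar>x $ j\<bar> * r * ?Q"
        using r by (intro mult_left_mono[OF LQ]) auto
      then show ?thesis by (simp only: exp_le_cancel_iff mult_le_cancel_left_pos zero_less_numeral)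
    qed
    finally show ?thesis .
  qed
  have Tb: "norm (b l * of_real (cheb_prod r l \<xi>)) \<le> (\<Prod>j\<in>UNIV. B j (l j) * z ^ l j)" for l
    unfolding b_def cheb_prod_def of_real_prod prod.distrib[symmetric] prod_norm[symmetric]
  proof (intro prod_mono conjI norm_ge_zero)
    fix j
    have "\<bar>\<xi> $ j / r\<bar> \<le> (z + 1 / z) / 2"
      using \<xi> r by (simp add: mem_cube abs_divide pos_divide_le_eq mult.commute)
    then have "\<bar>poly (chebyshev (l j)) (\<xi> $ j / r)\<bar> \<le> z ^ l j" by (rule chebyshev_growth[OF z])
    then show "norm (\<beta> j (l j) * complex_of_real (poly (chebyshev (l j)) (\<xi> $ j / r))) \<le> B j (l j) * z ^ l j"
      unfolding norm_mult norm_of_real by (intro mult_mono bB B0) auto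
  qed
  have "taylor_wave x M \<xi> - cheb_sum r n (\<lambda>k. (LINT \<eta>|lborel. taylor_wave x M \<eta> * of_real (cheb_kernel r k \<eta>))) \<xi>
     = (\<Sum>l\<in>?P. b l * of_real (cheb_prod r l \<xi>)) - (\<Sum>l\<in>?D. b l * of_real (cheb_prod r l \<xi>))"
    unfolding expand[of \<xi>] using DP coeff by (intro arg_cong2[where f="(-)"] sum.cong refl) auto
  also have "\<dots> = (\<Sum>l\<in>?P - ?D. b l * of_real (cheb_prod r l \<xi>))"
    by (rule sum_diff[OF finP DP, symmetric])
  also have "norm \<dots> \<le> (\<Sum>l\<in>?P - ?D. \<Prod>j\<in>UNIV. B j (l j) * z ^ l j)"
    by (rule order_trans[OF norm_sum]) (intro sum_mono Tb)
  also have "\<dots> \<le> (\<Sum>l\<in>?P - ?D. (\<Prod>j\<in>UNIV. B j (l j) * (\<rho> * z) ^ l j) / \<rho> ^ n)"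
  proof (rule sum_mono)
    fix l assume "l \<in> ?P - ?D"
    then have l: "n \<le> (\<Sum>j\<in>UNIV. l j)" by auto
    have "(\<Prod>j\<in>UNIV. B j (l j) * z ^ l j) * \<rho> ^ n \<le> (\<Prod>j\<in>UNIV. B j (l j) * z ^ l j) * \<rho> ^ (\<Sum>j\<in>UNIV. l j)"
      using \<rho> z l B0 by (intro mult_left_mono power_increasing prod_nonneg) auto
    also have "\<dots> = (\<Prod>j\<in>UNIV. B j (l j) * (\<rho> * z) ^ l j)"
      by (simp add: power_sum power_mult_distrib mult_ac flip: prod.distrib)
    finally show "(\<Prod>j\<in>UNIV. B j (l j) * z ^ l j) \<le> (\<Prod>j\<in>UNIV. B j (l j) * (\<rho> * z) ^ l j) / \<rho> ^ n"
      using \<rho> by (simp add: pos_le_divide_eq)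
  qed
  also have "\<dots> \<le> (\<Sum>l\<in>?P. (\<Prod>j\<in>UNIV. B j (l j) * (\<rho> * z) ^ l j) / \<rho> ^ n)"
    using \<rho> z B0 finP by (intro sum_mono2) (auto intro!: divide_nonneg_nonneg prod_nonneg)
  also have "\<dots> = (\<Prod>j\<in>UNIV. \<Sum>l\<le>M. B j l * (\<rho> * z) ^ l) / \<rho> ^ n"
    unfolding sum_divide_distrib[symmetric] by (subst prod_sum_PiE) auto
  also have "\<dots> \<le> (\<Prod>j\<in>(UNIV::'d set). 2 * exp (\<bar>x $ j\<bar> * r * ?Q)) / \<rho> ^ n"
    using \<rho> z B0 by (intro divide_right_mono prod_mono conjI factor sum_nonneg) auto
  also have "\<dots> = 2 ^ CARD('d) / \<rho> ^ n * exp (r * ?Q * (\<Sum>j\<in>UNIV. \<bar>x $ j\<bar>))"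
    by (simp add: prod.distrib sum_distrib_left sum_distrib_right mult_ac flip: exp_sum)
  finally show ?thesis .
qed


text \<open>
  The limit \<open>M \<rightarrow> \<infinity>\<close> of the previous lemma.
\<close>
lemma wave_truncation:
  fixes x \<xi> :: "real^'d"
  assumes r: "r > 0" and z: "z \<ge> 1" and \<rho>: "\<rho> \<ge> 1"
    and \<xi>: "\<xi> \<in> cube (r * ((z + 1 / z) / 2))"
  shows "norm (cis (x \<bullet> \<xi>) - cheb_sum r n (\<lambda>k. FT (\<lambda>\<eta>. of_real (cheb_kernel r k \<eta>)) x) \<xi>)
    \<le> 2 ^ CARD('d) / \<rho> ^ n * exp (r * (\<rho> * ((z + 1 / z) / 2)) * (\<Sum>j\<in>UNIV. \<bar>x $ j\<bar>))"
proof (rule LIMSEQ_le_const2)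
  show "(\<lambda>M. norm (taylor_wave x M \<xi> - cheb_sum r n (\<lambda>k. (LINT \<eta>|lborel. taylor_wave x M \<eta> * of_real (cheb_kernel r k \<eta>))) \<xi>))
    \<longlonglongrightarrow> norm (cis (x \<bullet> \<xi>) - cheb_sum r n (\<lambda>k. FT (\<lambda>\<eta>. of_real (cheb_kernel r k \<eta>)) x) \<xi>)"
    by (intro tendsto_norm tendsto_diff taylor_wave_tendsto tendsto_sum tendsto_mult taylor_wave_coeff_tendsto[OF r] tendsto_const)
  show "\<exists>N. \<forall>M\<ge>N. norm (taylor_wave x M \<xi> - cheb_sum r n (\<lambda>k. (LINT \<eta>|lborel. taylor_wave x M \<eta> * of_real (cheb_kernel r k \<eta>))) \<xi>)
    \<le> 2 ^ CARD('d) / \<rho> ^ n * exp (r * (\<rho> * ((z + 1 / z) / 2)) * (\<Sum>j\<in>UNIV. \<bar>x $ j\<bar>))"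
    using taylor_wave_truncation[OF r z \<rho> _ \<xi>] by (intro exI[of _ n] allI impI)
qed

text \<open>
  The transform is a superposition of plane waves with weight \<open>v\<close>, and its Chebyshev coefficients are the same
  superposition of theirs by \<open>FT_multiplication\<close>.
\<close>
lemma fourier_truncation:
  fixes v :: "real^'d \<Rightarrow> complex"
  assumes r: "r > 0" and z: "z \<ge> 1" and \<rho>: "\<rho> \<ge> 1"
    and \<xi>: "\<xi> \<in> cube (r * ((z + 1 / z) / 2))"
    and v: "integrable lebesgue v"
    and supp: "AE x in lebesgue. (\<Sum>j\<in>UNIV. \<bar>x $ j\<bar>) \<le> \<sigma> \<or> v x = 0"
  shows "norm (fourier v \<xi> - cheb_sum r n (cheb_coeff r (fourier v)) \<xi>)
    \<le> (LINT x|lebesgue. norm (v x)) / (2 * pi) ^ CARD('d) * (2 ^ CARD('d) / \<rho> ^ n * exp (r * (\<rho> * ((z + 1 / z) / 2)) * \<sigma>))"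
proof -
  let ?d = "(2 * pi) ^ CARD('d)"
  let ?D = "{k::'d \<Rightarrow> nat. (\<Sum>j\<in>UNIV. k j) < n}"
  define K where "K k x = FT (\<lambda>\<eta>::real^'d. complex_of_real (cheb_kernel r k \<eta>)) x" for k x
  define C where "C = 2 ^ CARD('d) / \<rho> ^ n * exp (r * (\<rho> * ((z + 1 / z) / 2)) * \<sigma>)"
  have vm: "v \<in> borel_measurable lebesgue" using v by auto
  then obtain v' where v': "v' \<in> borel_measurable borel" "AE x in lebesgue. v x = v' x"
    by (rule borel_version)
  have [measurable]: "v' \<in> borel_measurable borel" by fact
  have vi: "integrable lborel v'" using v borel_version_integral(1)[OF vm v'] by simp
  have nv: "(LINT x|lebesgue. norm (v x)) = (LINT x|lborel. norm (v' x))"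
    by (rule borel_version_integral(2)) (use vm v'(2) in auto)
  have supp': "AE x in lborel. (\<Sum>j\<in>UNIV. \<bar>x $ j\<bar>) \<le> \<sigma> \<or> v' x = 0"
  proof -
    have "AE x in lebesgue. (\<Sum>j\<in>UNIV. \<bar>x $ j\<bar>) \<le> \<sigma> \<or> v' x = 0"
      using supp v'(2) by eventually_elim auto
    then show ?thesis by (simp only: AE_completion_iff)
  qed
  have F: "fourier v \<eta> = FT v' \<eta> / of_real ?d" for \<eta>
    unfolding fourier_FTL FTL_eq_FT[OF vm v'] ..
  have mi: "integrable lborel (\<lambda>\<eta>. complex_of_real (cheb_kernel r k \<eta>))" for k :: "'d \<Rightarrow> nat"
    by (intro integrable_of_real cheb_kernel_integrable[OF r])
  have coeff: "cheb_coeff r (fourier v) k = (LINT x|lborel. v' x * K k x) / of_real ?d" for k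
  proof -
    have "cheb_coeff r (fourier v) k = (LINT \<eta>|lborel. FT v' \<eta> / of_real ?d * of_real (cheb_kernel r k \<eta>))"
      unfolding cheb_coeff_eq F by (rule integral_completion) measurable
    also have "\<dots> = (LINT \<eta>|lborel. FT v' \<eta> * of_real (cheb_kernel r k \<eta>)) / of_real ?d"
      by (subst integral_divide_zero[symmetric]) (simp only: times_divide_eq_left)
    also have "(LINT \<eta>|lborel. FT v' \<eta> * of_real (cheb_kernel r k \<eta>)) = (LINT x|lborel. v' x * K k x)"
      unfolding K_def by (rule FT_multiplication[OF vi mi])
    finally show ?thesis .
  qed
  have Km [measurable]: "K k \<in> borel_measurable borel" for k
    unfolding K_def[abs_def] by measurable
  have Ki: "integrable lborel (\<lambda>x. v' x * K k x)" for k
  proof (rule integrable_dominated[OF integrable_mult_left[OF integrable_norm[OF vi]]])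
    show "norm (v' x * K k x) \<le> norm (v' x) * (LINT \<eta>|lborel. norm (complex_of_real (cheb_kernel r k (\<eta>::real^'d))))" for x
      unfolding K_def norm_mult by (intro mult_left_mono norm_FT_le) auto
  qed simp
  have cv: "integrable lborel (\<lambda>x. v' x * cis (x \<bullet> \<xi>))"
    using integrable_cis_mult[OF vi, of \<xi>] by (simp add: mult.commute inner_commute)
  let ?S = "\<lambda>x. \<Sum>k\<in>?D. K k x * of_real (cheb_prod r k \<xi>)"
  have Si: "integrable lborel (\<lambda>x. v' x * ?S x)"
    unfolding sum_distrib_left mult.assoc[symmetric]
    by (intro Bochner_Integration.integrable_sum integrable_mult_left Ki)
  have "fourier v \<xi> - cheb_sum r n (cheb_coeff r (fourier v)) \<xi>
    = ((LINT x|lborel. v' x * cis (x \<bullet> \<xi>)) - cheb_sum r n (\<lambda>k. (LINT x|lborel. v' x * K k x)) \<xi>) / of_real ?d"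
    unfolding F coeff FT_def diff_divide_distrib sum_divide_distrib
    by (simp add: mult.commute inner_commute)
  also have "cheb_sum r n (\<lambda>k. (LINT x|lborel. v' x * K k x)) \<xi> = (LINT x|lborel. v' x * ?S x)"
    unfolding sum_distrib_left mult.assoc[symmetric]
    by (subst Bochner_Integration.integral_sum) (auto intro!: integrable_mult_left Ki)
  also have "(LINT x|lborel. v' x * cis (x \<bullet> \<xi>)) - (LINT x|lborel. v' x * ?S x) = (LINT x|lborel. v' x * (cis (x \<bullet> \<xi>) - ?S x))"
    unfolding right_diff_distrib by (rule Bochner_Integration.integral_diff[symmetric, OF cv Si])
  finally have eq: "fourier v \<xi> - cheb_sum r n (cheb_coeff r (fourier v)) \<xi>
    = (LINT x|lborel. v' x * (cis (x \<bullet> \<xi>) - ?S x)) / of_real ?d" .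
  have i: "integrable lborel (\<lambda>x. v' x * (cis (x \<bullet> \<xi>) - ?S x))"
    unfolding right_diff_distrib by (rule Bochner_Integration.integrable_diff[OF cv Si])
  have "norm (LINT x|lborel. v' x * (cis (x \<bullet> \<xi>) - ?S x)) \<le> (LINT x|lborel. norm (v' x * (cis (x \<bullet> \<xi>) - ?S x)))"
    by (rule integral_norm_bound)
  also have "\<dots> \<le> (LINT x|lborel. norm (v' x) * C)"
  proof (rule integral_mono_AE)
    show "integrable lborel (\<lambda>x. norm (v' x) * C)"
      by (rule integrable_mult_left) (rule integrable_norm[OF vi])
    show "AE x in lborel. norm (v' x * (cis (x \<bullet> \<xi>) - ?S x)) \<le> norm (v' x) * C"
      using supp'
    proof eventually_elim
      case (elim x)
      then show ?case
      proof
        assume s: "(\<Sum>j\<in>UNIV. \<bar>x $ j\<bar>) \<le> \<sigma>"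
        have "norm (cis (x \<bullet> \<xi>) - ?S x) \<le> 2 ^ CARD('d) / \<rho> ^ n * exp (r * (\<rho> * ((z + 1 / z) / 2)) * (\<Sum>j\<in>UNIV. \<bar>x $ j\<bar>))"
          unfolding K_def by (rule wave_truncation[OF r z \<rho> \<xi>])
        also have "\<dots> \<le> C"
          unfolding C_def using r z \<rho> s by (intro mult_left_mono) (auto intro!: mult_left_mono)
        finally show ?thesis unfolding norm_mult by (intro mult_left_mono) auto
      qed simp
    qed
  qed (rule integrable_norm[OF i])
  also have "\<dots> = (LINT x|lborel. norm (v' x)) * C" by simp
  finally have "norm (LINT x|lborel. v' x * (cis (x \<bullet> \<xi>) - ?S x)) / ?d \<le> (LINT x|lborel. norm (v' x)) * C / ?d"
    by (rule divide_right_mono) simp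
  then show ?thesis unfolding eq norm_divide norm_of_real nv C_def by (simp add: mult_ac)
qed

text \<open>
  Since the degree is below \<open>n\<close>, each \<open>z ^ degree\<close> is at most \<open>(2 * z) ^ (n - 1) / 2 ^ degree\<close>; the sum over all
  indices of \<open>cheb_fac k / 2 ^ degree\<close> factorises into geometric sums of value below \<open>1 + 2 * (1/2 + 1/4 + ...) = 3\<close>.
\<close>
lemma noise_bound:
  fixes c :: "('d::finite \<Rightarrow> nat) \<Rightarrow> complex"
  assumes r: "r > 0" and z: "z \<ge> 1" and n: "n \<ge> 1" and \<delta>: "\<delta> \<ge> 0"
    and \<xi>: "\<xi> \<in> cube (r * ((z + 1 / z) / 2))"
    and c: "\<And>k. norm (c k) \<le> \<delta> * cheb_fac k"
  shows "norm (cheb_sum r n c \<xi>) \<le> \<delta> * 3 ^ CARD('d) * (2 * z) ^ (n - 1)"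
proof -
  let ?D = "{k::'d \<Rightarrow> nat. (\<Sum>j\<in>UNIV. k j) < n}"
  let ?P = "PiE UNIV (\<lambda>_. {..n}) :: ('d \<Rightarrow> nat) set"
  define e :: "nat \<Rightarrow> real" where "e l = 2 ^ (if l > 0 then 1 else 0)" for l
  have e0: "e l \<ge> 0" for l by (simp add: e_def)
  have finP: "finite ?P" by (intro finite_PiE) auto
  have summand: "norm (c k * of_real (cheb_prod r k \<xi>)) \<le> \<delta> * (2 * z) ^ (n - 1) * (\<Prod>j\<in>UNIV. e (k j) / 2 ^ k j)"
    if k: "k \<in> ?D" for k
  proof -
    have "\<bar>cheb_prod r k \<xi>\<bar> \<le> (\<Prod>j\<in>UNIV. z ^ k j)"
      unfolding cheb_prod_def abs_prod
    proof (intro prod_mono conjI abs_ge_zero)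
      fix j
      have "\<bar>\<xi> $ j / r\<bar> \<le> (z + 1 / z) / 2"
        using \<xi> r by (simp add: mem_cube abs_divide pos_divide_le_eq mult.commute)
      then show "\<bar>poly (chebyshev (k j)) (\<xi> $ j / r)\<bar> \<le> z ^ k j" by (rule chebyshev_growth[OF z])
    qed
    then have "norm (c k * of_real (cheb_prod r k \<xi>)) \<le> (\<delta> * cheb_fac k) * (\<Prod>j\<in>UNIV. z ^ k j)"
      unfolding norm_mult norm_of_real using \<delta> cheb_fac_ge_1[of k] by (intro mult_mono c) auto
    also have "(\<Prod>j\<in>UNIV. z ^ k j) = (2 * z) ^ (\<Sum>j\<in>UNIV. k j) * (\<Prod>j\<in>UNIV. 1 / 2 ^ k j)"
      unfolding power_sum prod.distrib[symmetric] by (simp add: power_mult_distrib)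
    also have "(\<delta> * cheb_fac k) * ((2 * z) ^ (\<Sum>j\<in>UNIV. k j) * (\<Prod>j\<in>UNIV. 1 / 2 ^ k j))
      \<le> (\<delta> * cheb_fac k) * ((2 * z) ^ (n - 1) * (\<Prod>j\<in>UNIV. 1 / 2 ^ k j))"
      using \<delta> cheb_fac_ge_1[of k] z k by (intro mult_left_mono mult_right_mono power_increasing prod_nonneg mult_nonneg_nonneg) auto
    also have "\<dots> = \<delta> * (2 * z) ^ (n - 1) * (\<Prod>j\<in>UNIV. e (k j) / 2 ^ k j)"
      unfolding cheb_fac_def e_def by (simp add: mult_ac flip: prod.distrib prod_dividef)
    finally show ?thesis .
  qed
  have geo: "(\<Sum>l\<le>n. e l / 2 ^ l) \<le> 3" for n
  proof -
    have "(\<Sum>l\<le>n. e l / 2 ^ l) = 3 - 2 / 2 ^ n"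
      by (induction n) (auto simp: e_def field_simps)
    then show ?thesis by simp
  qed
  have "norm (cheb_sum r n c \<xi>) \<le> (\<Sum>k\<in>?D. \<delta> * (2 * z) ^ (n - 1) * (\<Prod>j\<in>UNIV. e (k j) / 2 ^ k j))"
    by (rule order_trans[OF norm_sum]) (rule sum_mono[OF summand])
  also have "\<dots> \<le> (\<Sum>k\<in>?P. \<delta> * (2 * z) ^ (n - 1) * (\<Prod>j\<in>UNIV. e (k j) / 2 ^ k j))"
    using degree_set_subset finP \<delta> z e0 by (intro sum_mono2) (auto intro!: mult_nonneg_nonneg prod_nonneg divide_nonneg_nonneg)
  also have "\<dots> = \<delta> * (2 * z) ^ (n - 1) * (\<Prod>j\<in>(UNIV::'d set). \<Sum>l\<le>n. e l / 2 ^ l)"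
    unfolding sum_distrib_left[symmetric] by (subst prod_sum_PiE) auto
  also have "\<dots> \<le> \<delta> * (2 * z) ^ (n - 1) * (\<Prod>j\<in>(UNIV::'d set). 3)"
    using \<delta> z e0 by (intro mult_left_mono prod_mono conjI geo sum_nonneg divide_nonneg_nonneg) auto
  finally show ?thesis by (simp add: mult_ac)
qed

section \<open>Error of the extrapolation\<close>

text \<open>
  Put \<open>\<Lambda> = ln (N / \<delta>)\<close> and \<open>q = (4 * L) powr (1 / \<tau>)\<close>. As \<open>L > 1\<close>, the maximum in the definition of \<open>L\<close> is attained by
  its second argument, so \<open>0 < \<tau> < 1\<close> and \<open>r * \<sigma> * q = (1 - \<tau>) * \<Lambda>\<close>, and \<open>n\<close> is \<open>(2 - \<tau>) * \<Lambda> / ln (3 * q)\<close> rounded up.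
  For the noise, \<open>ln (2 * z) \<le> ln (4 * L) = \<tau> * ln q\<close>, which gives the exponent \<open>\<tau> * (2 - \<tau>) - 1 = - (1 - \<tau>)\<^sup>2\<close> of
  \<open>exp \<Lambda>\<close>. For the truncation, \<open>\<rho> = q / L\<close> makes \<open>r * \<rho> * L * \<sigma> = (1 - \<tau>) * \<Lambda>\<close> and \<open>ln \<rho> \<ge> (1 - \<tau>) * ln (3 * q)\<close>,
  which gives \<open>(1 - \<tau>) - (2 - \<tau>) * (1 - \<tau>) = - (1 - \<tau>)\<^sup>2\<close> again.
\<close>
lemma extrapolation_parameters:
  fixes N \<delta> r \<sigma> \<tau> :: real
  defines "L \<equiv> L_tau N r \<sigma> \<tau> \<delta>" and "n \<equiv> n_tau N r \<sigma> \<tau> \<delta>"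
  assumes pos: "0 < \<delta>" "\<delta> < N" "0 < r" "0 < \<sigma>" and \<tau>: "0 \<le> \<tau>" "\<tau> \<le> 1" and L1: "L > 1"
  obtains z \<rho> where "z \<ge> 1" "\<rho> \<ge> 1" "(z + 1 / z) / 2 = L" "n \<ge> 1"
    "\<delta> * (2 * z) ^ (n - 1) \<le> N * (\<delta> / N) powr ((1 - \<tau>)\<^sup>2)"
    "exp (r * (\<rho> * L) * \<sigma>) / \<rho> ^ n \<le> (\<delta> / N) powr ((1 - \<tau>)\<^sup>2)"
proof -
  define \<Lambda> where "\<Lambda> = ln (N / \<delta>)"
  have \<Lambda>: "\<Lambda> > 0" using pos by (simp add: \<Lambda>_def)
  have \<tau>0: "\<tau> > 0"
  proof (rule ccontr)
    assume "\<not> \<tau> > 0"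
    then have "\<tau> = 0" using \<tau> by simp
    then show False using L1 by (simp add: L_def L_tau_0)
  qed
  have \<tau>1: "\<tau> < 1"
  proof (rule ccontr)
    assume "\<not> \<tau> < 1"
    then have "\<tau> = 1" using \<tau> by simp
    then show False using L1 by (simp add: L_def L_tau_def)
  qed
  \<comment> \<open>the identity \<open>4 * L = q powr \<tau>\<close> below shows that this is \<open>(4 * L) powr (1 / \<tau>)\<close>\<close>
  define q where "q = (1 - \<tau>) * \<Lambda> / (r * \<sigma>)"
  have q: "q > 0" using \<tau>1 \<Lambda> pos by (simp add: q_def)
  have L4: "4 * L = q powr \<tau>"
    using L1 unfolding L_def L_tau_def q_def \<Lambda>_def by (simp add: max_def split: if_splits)
  have lnL: "ln (4 * L) = \<tau> * ln q" unfolding L4 using q by (simp add: ln_powr)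
  have lnL0: "ln (4 * L) > 0" using L1 by simp
  then have lnq: "ln q > 0" using lnL \<tau>0 by (simp add: zero_less_mult_iff)
  have rsq: "r * \<sigma> * q = (1 - \<tau>) * \<Lambda>" using pos by (simp add: q_def)
  define D where "D = ln 3 + ln q"
  have D: "D > 0" unfolding D_def using lnq by (simp add: add_pos_pos)
  have "1 / \<tau> * ln (4 * L) = ln q" using lnL \<tau>0 by simp
  then have nd: "n = nat \<lceil>(2 - \<tau>) * \<Lambda> / D\<rceil>"
    unfolding n_def n_tau_def L_def[symmetric] \<Lambda>_def[symmetric] D_def using \<tau>0 by simp
  have quo: "(2 - \<tau>) * \<Lambda> / D > 0" using \<tau>1 \<Lambda> D by simp
  have n_lo: "(2 - \<tau>) * \<Lambda> / D \<le> real n" unfolding nd using quo by linarith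
  have n_hi: "real n - 1 \<le> (2 - \<tau>) * \<Lambda> / D" unfolding nd using quo by linarith
  have n1: "n \<ge> 1" using n_lo quo by (cases n) auto
  have \<epsilon>: "(\<delta> / N) powr ((1 - \<tau>)\<^sup>2) = exp (- ((1 - \<tau>)\<^sup>2 * \<Lambda>))"
    using pos by (simp add: powr_def \<Lambda>_def ln_div algebra_simps)
  have \<delta>eq: "\<delta> = N * exp (- \<Lambda>)" using pos by (simp add: \<Lambda>_def exp_minus)
  define z where "z = L + sqrt (L\<^sup>2 - 1)"
  have L2: "L\<^sup>2 - 1 > 0" using L1 by (simp add: power2_eq_square less_1_mult)
  have z1: "z \<ge> 1" using real_sqrt_gt_zero[OF L2] L1 unfolding z_def by linarith
  have "z * (L - sqrt (L\<^sup>2 - 1)) = 1"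
    using L2 by (simp add: z_def algebra_simps flip: power2_eq_square)
  then have "1 / z = L - sqrt (L\<^sup>2 - 1)" using z1 by (simp add: field_simps)
  then have zL: "(z + 1 / z) / 2 = L" by (simp add: z_def)
  have "sqrt (L\<^sup>2 - 1) \<le> L" using L1 by (intro real_le_lsqrt) auto
  then have z2: "2 * z \<le> 4 * L" by (simp add: z_def)
  have noise: "\<delta> * (2 * z) ^ (n - 1) \<le> N * (\<delta> / N) powr ((1 - \<tau>)\<^sup>2)"
  proof -
    have "(2 * z) ^ (n - 1) \<le> (4 * L) ^ (n - 1)" using z1 z2 by (intro power_mono) auto
    also have "\<dots> = exp ((real n - 1) * (\<tau> * ln q))"
    proof -
      have "exp (real (n - 1) * ln (4 * L)) = exp (ln (4 * L)) ^ (n - 1)" by (rule exp_of_nat_mult)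
      then show ?thesis using L1 n1 unfolding lnL[symmetric] by (simp add: of_nat_diff)
    qed
    also have "\<dots> \<le> exp (\<tau> * (2 - \<tau>) * \<Lambda>)"
    proof -
      have "(real n - 1) * (\<tau> * ln q) \<le> (2 - \<tau>) * \<Lambda> / D * (\<tau> * D)"
        using n_hi n1 \<tau>0 lnq quo D by (intro mult_mono) (auto simp: D_def)
      also have "\<dots> = \<tau> * (2 - \<tau>) * \<Lambda>" using D by simp
      finally show ?thesis by simp
    qed
    finally have "\<delta> * (2 * z) ^ (n - 1) \<le> \<delta> * exp (\<tau> * (2 - \<tau>) * \<Lambda>)"
      using pos by (intro mult_left_mono) auto
    also have "\<dots> = N * exp (- \<Lambda> + \<tau> * (2 - \<tau>) * \<Lambda>)"
      by (subst \<delta>eq) (simp add: exp_add[symmetric])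
    also have "- \<Lambda> + \<tau> * (2 - \<tau>) * \<Lambda> = - ((1 - \<tau>)\<^sup>2 * \<Lambda>)" by (simp add: power2_eq_square algebra_simps)
    finally show ?thesis unfolding \<epsilon> .
  qed
  define \<rho> where "\<rho> = q / L"
  have ln\<rho>: "ln \<rho> = ln 4 + (1 - \<tau>) * ln q"
  proof -
    have "ln (4 * L) = ln 4 + ln L" using L1 by (subst ln_mult) auto
    then show ?thesis using lnL q L1 by (simp add: \<rho>_def ln_div algebra_simps)
  qed
  have \<rho>0: "\<rho> > 0" using q L1 by (simp add: \<rho>_def)
  have ln\<rho>_ge: "ln \<rho> \<ge> (1 - \<tau>) * D"
  proof -
    have "(1 - \<tau>) * ln 3 \<le> 1 * ln (3::real)" using \<tau>0 \<tau>1 by (intro mult_right_mono) auto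
    also have "\<dots> \<le> ln 4" by simp
    finally show ?thesis unfolding ln\<rho> D_def by (simp add: algebra_simps)
  qed
  have "ln \<rho> \<ge> 0" using ln\<rho>_ge D \<tau>1 by (intro order_trans[OF _ ln\<rho>_ge]) simp
  then have \<rho>1: "\<rho> \<ge> 1" using \<rho>0 by (simp add: ln_ge_zero_iff)
  have tail: "exp (r * (\<rho> * L) * \<sigma>) / \<rho> ^ n \<le> (\<delta> / N) powr ((1 - \<tau>)\<^sup>2)"
  proof -
    have e1: "r * (\<rho> * L) * \<sigma> = (1 - \<tau>) * \<Lambda>" using rsq L1 by (simp add: \<rho>_def mult_ac)
    have e2: "\<rho> ^ n = exp (real n * ln \<rho>)" using \<rho>0 by (simp add: exp_of_nat_mult)
    have "(2 - \<tau>) * \<Lambda> / D * ((1 - \<tau>) * D) \<le> real n * ln \<rho>"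
      using n_lo ln\<rho>_ge D \<tau>1 quo by (intro mult_mono) auto
    then have e3: "(2 - \<tau>) * (1 - \<tau>) * \<Lambda> \<le> real n * ln \<rho>" using D by (simp add: mult_ac)
    have "exp (r * (\<rho> * L) * \<sigma>) / \<rho> ^ n = exp ((1 - \<tau>) * \<Lambda> - real n * ln \<rho>)"
      unfolding e1 e2 by (simp add: exp_diff)
    also have "\<dots> \<le> exp (- ((1 - \<tau>)\<^sup>2 * \<Lambda>))"
    proof -
      have "(1 - \<tau>) * \<Lambda> - (2 - \<tau>) * (1 - \<tau>) * \<Lambda> = - ((1 - \<tau>)\<^sup>2 * \<Lambda>)"
        by (simp add: power2_eq_square algebra_simps)
      then show ?thesis using e3 by simp
    qed
    finally show ?thesis unfolding \<epsilon> .
  qed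
  show ?thesis by (rule that[OF z1 \<rho>1 zL n1 noise tail])
qed

lemma power_2_3_le_power_5: "d \<ge> 1 \<Longrightarrow> 2 ^ d + 3 ^ d \<le> (5::real) ^ d"
proof (induction d rule: nat_induct_at_least)
  case (Suc d)
  have "(2::real) ^ d \<ge> 0" "(3::real) ^ d \<ge> 0" by auto
  with Suc.IH show ?case unfolding power_Suc by linarith
qed simp

text \<open>
  Linearity of the coefficients separates the truncation error of \<open>fourier v\<close> from the amplified noise.
\<close>
lemma cheb_extension_error:
  fixes v w :: "real^'d \<Rightarrow> complex"
  assumes pos: "0 < r" "z \<ge> 1" "\<rho> \<ge> 1" "n \<ge> 1" "0 \<le> \<delta>" "0 \<le> N"
    and v: "integrable lebesgue v" and vN: "(LINT x|lebesgue. norm (v x)) \<le> (2 * pi) ^ CARD('d) * N"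
    and supp: "AE x in lebesgue. (\<Sum>j\<in>UNIV. \<bar>x $ j\<bar>) \<le> \<sigma> \<or> v x = 0"
    and wm: "w \<in> borel_measurable (lebesgue_on (cube r))"
    and noise: "AE \<xi> in lebesgue. \<xi> \<in> cube r \<longrightarrow> norm (w \<xi> - fourier v \<xi>) \<le> \<delta>"
    and \<xi>: "\<xi> \<in> cube (r * ((z + 1 / z) / 2))"
    and e1: "\<delta> * (2 * z) ^ (n - 1) \<le> N * \<epsilon>"
    and e2: "exp (r * (\<rho> * ((z + 1 / z) / 2)) * \<sigma>) / \<rho> ^ n \<le> \<epsilon>"
  shows "norm (fourier v \<xi> - cheb_sum r n (cheb_coeff r w) \<xi>) \<le> 5 ^ CARD('d) * (N * \<epsilon>)"
proof -
  let ?D = "{k::'d \<Rightarrow> nat. (\<Sum>j\<in>UNIV. k j) < n}"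
  let ?u = "\<lambda>\<xi>. fourier v \<xi> - w \<xi>"
  have Fm: "fourier v \<in> borel_measurable (lebesgue_on (cube r))"
    by (intro measurable_restrict_space1 borel_to_lebesgue fourier_borel borel_measurable_integrable[OF v])
  have um: "?u \<in> borel_measurable (lebesgue_on (cube r))" using Fm wm by (rule borel_measurable_diff)
  have un: "AE \<xi> in lebesgue. \<xi> \<in> cube r \<longrightarrow> norm (?u \<xi>) \<le> \<delta>"
    using noise by (simp add: norm_minus_commute)
  have FN: "AE \<xi> in lebesgue. \<xi> \<in> cube r \<longrightarrow> norm (fourier v \<xi>) \<le> (LINT x|lebesgue. norm (v x)) / (2 * pi) ^ CARD('d)"
    by (intro AE_I2 impI fourier_bounded)
  note bu = cheb_coeff_bound[OF pos(1) um un]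
  note bF = cheb_coeff_bound[OF pos(1) Fm FN]
  have split: "cheb_coeff r w k = cheb_coeff r (fourier v) k - cheb_coeff r ?u k" for k
    unfolding cheb_coeff_eq by (subst Bochner_Integration.integral_diff[symmetric, OF bF(1) bu(1)]) (simp add: algebra_simps)
  have "fourier v \<xi> - cheb_sum r n (cheb_coeff r w) \<xi> =
     (fourier v \<xi> - cheb_sum r n (cheb_coeff r (fourier v)) \<xi>) +
     cheb_sum r n (cheb_coeff r ?u) \<xi>"
    unfolding split left_diff_distrib sum_subtractf by simp
  also have "norm \<dots> \<le> norm (fourier v \<xi> - cheb_sum r n (cheb_coeff r (fourier v)) \<xi>) +
     norm (cheb_sum r n (cheb_coeff r ?u) \<xi>)"
    by (rule norm_triangle_ineq)
  also have "\<dots> \<le> N * (2 ^ CARD('d) * \<epsilon>) + 3 ^ CARD('d) * (N * \<epsilon>)"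
  proof (rule add_mono)
    have "norm (fourier v \<xi> - cheb_sum r n (cheb_coeff r (fourier v)) \<xi>)
      \<le> (LINT x|lebesgue. norm (v x)) / (2 * pi) ^ CARD('d) * (2 ^ CARD('d) / \<rho> ^ n * exp (r * (\<rho> * ((z + 1 / z) / 2)) * \<sigma>))"
      by (rule fourier_truncation[OF pos(1-3) \<xi> v supp])
    also have "2 ^ CARD('d) / \<rho> ^ n * exp (r * (\<rho> * ((z + 1 / z) / 2)) * \<sigma>) = 2 ^ CARD('d) * (exp (r * (\<rho> * ((z + 1 / z) / 2)) * \<sigma>) / \<rho> ^ n)"
      by simp
    also have "(LINT x|lebesgue. norm (v x)) / (2 * pi) ^ CARD('d) * \<dots> \<le> N * (2 ^ CARD('d) * \<epsilon>)"
      using vN e2 pos by (intro mult_mono mult_left_mono) (auto simp: pos_divide_le_eq mult.commute)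
    finally show "norm (fourier v \<xi> - cheb_sum r n (cheb_coeff r (fourier v)) \<xi>) \<le> N * (2 ^ CARD('d) * \<epsilon>)" .
    have "norm (cheb_sum r n (cheb_coeff r ?u) \<xi>) \<le> \<delta> * 3 ^ CARD('d) * (2 * z) ^ (n - 1)"
      by (rule noise_bound[OF pos(1,2,4,5) \<xi> bu(2)])
    also have "\<dots> = 3 ^ CARD('d) * (\<delta> * (2 * z) ^ (n - 1))" by simp
    also have "\<dots> \<le> 3 ^ CARD('d) * (N * \<epsilon>)" using e1 by (intro mult_left_mono) auto
    finally show "norm (cheb_sum r n (cheb_coeff r ?u) \<xi>) \<le> 3 ^ CARD('d) * (N * \<epsilon>)" .
  qed
  also have "\<dots> = (2 ^ CARD('d) + 3 ^ CARD('d)) * (N * \<epsilon>)" by (simp add: algebra_simps)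
  also have "\<dots> \<le> 5 ^ CARD('d) * (N * \<epsilon>)"
  proof (rule mult_right_mono)
    have "CARD('d) \<ge> 1" by (simp add: Suc_le_eq)
    then show "2 ^ CARD('d) + 3 ^ CARD('d) \<le> (5::real) ^ CARD('d)" by (rule power_2_3_le_power_5)
    have "0 \<le> \<delta> * (2 * z) ^ (n - 1)" using pos by simp
    then show "0 \<le> N * \<epsilon>" using e1 by linarith
  qed
  finally show ?thesis .
qed

lemma measure_cube: "c \<ge> 0 \<Longrightarrow> measure lebesgue (cube c :: (real^'d) set) = (2 * c) ^ CARD('d)"
proof -
  assume c: "c \<ge> 0"
  then have "(0::real^'d) \<in> cube c" by (simp add: mem_cube)
  then have "cbox (vec (- c)) (vec c :: real^'d) \<noteq> {}" unfolding cube_def by blast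
  then show ?thesis unfolding cube_def by (simp add: content_cbox_cart)
qed

lemma cube_indicator_integrable: "integrable lebesgue (\<lambda>x::real^'d. indicator (cube c) x :: real)"
  using lmeasurable_compact[OF compact_cube, of c] by (intro integrable_real_indicator) (auto simp: fmeasurable_def)

lemma bounded_on_cube_integrable:
  fixes u :: "real^'d \<Rightarrow> complex"
  assumes m: "u \<in> borel_measurable lebesgue" and bd: "AE x in lebesgue. norm (u x) \<le> B * indicator (cube c) x"
  shows "integrable lebesgue u" "square_integrable u"
proof -
  show "integrable lebesgue u"
    by (rule Bochner_Integration.integrable_bound[OF integrable_mult_right[OF cube_indicator_integrable, of B c] m])
       (use bd in \<open>eventually_elim, simp\<close>)
  have "integrable lebesgue (\<lambda>x. (norm (u x))\<^sup>2)"
  proof (rule Bochner_Integration.integrable_bound[OF integrable_mult_right[OF cube_indicator_integrable, of "B\<^sup>2" c]])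
    show "AE x in lebesgue. norm ((norm (u x))\<^sup>2) \<le> norm (B\<^sup>2 * indicator (cube c) x)"
      using bd
    proof eventually_elim
      case (elim x)
      then have "(norm (u x))\<^sup>2 \<le> (B * indicator (cube c) x)\<^sup>2" by (intro power_mono) auto
      then show ?case by (auto simp: indicator_def split: if_splits)
    qed
  qed (use m in measurable)
  then show "square_integrable u" using m by (simp add: square_integrable_def)
qed

theorem theorem3p1:
  fixes v w :: "real^'d \<Rightarrow> complex"
    and N \<delta> r \<sigma> \<gamma> \<tau> :: real
    and m :: nat
  assumes "N > 0" "\<delta> > 0" "r > 0" "\<sigma> > 0"
    and "integrable lebesgue v"
    and "(LINT x|lebesgue. norm (v x)) \<le> (2 * pi) ^ CARD('d) * N"
    and "ess_support v \<subseteq> {x. (\<Sum>j\<in>UNIV. \<bar>x $ j\<bar>) \<le> \<sigma>}"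
    and "w \<in> borel_measurable (lebesgue_on (cube r))"
    and "esssup (lebesgue_on (cube r)) (\<lambda>\<xi>. ereal (norm (w \<xi> - fourier v \<xi>))) \<le> ereal \<delta>"
    and "\<delta> < N"
    and "m > 0"
    and "in_Sobolev m v"
    and "\<gamma> > 0"
    and "Sobolev_seminorm m v \<le> \<gamma>"
    and "0 \<le> \<tau>" "\<tau> \<le> 1"
  shows "square_integrable (\<lambda>x. v x - inv_fourier (cheb_star N r \<sigma> \<tau> \<delta> w) x) \<and>
    L2_norm (\<lambda>x. v x - inv_fourier (cheb_star N r \<sigma> \<tau> \<delta> w) x)
      \<le> (20 * sqrt r) ^ CARD('d) * N
           * L_tau N r \<sigma> \<tau> \<delta> powr (real CARD('d) / 2 + 1)
           * (\<delta> / N) powr ((1 - \<tau>)\<^sup>2)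
         + \<gamma> * (r * L_tau N r \<sigma> \<tau> \<delta>) powi (- int m)"
proof -
  note N = assms(1) and \<delta> = assms(2) and r = assms(3) and \<sigma> = assms(4) and v = assms(5) and vN = assms(6)
  note wm = assms(8) and \<delta>N = assms(10) and S = assms(12) and \<gamma> = assms(13) and S\<gamma> = assms(14) and \<tau> = assms(15,16)
  let ?d = "CARD('d)"
  define L where "L = L_tau N r \<sigma> \<tau> \<delta>"
  define n where "n = n_tau N r \<sigma> \<tau> \<delta>"
  define R where "R = r * L"
  define \<epsilon> where "\<epsilon> = (\<delta> / N) powr ((1 - \<tau>)\<^sup>2)"
  define u where "u = cheb_star N r \<sigma> \<tau> \<delta> w"
  define p where "p \<xi> = cheb_sum r n (cheb_coeff r w) \<xi>" for \<xi> :: "real^'d"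
  define B where "B = 5 ^ ?d * (N * \<epsilon>)"
  have L1: "L \<ge> 1" by (simp add: L_def L_tau_def)
  have R: "R \<ge> r" "R > 0" using L1 r by (auto simp: R_def)
  have \<epsilon>0: "\<epsilon> > 0" using N \<delta> by (simp add: \<epsilon>_def)
  have B0: "B \<ge> 0" using N \<epsilon>0 by (simp add: B_def)
  have u: "u \<xi> = (if \<xi> \<in> cube r then w \<xi> else if \<xi> \<in> cube R then p \<xi> else 0)" for \<xi>
    unfolding u_def cheb_star_def cheb_extend_def p_def cheb_prod_def n_def R_def R_tau_def L_def ..
  have supp: "AE x in lebesgue. (\<Sum>j\<in>UNIV. \<bar>x $ j\<bar>) \<le> \<sigma> \<or> v x = 0"
    using ess_support_AE[of v] by eventually_elim (use assms(7) in auto)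
  have supp': "AE x in lebesgue. x \<notin> cube \<sigma> \<longrightarrow> v x = 0"
    using supp
  proof eventually_elim
    case (elim x)
    have "x \<in> cube \<sigma>" if "(\<Sum>j\<in>UNIV. \<bar>x $ j\<bar>) \<le> \<sigma>"
    proof -
      have "\<bar>x $ j\<bar> \<le> (\<Sum>j\<in>UNIV. \<bar>x $ j\<bar>)" for j by (rule member_le_sum) auto
      then show ?thesis using that unfolding mem_cube by (meson order_trans)
    qed
    then show ?case using elim by blast
  qed
  have noise: "AE \<xi> in lebesgue. \<xi> \<in> cube r \<longrightarrow> norm (w \<xi> - fourier v \<xi>) \<le> \<delta>"
  proof -
    have "AE \<xi> in lebesgue_on (cube r). norm (w \<xi> - fourier v \<xi>) \<le> \<delta>"
      using esssup_AE[of "\<lambda>\<xi>. ereal (norm (w \<xi> - fourier v \<xi>))" "lebesgue_on (cube r)"]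
    proof eventually_elim
      case (elim \<xi>)
      then have "ereal (norm (w \<xi> - fourier v \<xi>)) \<le> ereal \<delta>" using assms(9) by (rule order_trans)
      then show ?case by simp
    qed
    then show ?thesis by (subst (asm) AE_restrict_space_iff) auto
  qed
  have Fm [measurable]: "fourier v \<in> borel_measurable lebesgue"
    by (intro borel_to_lebesgue fourier_borel borel_measurable_integrable[OF v])
  have pm: "p \<in> borel_measurable lebesgue"
    unfolding p_def cheb_prod_def
    by (intro borel_to_lebesgue borel_measurable_continuous_onI continuous_intros) (use r in auto)
  have um: "u \<in> borel_measurable lebesgue"
  proof -
    have "(\<lambda>\<xi>. indicator (cube r) \<xi> *\<^sub>R w \<xi>) \<in> borel_measurable lebesgue"
      using wm by (subst (asm) borel_measurable_restrict_space_iff) auto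
    moreover have "(\<lambda>\<xi>. indicator (cube R - cube r) \<xi> *\<^sub>R p \<xi>) \<in> borel_measurable lebesgue"
      using pm by (intro borel_measurable_scaleR borel_measurable_indicator) auto
    ultimately have "(\<lambda>\<xi>. indicator (cube r) \<xi> *\<^sub>R w \<xi> + indicator (cube R - cube r) \<xi> *\<^sub>R p \<xi>) \<in> borel_measurable lebesgue"
      by (rule borel_measurable_add)
    also have "(\<lambda>\<xi>. indicator (cube r) \<xi> *\<^sub>R w \<xi> + indicator (cube R - cube r) \<xi> *\<^sub>R p \<xi>) = u"
      by (auto simp: u indicator_def)
    finally show ?thesis .
  qed
  have err: "AE \<xi> in lebesgue. \<xi> \<in> cube R \<longrightarrow> norm (fourier v \<xi> - u \<xi>) \<le> B"
    using noise
  proof eventually_elim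
    case (elim \<xi>)
    show ?case
    proof
      assume \<xi>: "\<xi> \<in> cube R"
      show "norm (fourier v \<xi> - u \<xi>) \<le> B"
      proof (cases "\<xi> \<in> cube r")
        case True
        have "\<delta> / N = (\<delta> / N) powr 1" using N \<delta> by simp
        also have "\<dots> \<le> \<epsilon>" unfolding \<epsilon>_def
          using N \<delta> \<delta>N \<tau> by (intro powr_mono') (auto simp: power_le_one)
        finally have "\<delta> \<le> N * \<epsilon>" using N by (simp add: pos_divide_le_eq mult.commute)
        also have "\<dots> \<le> B" unfolding B_def using N \<epsilon>0 by simp
        finally show ?thesis using elim True by (simp add: u norm_minus_commute)
      next
        case False
        have "L > 1"
        proof (rule ccontr)
          assume "\<not> L > 1"
          then have "R = r" using L1 by (simp add: R_def)
          then show False using False \<xi> by simp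
        qed
        then obtain z \<rho> where z: "z \<ge> 1" "\<rho> \<ge> 1" "(z + 1 / z) / 2 = L" "n \<ge> 1"
            "\<delta> * (2 * z) ^ (n - 1) \<le> N * \<epsilon>" "exp (r * (\<rho> * L) * \<sigma>) / \<rho> ^ n \<le> \<epsilon>"
          using extrapolation_parameters[of \<delta> N r \<sigma> \<tau>] \<delta> \<delta>N r \<sigma> \<tau> unfolding L_def n_def \<epsilon>_def by blast
        have "norm (fourier v \<xi> - p \<xi>) \<le> B" unfolding p_def B_def
          by (rule cheb_extension_error[OF r z(1,2,4) _ _ v vN supp wm noise]) (use z \<xi> \<delta> N in \<open>auto simp: R_def\<close>)
        then show ?thesis using False \<xi> by (simp add: u)
      qed
    qed
  qed
  have FN: "norm (fourier v \<xi>) \<le> N" for \<xi>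
  proof -
    have "norm (fourier v \<xi>) \<le> (LINT x|lebesgue. norm (v x)) / (2 * pi) ^ ?d" by (rule fourier_bounded)
    also have "\<dots> \<le> N" using vN by (simp add: pos_divide_le_eq mult.commute)
    finally show ?thesis .
  qed
  have off: "u \<xi> = 0" if "\<xi> \<notin> cube R" for \<xi>
    using that cube_mono[of \<xi> r R] R by (auto simp: u)
  have ub: "AE \<xi> in lebesgue. norm (u \<xi>) \<le> (B + N) * indicator (cube R) \<xi>"
    using err
  proof eventually_elim
    case (elim \<xi>)
    show ?case
    proof (cases "\<xi> \<in> cube R")
      case True
      have "norm (u \<xi>) \<le> norm (fourier v \<xi> - u \<xi>) + norm (fourier v \<xi>)"
        using norm_triangle_ineq3[of "u \<xi>" "fourier v \<xi>"] by (simp add: norm_minus_commute)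
      then show ?thesis using elim True FN[of \<xi>] by simp
    qed (simp add: off)
  qed
  have v2: "square_integrable v" using S by (simp add: in_Sobolev_def)
  note inv = L2_inverse_fourier_diff[OF v v2 bounded_on_cube_integrable[OF um ub]]
  have F2: "integrable lebesgue (\<lambda>\<xi>. (norm (fourier v \<xi>))\<^sup>2)"
    using fourier_L2(1)[OF v v2] by (simp add: square_integrable_def)
  define T where "T = (LINT \<xi>|lebesgue. indicator (- cube R) \<xi> * (norm (fourier v \<xi>))\<^sup>2)"
  have T: "(2 * pi) ^ ?d * (R ^ m)\<^sup>2 * T \<le> \<gamma>\<^sup>2"
  proof -
    have "(2 * pi) ^ ?d * (R ^ m)\<^sup>2 * T \<le> (Sobolev_seminorm m v)\<^sup>2"
      unfolding T_def by (rule Sobolev_fourier_tail[OF S v supp']) (use \<sigma> R in auto)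
    also have "\<dots> \<le> \<gamma>\<^sup>2" using S\<gamma> by (intro power_mono) (auto simp: Sobolev_seminorm_def intro!: real_sqrt_ge_zero sum_nonneg)
    finally show ?thesis .
  qed
  have Ti: "integrable lebesgue (\<lambda>\<xi>. indicator (- cube R) \<xi> * (norm (fourier v \<xi>))\<^sup>2)"
    using integrable_mult_indicator[OF _ F2, of "- cube R"] by simp
  have "(L2_norm (\<lambda>\<xi>. fourier v \<xi> - u \<xi>))\<^sup>2 \<le> (LINT \<xi>|lebesgue. B\<^sup>2 * indicator (cube R) \<xi> + indicator (- cube R) \<xi> * (norm (fourier v \<xi>))\<^sup>2)"
    unfolding L2_norm_power2
  proof (rule integral_mono_AE')
    show "integrable lebesgue (\<lambda>\<xi>. B\<^sup>2 * indicator (cube R) \<xi> + indicator (- cube R) \<xi> * (norm (fourier v \<xi>))\<^sup>2)"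
      by (intro Bochner_Integration.integrable_add integrable_mult_right cube_indicator_integrable Ti)
    show "AE \<xi> in lebesgue. (norm (fourier v \<xi> - u \<xi>))\<^sup>2 \<le> B\<^sup>2 * indicator (cube R) \<xi> + indicator (- cube R) \<xi> * (norm (fourier v \<xi>))\<^sup>2"
      using err
    proof eventually_elim
      case (elim \<xi>)
      then show ?case by (cases "\<xi> \<in> cube R") (auto simp: off intro!: power_mono)
    qed
  qed (auto simp: indicator_def)
  also have "\<dots> = B\<^sup>2 * (2 * R) ^ ?d + T"
    using Ti cube_indicator_integrable[of R] measure_cube[of R, where 'd='d] R
    by (subst Bochner_Integration.integral_add) (auto simp: T_def)
  finally have E2: "(2 * pi) ^ ?d * (L2_norm (\<lambda>\<xi>. fourier v \<xi> - u \<xi>))\<^sup>2 \<le> (2 * pi) ^ ?d * (B\<^sup>2 * (2 * R) ^ ?d + T)"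
    by (intro mult_left_mono) auto
  let ?a = "sqrt ((4 * pi * R) ^ ?d) * B"
  let ?b = "\<gamma> / R ^ m"
  have a0: "?a \<ge> 0" using R B0 by simp
  have b0: "?b \<ge> 0" using R \<gamma> by simp
  have "(L2_norm (\<lambda>x. v x - inv_fourier u x))\<^sup>2 \<le> (2 * pi) ^ ?d * (B\<^sup>2 * (2 * R) ^ ?d + T)"
    using inv(2) E2 by (rule order_trans)
  also have "\<dots> = ?a\<^sup>2 + (2 * pi) ^ ?d * T"
  proof -
    have "4 * pi * R = 2 * pi * (2 * R)" by simp
    then have "(4 * pi * R) ^ ?d = (2 * pi) ^ ?d * (2 * R) ^ ?d" by (metis power_mult_distrib)
    moreover have "(sqrt ((4 * pi * R) ^ ?d))\<^sup>2 = (4 * pi * R) ^ ?d" using R by (intro real_sqrt_pow2) simp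
    ultimately have "?a\<^sup>2 = (2 * pi) ^ ?d * (2 * R) ^ ?d * B\<^sup>2" unfolding power_mult_distrib[of _ B] by simp
    then show ?thesis by (simp only: distrib_left mult_ac)
  qed
  also have "(2 * pi) ^ ?d * T \<le> ?b\<^sup>2"
    using T R by (simp add: power_divide pos_le_divide_eq mult_ac)
  also have "?a\<^sup>2 + ?b\<^sup>2 \<le> (?a + ?b)\<^sup>2"
  proof -
    have "a\<^sup>2 + b\<^sup>2 \<le> (a + b)\<^sup>2" if "a \<ge> 0" "b \<ge> 0" for a b :: real
      using that by (simp add: power2_sum)
    then show ?thesis using a0 b0 .
  qed
  finally have "(L2_norm (\<lambda>x. v x - inv_fourier u x))\<^sup>2 \<le> (?a + ?b)\<^sup>2" by simp
  then have "L2_norm (\<lambda>x. v x - inv_fourier u x) \<le> ?a + ?b"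
    by (rule power2_le_imp_le) (use a0 b0 in auto)
  also have "?a \<le> (20 * sqrt r) ^ ?d * N * L powr (real ?d / 2 + 1) * \<epsilon>"
  proof -
    have "sqrt ((4 * pi * R) ^ ?d) = sqrt (4 * pi) ^ ?d * sqrt r ^ ?d * sqrt L ^ ?d"
      by (simp add: R_def real_sqrt_mult real_sqrt_power power_mult_distrib)
    then have "?a = (sqrt (4 * pi) * 5 * sqrt r) ^ ?d * N * sqrt L ^ ?d * \<epsilon>"
      by (simp add: B_def power_mult_distrib)
    also have "\<dots> \<le> (20 * sqrt r) ^ ?d * N * L powr (real ?d / 2 + 1) * \<epsilon>"
    proof (intro mult_right_mono mult_mono power_mono)
      have "sqrt (4 * pi) \<le> 4" using pi_less_4 by (intro real_le_lsqrt) auto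
      then show "sqrt (4 * pi) * 5 \<le> 20" by simp
      have "sqrt L ^ ?d = L powr (real ?d / 2)"
        using L1 by (simp add: powr_half_sqrt[symmetric] powr_powr flip: powr_realpow)
      also have "\<dots> \<le> L powr (real ?d / 2 + 1)" using L1 by (intro powr_mono) auto
      finally show "sqrt L ^ ?d \<le> L powr (real ?d / 2 + 1)" .
    qed (use N r L1 \<epsilon>0 in auto)
    finally show ?thesis .
  qed
  also have "?b = \<gamma> * (r * L) powi (- int m)"
    by (simp add: R_def power_int_minus divide_inverse)
  finally show ?thesis using inv(1) unfolding u_def L_def \<epsilon>_def by simp
qed

end
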